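(* Let $R>0$ and let $k\ge2$ be an integer. Then $(\lambda_k,0)=(R\sqrt{k^2-1},0)\in(0,+\infty)\times Y_{\rm rev}$ is a bifurcation point of the projected reversible operator $\widehat{\mathcal G}_{\rm rev}:(0,+\infty)\times Y_{\rm rev}\to\widehat Z_{\rm rev}$ from the trivial branch $\mathcal T=\{(\lambda,0):\lambda>0\}$. Let $$Y^k_{\rm rev}:=\{\mathbf u\in Y_{\rm rev}:(\mathbf u,\mathbf v_k^{(2)})_{H^2}=0\}.$$ Then the following statements hold. (a) Existence. There exist $\delta>0$, a neighbourhood of $(\lambda_k,0)$, and two $\mathcal C^\infty$-maps $$\Lambda_k:(-\delta,\delta)\to(0,+\infty),\ \Lambda_k(0)=\lambda_k,\qquad \Gamma_k:(-\delta,\delta)\to Y^k_{\rm rev},\ \Gamma_k(0)=0,$$ such that, for every $t\in(-\delta,\delta)$, $$\widehat{\mathcal G}_{\rm rev}(\Lambda_k(t),\mathbf u_k(t))=0,\qquad \mathbf u_k(t):=t\big(\mathbf v_k^{(2)}+\Gamma_k(t)\big).$$ In particular, $\mathbf u_k'(0)=\mathbf v_k^{(2)}$. (b) Local uniqueness. There exists $\rho>0$ such that, if $\widehat{\mathcal G}_{\rm rev}(\lambda,\mathbf u)=0$ and $(\lambda,\mathbf u)\in B_\rho(\lambda_k,0)\subset(0,+\infty)\times Y_{\rm rev}$, then either $\mathbf u=0$, or there exists $t\in(-\delta,\delta)$ such that $(\lambda,\mathbf u)=(\Lambda_k(t),\mathbf u_k(t))$. Moreover, after possibly reducing $\rho$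 and $\delta$, the curve $t\mapsto(\Lambda_k(t),\mathbf u_k(t))$, $t\in(-\delta,\delta)$, is also a curve of zeros of the full augmented operator $\mathcal G$. Equivalently, if $\mathbf x_k(t):=\mathbf x_0+\mathbf u_k(t)$, then, for every $t\in(-\delta,\delta)$, $$\mathbf x_k(t)\times\mathbf x_k(t)''-\Lambda_k(t)e_3\times\mathbf x_k(t)+\Lambda_k(t)\mathbf x_k(t)'=0,\qquad \|\mathbf x_k(t)(\eta)\|\equiv R.$$
   Context: Fix $R>0$; $\mathbb T=\mathbb R/2\pi\mathbb Z$, primes on functions of $\eta\in\mathbb T$ are derivatives in $\eta$, $\mathbf x_0(\eta)=(R\cos\eta,R\sin\eta,0)$, $E_2(\eta)=(-\sin\eta,\cos\eta,0)$, $E_3=e_3=(0,0,1)$. For $\lambda>0$, $\mathbf u\in H^2(\mathbb T,\mathbb R^3)$: $\mathcal F(\lambda,\mathbf u)=\mathbf x_0\times\mathbf u''+\mathbf u\times\mathbf x_0''+\mathbf u\times\mathbf u''-\lambda e_3\times\mathbf u+\lambda\mathbf u'$, $\mathcal C(\mathbf u)=\mathbf x_0\cdot\mathbf u+\frac12\|\mathbf u\|^2$ (pointwise), $\mathcal G(\lambda,\mathbf u)=(\mathcal F(\lambda,\mathbf u),\mathcal C(\mathbf u))\in L^2(\mathbb T,\mathbb R^3)\times H^2(\mathbb T)$. With $S=\mathrm{diag}(1,-1,1)$, $Y_{\rm rev}=\{\mathbf u\in H^2(\mathbb T,\mathbb R^3):S\mathbf u(-\eta)=\mathbf u(\eta)\}$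 and $\widehat Z_{\rm rev}=L^2_{\rm even}(\mathbb T)\times L^2_{\rm odd}(\mathbb T)\times H^2_{\rm even}(\mathbb T)$. The projected reversible operator is $\widehat{\mathcal G}_{\rm rev}(\lambda,\mathbf u)=\big(\mathcal F(\lambda,\mathbf u)\cdot E_2,\ \mathcal F(\lambda,\mathbf u)\cdot E_3,\ \mathcal C(\mathbf u)\big)$ for $\mathbf u\in Y_{\rm rev}$. $\mathbf v_k^{(2)}(\eta)=\sin(k\eta)E_2(\eta)-\frac{k}{\sqrt{k^2-1}}\cos(k\eta)E_3$. $(\cdot,\cdot)_{H^2}$ is the inner product of $H^2(\mathbb T,\mathbb R^3)$; $B_\rho$ is the open ball of radius $\rho$. In (a), $\mathbf u_k'(0)$ is the derivative in $t$. A bifurcation point from $\mathcal T$ is a point of $\mathcal T$ that is a limit of zeros $(\lambda,\mathbf u)$ with $\mathbf u\neq0$. *)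

theory Defs
  imports "HOL-Analysis.Analysis"
begin

section \<open>Function spaces on the circle\<close>

text \<open>Functions on the circle are 2 pi-periodic functions on the real line.\<close>

definition periodic :: "(real \<Rightarrow> 'a) \<Rightarrow> bool" where
  "periodic f \<longleftrightarrow> (\<forall>\<eta>. f (\<eta> + 2 * pi) = f \<eta>)"

definition D1 :: "(real \<Rightarrow> 'a::real_normed_vector) \<Rightarrow> real \<Rightarrow> 'a" where
  "D1 f \<eta> = vector_derivative f (at \<eta>)"

definition D2 :: "(real \<Rightarrow> 'a::real_normed_vector) \<Rightarrow> real \<Rightarrow> 'a" where
  "D2 f = D1 (D1 f)"

text \<open>Representatives of square-integrable classes; equality in \<open>L\<^sup>2\<close> is equality almost everywhere.\<close>

definition L2 :: "(real \<Rightarrow> 'a::euclidean_space) \<Rightarrow> bool" where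
  "L2 f \<longleftrightarrow> periodic f \<and> f \<in> borel_measurable lebesgue \<and>
     set_integrable lebesgue {0..2 * pi} (\<lambda>\<eta>. (norm (f \<eta>))\<^sup>2)"

text \<open>An element of \<open>H\<^sup>2\<close> of the circle is identified with its continuously differentiable
  representative: \<open>f\<close> is differentiable, \<open>f'\<close> is absolutely continuous (differentiable almost
  everywhere and the integral of its derivative), and \<open>f''\<close> is square integrable. The value of
  \<open>D2 f\<close> is arbitrary on the null set where \<open>f'\<close> is not differentiable.\<close>

definition H2 :: "(real \<Rightarrow> 'a::euclidean_space) \<Rightarrow> bool" where
  "H2 f \<longleftrightarrow> periodic f \<and> (\<forall>\<eta>. f differentiable at \<eta>) \<and>
     (AE \<eta> in lebesgue. D1 f differentiable at \<eta>) \<and> L2 (D2 f) \<and>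
     (\<forall>a b. a \<le> b \<longrightarrow> (D2 f has_integral (D1 f b - D1 f a)) {a..b})"

lemma periodic_D1:
  assumes "periodic f" shows "periodic (D1 f)"
proof -
  have "(f has_vector_derivative d) (at (x + 2 * pi)) \<longleftrightarrow> (f has_vector_derivative d) (at x)" for d x
  proof -
    have 1: "f = f \<circ> (\<lambda>x. x + 2 * pi)"
      using assms by (auto simp: periodic_def)
    have 2: "f = f \<circ> (\<lambda>x. x - 2 * pi)"
      using assms by (auto simp: periodic_def fun_eq_iff) (metis diff_add_cancel)
    show ?thesis
    proof
      assume a: "(f has_vector_derivative d) (at (x + 2 * pi))"
      have "((f \<circ> (\<lambda>x. x + 2 * pi)) has_vector_derivative (1 *\<^sub>R d)) (at x)"
        by (rule vector_diff_chain_at) (auto intro!: derivative_eq_intros simp: a)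
      then show "(f has_vector_derivative d) (at x)" using 1 by simp
    next
      assume a: "(f has_vector_derivative d) (at x)"
      have "((f \<circ> (\<lambda>x. x - 2 * pi)) has_vector_derivative (1 *\<^sub>R d)) (at (x + 2 * pi))"
        by (rule vector_diff_chain_at) (auto intro!: derivative_eq_intros simp: a)
      then show "(f has_vector_derivative d) (at (x + 2 * pi))" using 2 by simp
    qed
  qed
  then show ?thesis by (simp add: periodic_def D1_def vector_derivative_def)
qed

lemma periodic_D2: "periodic f \<Longrightarrow> periodic (D2 f)"
  by (simp add: D2_def periodic_D1)

lemma D1_works: "f differentiable at x \<Longrightarrow> (f has_vector_derivative D1 f x) (at x)"
  by (simp add: D1_def vector_derivative_works)

lemma D1_eqI: "(f has_vector_derivative d) (at x) \<Longrightarrow> D1 f x = d"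
  by (simp add: D1_def vector_derivative_at)

lemma L2_AE_cong:
  assumes "L2 f" "periodic g" "AE x in lebesgue. f x = g x"
  shows "L2 g"
proof -
  have m: "g \<in> borel_measurable lebesgue"
    using borel_measurable_AE[OF _ assms(3)] assms(1) by (auto simp: L2_def)
  have mg: "(\<lambda>\<eta>. indicat_real {0..2*pi} \<eta> *\<^sub>R (norm (g \<eta>))\<^sup>2) \<in> borel_measurable lebesgue"
    by (intro borel_measurable_scaleR borel_measurable_indicator borel_measurable_power
        measurable_compose[OF m borel_measurable_norm]) simp
  have "set_integrable lebesgue {0..2*pi} (\<lambda>\<eta>. (norm (f \<eta>))\<^sup>2)"
    using assms(1) by (simp add: L2_def)
  then have "set_integrable lebesgue {0..2*pi} (\<lambda>\<eta>. (norm (g \<eta>))\<^sup>2)"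
    unfolding set_integrable_def
    by (rule integrable_cong_AE_imp[OF _ mg]) (use assms(3) in auto)
  then show ?thesis using m assms(2) by (simp add: L2_def)
qed

lemma L2_inner_integrable:
  assumes "L2 f" "L2 g"
  shows "set_integrable lebesgue {0..2*pi} (\<lambda>\<eta>. f \<eta> \<bullet> g \<eta>)"
proof -
  have m: "f \<in> borel_measurable lebesgue" "g \<in> borel_measurable lebesgue"
    and i: "set_integrable lebesgue {0..2*pi} (\<lambda>\<eta>. (norm (f \<eta>))\<^sup>2 + (norm (g \<eta>))\<^sup>2)"
    using assms by (auto simp: L2_def)
  have le: "\<bar>a \<bullet> b\<bar> \<le> (norm a)\<^sup>2 + (norm b)\<^sup>2" for a b :: 'a
  proof -
    have "2 * (norm a * norm b) \<le> (norm a)\<^sup>2 + (norm b)\<^sup>2"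
      using sum_squares_bound[of "norm a" "norm b"] by simp
    moreover have "0 \<le> norm a * norm b" by simp
    ultimately show ?thesis using Cauchy_Schwarz_ineq2[of a b] by linarith
  qed
  show ?thesis
    using i unfolding set_integrable_def
  proof (rule Bochner_Integration.integrable_bound)
    show "(\<lambda>x. indicat_real {0..2*pi} x *\<^sub>R (f x \<bullet> g x)) \<in> borel_measurable lebesgue"
      by (intro borel_measurable_scaleR borel_measurable_indicator borel_measurable_inner m) simp
  qed (use le in \<open>auto simp: indicator_def\<close>)
qed

lemma L2_add:
  assumes "L2 f" "L2 g" shows "L2 (\<lambda>x. f x + g x)"
proof -
  have "set_integrable lebesgue {0..2*pi} (\<lambda>\<eta>. (norm (f \<eta>))\<^sup>2 + (norm (g \<eta>))\<^sup>2 + 2 * (f \<eta> \<bullet> g \<eta>))"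
    using assms L2_inner_integrable[OF assms]
    by (intro set_integral_add set_integrable_mult_right) (auto simp: L2_def)
  moreover have "(norm (a + b))\<^sup>2 = (norm a)\<^sup>2 + (norm b)\<^sup>2 + 2 * (a \<bullet> b)" for a b :: 'a
    by (simp add: power2_norm_eq_inner inner_simps inner_commute)
  ultimately show ?thesis
    using assms by (auto simp: L2_def periodic_def)
qed

lemma L2_scaleR:
  assumes "L2 f" shows "L2 (\<lambda>x. c *\<^sub>R f x)"
  using assms by (auto simp: L2_def periodic_def power_mult_distrib)

lemma L2_continuous:
  assumes "periodic f" "continuous_on UNIV f" shows "L2 f"
proof -
  have "f \<in> borel_measurable lebesgue"
    using assms(2) by (simp add: borel_measurable_continuous_onI measurable_completion)
  moreover have "set_integrable lborel {0..2*pi} (\<lambda>\<eta>. (norm (f \<eta>))\<^sup>2)"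
    by (rule borel_integrable_atLeastAtMost')
       (intro continuous_intros continuous_on_subset[OF assms(2)], auto)
  then have "set_integrable lebesgue {0..2*pi} (\<lambda>\<eta>. (norm (f \<eta>))\<^sup>2)"
    by (simp add: set_integrable_def integrable_completion)
  ultimately show ?thesis using assms(1) by (simp add: L2_def)
qed

lemma H2_continuous: "H2 f \<Longrightarrow> continuous_on UNIV f"
  by (auto simp: H2_def intro!: continuous_at_imp_continuous_on differentiable_imp_continuous_within)

lemma H2_D1_continuous:
  assumes "H2 f" shows "continuous_on UNIV (D1 f)"
proof -
  have "isCont (D1 f) x" for x
  proof -
    have *: "(D2 f has_integral (D1 f b - D1 f a)) {a..b}" if "a \<le> b" for a b
      using assms that by (simp add: H2_def)
    have "continuous_on {x-1..x+1} (\<lambda>y. integral {x-1..y} (D2 f) + D1 f (x-1))"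
      by (intro continuous_intros indefinite_integral_continuous_1 has_integral_integrable[OF *]) simp
    moreover have "integral {x-1..y} (D2 f) + D1 f (x-1) = D1 f y" if "y \<in> {x-1..x+1}" for y
      using integral_unique[OF *[of "x-1" y]] that by simp
    ultimately have "continuous_on {x-1..x+1} (D1 f)"
      by (rule continuous_on_eq)
    then show ?thesis
      by (rule continuous_on_interior) simp
  qed
  then show ?thesis by (simp add: continuous_at_imp_continuous_on)
qed

lemma H2_L2:
  assumes "H2 f" shows "L2 f" "L2 (D1 f)" "L2 (D2 f)"
proof -
  have p: "periodic f" using assms by (simp add: H2_def)
  show "L2 f" by (rule L2_continuous[OF p H2_continuous[OF assms]])
  show "L2 (D1 f)" by (rule L2_continuous[OF periodic_D1[OF p] H2_D1_continuous[OF assms]])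
  show "L2 (D2 f)" using assms by (simp add: H2_def)
qed

lemma H2_lincomb:
  assumes "H2 f" "H2 g"
  shows "H2 (\<lambda>x. c *\<^sub>R f x + d *\<^sub>R g x)"
    and "D1 (\<lambda>x. c *\<^sub>R f x + d *\<^sub>R g x) = (\<lambda>x. c *\<^sub>R D1 f x + d *\<^sub>R D1 g x)"
    and "AE x in lebesgue. D2 (\<lambda>x. c *\<^sub>R f x + d *\<^sub>R g x) x = c *\<^sub>R D2 f x + d *\<^sub>R D2 g x"
proof -
  let ?h = "\<lambda>x. c *\<^sub>R f x + d *\<^sub>R g x"
  have df: "f differentiable at x" "g differentiable at x" for x
    using assms by (auto simp: H2_def)
  have per: "periodic ?h" using assms by (auto simp: H2_def periodic_def)
  show D1: "D1 ?h = (\<lambda>x. c *\<^sub>R D1 f x + d *\<^sub>R D1 g x)"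
    by (rule ext, rule D1_eqI) (auto intro!: derivative_eq_intros D1_works df)
  have "AE x in lebesgue. D1 f differentiable at x \<and> D1 g differentiable at x"
    using assms by (auto simp: H2_def)
  then have ae: "AE x in lebesgue. D1 ?h differentiable at x \<and>
      c *\<^sub>R D2 f x + d *\<^sub>R D2 g x = D2 ?h x"
  proof (rule AE_mp, intro AE_I2 impI)
    fix x assume a: "D1 f differentiable at x \<and> D1 g differentiable at x"
    have "(D1 ?h has_vector_derivative (c *\<^sub>R D2 f x + d *\<^sub>R D2 g x)) (at x)"
      unfolding D1 D2_def using a by (auto intro!: derivative_eq_intros D1_works)
    then show "D1 ?h differentiable at x \<and> c *\<^sub>R D2 f x + d *\<^sub>R D2 g x = D2 ?h x"
      by (auto simp: D2_def D1_eqI intro: differentiableI_vector)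
  qed
  then have ae2: "AE x in lebesgue. c *\<^sub>R D2 f x + d *\<^sub>R D2 g x = D2 ?h x"
    by (rule AE_mp) auto
  then show "AE x in lebesgue. D2 ?h x = c *\<^sub>R D2 f x + d *\<^sub>R D2 g x"
    by (rule AE_mp) auto
  have L: "L2 (D2 ?h)"
    by (rule L2_AE_cong[OF _ periodic_D2[OF per] ae2])
       (intro L2_add L2_scaleR H2_L2(3) assms)
  obtain N where N: "{x. c *\<^sub>R D2 f x + d *\<^sub>R D2 g x \<noteq> D2 ?h x} \<subseteq> N" "negligible N"
    using ae2 by (auto elim!: AE_E simp: negligible_iff_null_sets null_sets_def)
  have "(D2 ?h has_integral (D1 ?h b - D1 ?h a)) {a..b}" if "a \<le> b" for a b
  proof -
    have "((\<lambda>x. c *\<^sub>R D2 f x + d *\<^sub>R D2 g x) has_integral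
        (c *\<^sub>R (D1 f b - D1 f a) + d *\<^sub>R (D1 g b - D1 g a))) {a..b}"
      using assms that by (intro has_integral_add has_integral_cmul) (auto simp: H2_def)
    then have "(D2 ?h has_integral
        (c *\<^sub>R (D1 f b - D1 f a) + d *\<^sub>R (D1 g b - D1 g a))) {a..b}"
      by (rule has_integral_spike[OF N(2), rotated]) (use N(1) in force)
    then show ?thesis by (simp add: D1 algebra_simps)
  qed
  moreover have "AE x in lebesgue. D1 ?h differentiable at x"
    using ae by (rule AE_mp) auto
  moreover have "?h differentiable at x" for x using df by (intro derivative_intros) auto
  ultimately show "H2 ?h" using per L by (simp add: H2_def)
qed

lemma H2_C2:
  assumes "periodic f" "\<And>x. (f has_vector_derivative f' x) (at x)"
    "\<And>x. (f' has_vector_derivative f'' x) (at x)" "continuous_on UNIV f''"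
  shows "H2 f"
proof -
  have 1: "D1 f = f'" by (rule ext) (rule D1_eqI[OF assms(2)])
  have 2: "D2 f = f''" unfolding D2_def 1 by (rule ext) (rule D1_eqI[OF assms(3)])
  have "L2 (D2 f)" using periodic_D2[OF assms(1)] assms(4) 2 by (simp add: L2_continuous)
  moreover have "(f'' has_integral (f' b - f' a)) {a..b}" if "a \<le> b" for a b
    using that by (rule fundamental_theorem_of_calculus)
       (auto intro: has_vector_derivative_at_within assms)
  ultimately show ?thesis
    using assms(1) differentiableI_vector[OF assms(2)] differentiableI_vector[OF assms(3)]
    by (auto simp: H2_def 1 2)
qed

lemma H2_zero: "H2 (\<lambda>_. 0)"
  by (rule H2_C2[where f' = "\<lambda>_. 0" and f'' = "\<lambda>_. 0"]) (simp_all add: periodic_def)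


subsection \<open>The Hilbert space \<open>H\<^sup>2\<close>\<close>

typedef (overloaded) ('a::euclidean_space) h2 = "{f :: real \<Rightarrow> 'a. H2 f}"
  morphisms h2_fun Abs_h2
  using H2_zero by auto

setup_lifting type_definition_h2

lemma H2_h2_fun: "H2 (h2_fun f)" using h2_fun by auto

instantiation h2 :: (euclidean_space) real_vector
begin

lift_definition zero_h2 :: "'a h2" is "\<lambda>_. 0"
  by (rule H2_zero)
lift_definition plus_h2 :: "'a h2 \<Rightarrow> 'a h2 \<Rightarrow> 'a h2" is "\<lambda>f g x. f x + g x"
  using H2_lincomb(1)[of _ _ 1 1] by simp
lift_definition minus_h2 :: "'a h2 \<Rightarrow> 'a h2 \<Rightarrow> 'a h2" is "\<lambda>f g x. f x - g x"
  using H2_lincomb(1)[of _ _ 1 "-1"] by simp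
lift_definition uminus_h2 :: "'a h2 \<Rightarrow> 'a h2" is "\<lambda>f x. - f x"
  using H2_lincomb(1)[of _ _ "-1" 0] by simp
lift_definition scaleR_h2 :: "real \<Rightarrow> 'a h2 \<Rightarrow> 'a h2" is "\<lambda>c f x. c *\<^sub>R f x"
  using H2_lincomb(1)[of _ _ _ 0] by simp

instance
proof
  fix f g h :: "'a h2" and a b :: real
  show "f + g + h = f + (g + h)" by transfer (simp add: add.assoc)
  show "f + g = g + f" by transfer (simp add: add.commute)
  show "0 + f = f" by transfer simp
  show "- f + f = 0" by transfer simp
  show "f - g = f + - g" by transfer simp
  show "a *\<^sub>R (f + g) = a *\<^sub>R f + a *\<^sub>R g" by transfer (simp add: scaleR_add_right)
  show "(a + b) *\<^sub>R f = a *\<^sub>R f + b *\<^sub>R f" by transfer (simp add: scaleR_add_left)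
  show "a *\<^sub>R b *\<^sub>R f = (a * b) *\<^sub>R f" by transfer simp
  show "1 *\<^sub>R f = f" by transfer simp
qed

end

instantiation h2 :: (euclidean_space) real_inner
begin

lift_definition inner_h2 :: "'a h2 \<Rightarrow> 'a h2 \<Rightarrow> real" is
  "\<lambda>f g. (LINT \<eta>:{0..2 * pi}|lebesgue. f \<eta> \<bullet> g \<eta> + D1 f \<eta> \<bullet> D1 g \<eta> + D2 f \<eta> \<bullet> D2 g \<eta>)" .

definition norm_h2 :: "'a h2 \<Rightarrow> real" where "norm_h2 f = sqrt (f \<bullet> f)"
definition sgn_h2 :: "'a h2 \<Rightarrow> 'a h2" where "sgn_h2 f = f /\<^sub>R norm f"
definition dist_h2 :: "'a h2 \<Rightarrow> 'a h2 \<Rightarrow> real" where "dist_h2 f g = norm (f - g)"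
definition uniformity_h2 :: "('a h2 \<times> 'a h2) filter" where
  "uniformity_h2 = (INF e\<in>{0 <..}. principal {(x, y). dist x y < e})"
definition open_h2 :: "'a h2 set \<Rightarrow> bool" where
  "open_h2 S = (\<forall>x\<in>S. \<forall>\<^sub>F (x', y) in uniformity. x' = x \<longrightarrow> y \<in> S)"

lemma inner_h2_integrable:
  assumes "H2 f" "H2 g"
  shows "set_integrable lebesgue {0..2*pi} (\<lambda>\<eta>. f \<eta> \<bullet> g \<eta> + D1 f \<eta> \<bullet> D1 g \<eta> + D2 f \<eta> \<bullet> D2 g \<eta>)"
  using assms by (intro set_integral_add(1) L2_inner_integrable) (simp_all add: H2_L2)

lemma inner_h2_lincomb:
  fixes c d :: real
  assumes "H2 f" "H2 g" "H2 h"
    and k_def: "k = (\<lambda>x. c *\<^sub>R f x + d *\<^sub>R g x)"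
  shows "(LINT \<eta>:{0..2*pi}|lebesgue. k \<eta> \<bullet> h \<eta> + D1 k \<eta> \<bullet> D1 h \<eta> + D2 k \<eta> \<bullet> D2 h \<eta>) =
    c * (LINT \<eta>:{0..2*pi}|lebesgue. f \<eta> \<bullet> h \<eta> + D1 f \<eta> \<bullet> D1 h \<eta> + D2 f \<eta> \<bullet> D2 h \<eta>) +
    d * (LINT \<eta>:{0..2*pi}|lebesgue. g \<eta> \<bullet> h \<eta> + D1 g \<eta> \<bullet> D1 h \<eta> + D2 g \<eta> \<bullet> D2 h \<eta>)"
    (is "_ = c * ?F + d * ?G")
proof -
  note i = inner_h2_integrable[OF assms(1,3)] inner_h2_integrable[OF assms(2,3)]
  have k: "H2 k" unfolding k_def by (rule H2_lincomb) fact+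
  have "(LINT \<eta>:{0..2*pi}|lebesgue. k \<eta> \<bullet> h \<eta> + D1 k \<eta> \<bullet> D1 h \<eta> + D2 k \<eta> \<bullet> D2 h \<eta>) =
    (LINT \<eta>:{0..2*pi}|lebesgue. c * (f \<eta> \<bullet> h \<eta> + D1 f \<eta> \<bullet> D1 h \<eta> + D2 f \<eta> \<bullet> D2 h \<eta>) +
      d * (g \<eta> \<bullet> h \<eta> + D1 g \<eta> \<bullet> D1 h \<eta> + D2 g \<eta> \<bullet> D2 h \<eta>))"
    unfolding set_lebesgue_integral_def
  proof (rule integral_cong_AE)
    show "(\<lambda>\<eta>. indicator {0..2*pi} \<eta> *\<^sub>R (k \<eta> \<bullet> h \<eta> + D1 k \<eta> \<bullet> D1 h \<eta> + D2 k \<eta> \<bullet> D2 h \<eta>))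
        \<in> borel_measurable lebesgue"
      using inner_h2_integrable[OF k assms(3)] unfolding set_integrable_def
      by (rule borel_measurable_integrable)
    show "(\<lambda>\<eta>. indicator {0..2*pi} \<eta> *\<^sub>R (c * (f \<eta> \<bullet> h \<eta> + D1 f \<eta> \<bullet> D1 h \<eta> + D2 f \<eta> \<bullet> D2 h \<eta>) +
      d * (g \<eta> \<bullet> h \<eta> + D1 g \<eta> \<bullet> D1 h \<eta> + D2 g \<eta> \<bullet> D2 h \<eta>))) \<in> borel_measurable lebesgue"
      using set_integral_add(1)[OF set_integrable_mult_right[of c, OF i(1)] set_integrable_mult_right[of d, OF i(2)]]
      unfolding set_integrable_def by (rule borel_measurable_integrable)
    have "AE x in lebesgue. D2 k x = c *\<^sub>R D2 f x + d *\<^sub>R D2 g x"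
      unfolding k_def by (rule H2_lincomb) fact+
    moreover have "D1 k = (\<lambda>x. c *\<^sub>R D1 f x + d *\<^sub>R D1 g x)"
      unfolding k_def by (rule H2_lincomb) fact+
    ultimately show "AE \<eta> in lebesgue. indicator {0..2*pi} \<eta> *\<^sub>R (k \<eta> \<bullet> h \<eta> + D1 k \<eta> \<bullet> D1 h \<eta> + D2 k \<eta> \<bullet> D2 h \<eta>) =
      indicator {0..2*pi} \<eta> *\<^sub>R (c * (f \<eta> \<bullet> h \<eta> + D1 f \<eta> \<bullet> D1 h \<eta> + D2 f \<eta> \<bullet> D2 h \<eta>) +
      d * (g \<eta> \<bullet> h \<eta> + D1 g \<eta> \<bullet> D1 h \<eta> + D2 g \<eta> \<bullet> D2 h \<eta>))"
      by (elim AE_mp) (auto intro!: AE_I2 simp: k_def inner_add_left algebra_simps)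
  qed
  also have "\<dots> = c * ?F + d * ?G"
    by (subst set_integral_add(2)) (use i in auto)
  finally show ?thesis .
qed

lemma inner_h2_definite:
  assumes "H2 f"
    and 0: "(LINT \<eta>:{0..2*pi}|lebesgue. f \<eta> \<bullet> f \<eta> + D1 f \<eta> \<bullet> D1 f \<eta> + D2 f \<eta> \<bullet> D2 f \<eta>) = 0"
  shows "f = (\<lambda>_. 0)"
proof -
  have i: "set_integrable lebesgue {0..2*pi} (\<lambda>\<eta>. f \<eta> \<bullet> f \<eta>)"
    using assms by (intro L2_inner_integrable) (simp_all add: H2_L2)
  have "(LINT \<eta>:{0..2*pi}|lebesgue. f \<eta> \<bullet> f \<eta>) \<le>
    (LINT \<eta>:{0..2*pi}|lebesgue. f \<eta> \<bullet> f \<eta> + D1 f \<eta> \<bullet> D1 f \<eta> + D2 f \<eta> \<bullet> D2 f \<eta>)"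
    by (rule set_integral_mono[OF i inner_h2_integrable[OF assms(1,1)]]) auto
  then have "(LINT \<eta>:{0..2*pi}|lebesgue. f \<eta> \<bullet> f \<eta>) \<le> 0" using 0 by simp
  then have le: "integral {0..2*pi} (\<lambda>\<eta>. f \<eta> \<bullet> f \<eta>) \<le> 0"
    using set_lebesgue_integral_eq_integral(2)[OF i] by simp
  have c: "continuous_on {0..2*pi} (\<lambda>\<eta>. f \<eta> \<bullet> f \<eta>)"
    by (intro continuous_intros continuous_on_subset[OF H2_continuous[OF assms(1)]]) auto
  have "integral {0..2*pi} (\<lambda>\<eta>. f \<eta> \<bullet> f \<eta>) = 0"
    using le integral_nonneg[OF integrable_continuous_interval[OF c]] by force
  then have z: "f x = 0" if "x \<in> {0..2*pi}" for x
    using integral_eq_0_iff[OF c] that by auto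
  have per: "f (x + 2*pi) = f x" for x using assms(1) by (auto simp: H2_def periodic_def)
  have pn: "f (x + 2*pi * real n) = f x" for x n
  proof (induction n)
    case (Suc n)
    then show ?case using per[of "x + 2*pi*real n"] by (simp add: algebra_simps)
  qed simp
  have pi: "f (x + 2*pi * of_int m) = f x" for x m
  proof (cases "m \<ge> 0")
    case True then show ?thesis using pn[of x "nat m"] by simp
  next
    case False then show ?thesis using pn[of "x + 2*pi * of_int m" "nat (-m)"] by simp
  qed
  have "f x = 0" for x
  proof -
    define m where "m = \<lfloor>x / (2*pi)\<rfloor>"
    have "of_int m \<le> x / (2*pi)" "x / (2*pi) < of_int m + 1" by (auto simp: m_def)
    then have "x + 2*pi * of_int (-m) \<in> {0..2*pi}" by (auto simp: field_simps)
    then show ?thesis using z pi[of x "-m"] by metis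
  qed
  then show ?thesis by auto
qed

instance
proof
  fix f g h :: "'a h2" and r :: real and U :: "'a h2 set"
  show "dist f g = norm (f - g)" by (rule dist_h2_def)
  show "sgn f = f /\<^sub>R norm f" by (rule sgn_h2_def)
  show "uniformity = (INF e\<in>{0 <..}. principal {(x, y :: 'a h2). dist x y < e})"
    by (rule uniformity_h2_def)
  show "open U = (\<forall>x\<in>U. \<forall>\<^sub>F (x', y) in uniformity. x' = x \<longrightarrow> y \<in> U)" by (rule open_h2_def)
  show "norm f = sqrt (f \<bullet> f)" by (rule norm_h2_def)
  show "f \<bullet> g = g \<bullet> f" by transfer (simp add: inner_commute)
  show "(f + g) \<bullet> h = f \<bullet> h + g \<bullet> h"
    by transfer (use inner_h2_lincomb[OF _ _ _ refl, where c=1 and d=1] in simp)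
  show "(r *\<^sub>R f) \<bullet> g = r * (f \<bullet> g)"
    by transfer (use inner_h2_lincomb[OF _ _ _ refl, where d=0] in simp)
  show "0 \<le> f \<bullet> f"
    by transfer (auto simp: set_lebesgue_integral_def intro!: integral_nonneg_AE)
  have "f \<bullet> f = 0 \<Longrightarrow> f = 0" by transfer (rule inner_h2_definite)
  moreover have "(0 :: 'a h2) \<bullet> 0 = 0"
  proof transfer
    have "D1 (\<lambda>_. 0 :: 'a) = (\<lambda>_. 0)" by (rule ext, rule D1_eqI) auto
    then show "(LINT \<eta>:{0..2*pi}|lebesgue. (0::'a) \<bullet> 0 + D1 (\<lambda>_. 0::'a) \<eta> \<bullet> D1 (\<lambda>_. 0) \<eta> +
      D2 (\<lambda>_. 0::'a) \<eta> \<bullet> D2 (\<lambda>_. 0) \<eta>) = 0" by (simp add: D2_def)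
  qed
  ultimately show "(f \<bullet> f = 0) = (f = 0)" by auto
qed

end


section \<open>Smooth curves\<close>

text \<open>For open \<open>I\<close>: all derivatives of \<open>f\<close> exist on \<open>I\<close>, with \<open>D n\<close> the \<open>n\<close>-th one.\<close>

definition smooth_curve_on :: "real set \<Rightarrow> (real \<Rightarrow> 'a::real_normed_vector) \<Rightarrow> bool" where
  "smooth_curve_on I f \<longleftrightarrow> (\<exists>D :: nat \<Rightarrow> real \<Rightarrow> 'a. (\<forall>t\<in>I. D 0 t = f t) \<and>
     (\<forall>n. \<forall>t\<in>I. (D n has_vector_derivative D (Suc n) t) (at t)))"


section \<open>The operators\<close>

definition x0 :: "real \<Rightarrow> real \<Rightarrow> real^3" where
  "x0 R \<eta> = vector [R * cos \<eta>, R * sin \<eta>, 0]"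

definition E2 :: "real \<Rightarrow> real^3" where
  "E2 \<eta> = vector [- sin \<eta>, cos \<eta>, 0]"

definition e3 :: "real^3" where
  "e3 = vector [0, 0, 1]"

definition F_op :: "real \<Rightarrow> real \<Rightarrow> (real^3) h2 \<Rightarrow> real \<Rightarrow> real^3" where
  "F_op R lam w \<eta> = (let u = h2_fun w in
     cross3 (x0 R \<eta>) (D2 u \<eta>) + cross3 (u \<eta>) (D2 (x0 R) \<eta>) + cross3 (u \<eta>) (D2 u \<eta>)
     - lam *\<^sub>R cross3 e3 (u \<eta>) + lam *\<^sub>R D1 u \<eta>)"

definition C_op :: "real \<Rightarrow> (real^3) h2 \<Rightarrow> real \<Rightarrow> real" where
  "C_op R w \<eta> = (let u = h2_fun w in x0 R \<eta> \<bullet> u \<eta> + 1/2 * (norm (u \<eta>))\<^sup>2)"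

definition G_op :: "real \<Rightarrow> real \<Rightarrow> (real^3) h2 \<Rightarrow> (real \<Rightarrow> real^3) \<times> (real \<Rightarrow> real)" where
  "G_op R lam u = (F_op R lam u, C_op R u)"

definition G_rev :: "real \<Rightarrow> real \<Rightarrow> (real^3) h2 \<Rightarrow>
    (real \<Rightarrow> real) \<times> (real \<Rightarrow> real) \<times> (real \<Rightarrow> real)" where
  "G_rev R lam u = (\<lambda>\<eta>. F_op R lam u \<eta> \<bullet> E2 \<eta>, \<lambda>\<eta>. F_op R lam u \<eta> \<bullet> e3, C_op R u)"

definition S_refl :: "real^3 \<Rightarrow> real^3" where
  "S_refl v = vector [v $ 1, - v $ 2, v $ 3]"

definition Y_rev :: "(real^3) h2 set" where
  "Y_rev = {u. \<forall>\<eta>. S_refl (h2_fun u (- \<eta>)) = h2_fun u \<eta>}"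

definition Z_rev :: "((real \<Rightarrow> real) \<times> (real \<Rightarrow> real) \<times> (real \<Rightarrow> real)) set" where
  "Z_rev = {(f, g, h).
     L2 f \<and> (AE \<eta> in lebesgue. f (- \<eta>) = f \<eta>) \<and>
     L2 g \<and> (AE \<eta> in lebesgue. g (- \<eta>) = - g \<eta>) \<and>
     H2 h \<and> (\<forall>\<eta>. h (- \<eta>) = h \<eta>)}"

text \<open>Vanishing in the target spaces: almost everywhere in the \<open>L\<^sup>2\<close> components, everywhere in the
  \<open>H\<^sup>2\<close> component.\<close>

definition G_zero :: "real \<Rightarrow> real \<Rightarrow> (real^3) h2 \<Rightarrow> bool" where
  "G_zero R lam u \<longleftrightarrow> (case G_op R lam u of (F, C) \<Rightarrow>
     (AE \<eta> in lebesgue. F \<eta> = 0) \<and> (\<forall>\<eta>. C \<eta> = 0))"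

definition G_rev_zero :: "real \<Rightarrow> real \<Rightarrow> (real^3) h2 \<Rightarrow> bool" where
  "G_rev_zero R lam u \<longleftrightarrow> (case G_rev R lam u of (f, g, h) \<Rightarrow>
     (AE \<eta> in lebesgue. f \<eta> = 0) \<and> (AE \<eta> in lebesgue. g \<eta> = 0) \<and> (\<forall>\<eta>. h \<eta> = 0))"

definition zeros_rev :: "real \<Rightarrow> (real \<times> (real^3) h2) set" where
  "zeros_rev R = {(lam, u). lam > 0 \<and> u \<in> Y_rev \<and> G_rev_zero R lam u}"

definition trivial_branch :: "(real \<times> (real^3) h2) set" where
  "trivial_branch = {(lam, 0) | lam. lam > 0}"

definition bifurcation_point_rev :: "real \<Rightarrow> real \<times> (real^3) h2 \<Rightarrow> bool" where
  "bifurcation_point_rev R p \<longleftrightarrow>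
     p \<in> trivial_branch \<and> p \<in> closure {(lam, u). (lam, u) \<in> zeros_rev R \<and> u \<noteq> 0}"

definition lam_k :: "real \<Rightarrow> nat \<Rightarrow> real" where
  "lam_k R k = R * sqrt ((real k)\<^sup>2 - 1)"

lift_definition v_k :: "nat \<Rightarrow> (real^3) h2" is
  "\<lambda>k \<eta>. sin (real k * \<eta>) *\<^sub>R E2 \<eta> - (real k / sqrt ((real k)\<^sup>2 - 1) * cos (real k * \<eta>)) *\<^sub>R e3"
proof -
  fix k :: nat
  define c where "c = real k / sqrt ((real k)\<^sup>2 - 1)"
  define A B :: "real^3" where "A = vector [1, 0, 0]" and "B = vector [0, 1, 0]"
  have E2: "E2 x = (- sin x) *\<^sub>R A + cos x *\<^sub>R B" for x
    by (simp add: E2_def A_def B_def vec_eq_iff forall_3)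
  have p: "sin (real k * (x + 2 * pi)) = sin (real k * x)"
    "cos (real k * (x + 2 * pi)) = cos (real k * x)" for x
    using sin.plus_of_nat[of "real k * x" k] cos.plus_of_nat[of "real k * x" k]
    by (simp_all add: algebra_simps)
  define f' where "f' = (\<lambda>x::real. (- (real k * cos (real k * x) * sin x + sin (real k * x) * cos x)) *\<^sub>R A
    + (real k * cos (real k * x) * cos x - sin (real k * x) * sin x) *\<^sub>R B + (c * real k * sin (real k * x)) *\<^sub>R e3)"
  define f'' where "f'' = (\<lambda>x::real. (((real k)\<^sup>2 + 1) * sin (real k * x) * sin x - 2 * real k * cos (real k * x) * cos x) *\<^sub>R A
    + (- (((real k)\<^sup>2 + 1) * sin (real k * x) * cos x) - 2 * real k * cos (real k * x) * sin x) *\<^sub>R B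
    + (c * (real k)\<^sup>2 * cos (real k * x)) *\<^sub>R e3)"
  have "H2 (\<lambda>x. sin (real k * x) *\<^sub>R E2 x - (c * cos (real k * x)) *\<^sub>R e3)"
  proof (rule H2_C2[where f' = f' and f'' = f''])
    show "periodic (\<lambda>x. sin (real k * x) *\<^sub>R E2 x - (c * cos (real k * x)) *\<^sub>R e3)"
      by (simp add: periodic_def p E2)
    show "((\<lambda>x. sin (real k * x) *\<^sub>R E2 x - (c * cos (real k * x)) *\<^sub>R e3) has_vector_derivative f' x) (at x)" for x
      unfolding E2 f'_def
      by (rule derivative_eq_intros refl)+ (simp add: vec_eq_iff algebra_simps)
    show "(f' has_vector_derivative f'' x) (at x)" for x
      unfolding f'_def f''_def
      by (rule derivative_eq_intros refl)+ (simp add: vec_eq_iff algebra_simps power2_eq_square)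
    show "continuous_on UNIV f''" unfolding f''_def by (intro continuous_intros)
  qed
  then show "H2 (\<lambda>\<eta>. sin (real k * \<eta>) *\<^sub>R E2 \<eta> -
      (real k / sqrt ((real k)\<^sup>2 - 1) * cos (real k * \<eta>)) *\<^sub>R e3)"
    by (simp add: c_def)
qed

definition Y_rev_k :: "nat \<Rightarrow> (real^3) h2 set" where
  "Y_rev_k k = {u \<in> Y_rev. u \<bullet> v_k k = 0}"

end

theory Submission
  imports Defs
begin

text \<open>Let \<open>x = x\<^sub>0 + u\<close> and \<open>M = x \<times> x' + \<lambda> x\<close>. On the sphere \<open>\<bar>x\<bar> = R\<close> the equation \<open>\<F>(\<lambda>, u) = 0\<close> is
  equivalent to the first order polynomial system \<open>R\<^sup>2 x' = M \<times> x\<close>, \<open>M' = \<lambda> e\<^sub>3 \<times> x\<close>, which conserves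
  \<open>\<bar>x\<bar>\<close>, \<open>M \<cdot> x\<close> and \<open>M \<cdot> e\<^sub>3\<close>. The \<open>E\<^sub>1\<close> component missing from the projected operator is harmless,
  because \<open>\<F>(\<lambda>, u) \<cdot> x = 0\<close> and \<open>x \<cdot> E\<^sub>1 > 0\<close> for small \<open>u\<close>.

  In the rotating frame the linearisation at \<open>\<lambda>\<^sub>k\<close> has constant coefficients. On reversible periodic
  functions its kernel is spanned by a vector \<open>V\<close> corresponding to \<open>v\<^sub>k\<close>, and moving \<open>\<lambda>\<close> is transversal
  to its range, so that together with \<open>\<lambda>\<close> it has an explicit bounded inverse \<open>K\<close> on continuous
  functions. Writing the unknown as \<open>t (V + w)\<close>, the system divided by \<open>t\<close> becomes a quadratic fixed
  point equation for \<open>(\<lambda> - \<lambda>\<^sub>k, w)\<close>, whose small solution is unique and smooth in \<open>t\<close>. Any small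
  reversible zero has this form, with \<open>t\<close> its component along \<open>V\<close>. The system expresses the second
  derivatives of \<open>w\<close> polynomially in \<open>w\<close>, which turns smoothness in the sup norm into smoothness in
  \<open>H\<^sup>2\<close>.\<close>

section \<open>Curves of class \<open>C\<^sup>n\<close> solving a quadratic fixed point equation\<close>

text \<open>The operator itself is awkward: \<open>x \<times> u''\<close> degenerates along
  \<open>x\<close>, and the augmented problem has four scalar equations for three unknown functions.
  In the first order system this redundancy shows up as first integrals. Two of them become scalar
  conditions at \<eta> = 0, and the third, \<open>M \<cdot> e3\<close>, becomes the scalar unknown
  \<open>n\<close>. What remains of the linear part is essentially a harmonic oscillator for
  \<open>(c, y)\<close> of squared frequency \<open>1 + (\<lambda> / R)^2\<close>. This equals
  \<open>k^2\<close> exactly at \<open>\<lambda> = R * sqrt (k^2 - 1)\<close>, the origin of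
  \<lambda>_k. Reversibility removes the phase of the oscillation and the free constant of
  \<open>b\<close>; one amplitude and one resonance condition are left, and moving \<lambda> pays
  for the latter. Since the system is polynomial, the blow-up leaves no Taylor remainder, and a
  fixed point theorem for exactly this quadratic shape can be proved directly. Because the equations
  are of first order they can be solved among continuous functions. \<open>H2\<close> enters only at
  the two ends: a Sobolev bound brings small zeros into the uniqueness ball, and an explicit bounded
  linear map rebuilds \<open>u\<close> along the curve.\<close>

primrec Cn_on :: "nat \<Rightarrow> real set \<Rightarrow> (real \<Rightarrow> 'a::real_normed_vector) \<Rightarrow> bool" where
  "Cn_on 0 I f = continuous_on I f"
| "Cn_on (Suc n) I f = (\<exists>f'. (\<forall>t\<in>I. (f has_vector_derivative f' t) (at t)) \<and> Cn_on n I f')"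

lemma Cn_on_cong:
  assumes "open I" "\<And>t. t \<in> I \<Longrightarrow> f t = g t" "Cn_on n I f"
  shows "Cn_on n I g"
proof (cases n)
  case 0
  then show ?thesis using assms continuous_on_cong[of I I f g] by simp
next
  case (Suc m)
  then obtain f' where f': "\<forall>t\<in>I. (f has_vector_derivative f' t) (at t)" "Cn_on m I f'"
    using assms by auto
  have "(g has_vector_derivative f' t) (at t)" if "t \<in> I" for t
    using has_vector_derivative_transform_within_open[of f "f' t" t I g] f' that assms by auto
  then show ?thesis using Suc f' by auto
qed

lemma Cn_on_Suc_imp: "Cn_on (Suc n) I f \<Longrightarrow> Cn_on n I f"
proof (induction n arbitrary: f)
  case 0
  then obtain f' where "\<forall>t\<in>I. (f has_vector_derivative f' t) (at t)" by auto
  then show ?case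
    by (auto intro!: continuous_at_imp_continuous_on has_vector_derivative_continuous)
next
  case (Suc n)
  then show ?case by (metis Cn_on.simps(2))
qed

lemma Cn_on_const [intro]: "Cn_on n I (\<lambda>_. c)"
proof (induction n arbitrary: c)
  case (Suc n)
  then show ?case by (auto intro!: exI[of _ "\<lambda>_. 0"])
qed simp

lemma Cn_on_ident: "Cn_on n I (\<lambda>t. t)"
  by (cases n) (auto intro!: exI[of _ "\<lambda>_. 1"] simp: has_vector_derivative_id)

lemma Cn_on_linear:
  assumes "bounded_linear L" "Cn_on n I f"
  shows "Cn_on n I (\<lambda>t. L (f t))"
  using assms(2)
proof (induction n arbitrary: f)
  case 0
  then show ?case using bounded_linear.continuous_on[OF assms(1)] by simp
next
  case (Suc n)
  then obtain f' where "\<forall>t\<in>I. (f has_vector_derivative f' t) (at t)" "Cn_on n I f'" by auto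
  then show ?case
    using Suc.IH bounded_linear.has_vector_derivative[OF assms(1)]
    by (auto intro!: exI[of _ "\<lambda>t. L (f' t)"])
qed

lemma Cn_on_add:
  assumes "Cn_on n I f" "Cn_on n I g"
  shows "Cn_on n I (\<lambda>t. f t + g t)"
  using assms
proof (induction n arbitrary: f g)
  case 0
  then show ?case by (simp add: continuous_on_add)
next
  case (Suc n)
  then obtain f' g' where "\<forall>t\<in>I. (f has_vector_derivative f' t) (at t)" "Cn_on n I f'"
    "\<forall>t\<in>I. (g has_vector_derivative g' t) (at t)" "Cn_on n I g'" by auto
  then show ?case
    using Suc.IH by (auto intro!: exI[of _ "\<lambda>t. f' t + g' t"] derivative_intros)
qed

lemma Cn_on_bilinear:
  assumes "bounded_bilinear B" "Cn_on n I f" "Cn_on n I g"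
  shows "Cn_on n I (\<lambda>t. B (f t) (g t))"
  using assms(2,3)
proof (induction n arbitrary: f g)
  case 0
  then show ?case using bounded_bilinear.continuous_on[OF assms(1)] by simp
next
  case (Suc n)
  then obtain f' g' where *: "\<forall>t\<in>I. (f has_vector_derivative f' t) (at t)" "Cn_on n I f'"
    "\<forall>t\<in>I. (g has_vector_derivative g' t) (at t)" "Cn_on n I g'" by auto
  have "Cn_on n I (\<lambda>t. B (f t) (g' t) + B (f' t) (g t))"
    using Suc.prems[THEN Cn_on_Suc_imp] * by (intro Cn_on_add Suc.IH)
  then show ?case
    using * bounded_bilinear.has_vector_derivative[OF assms(1)]
    by (auto intro!: exI[of _ "\<lambda>t. B (f t) (g' t) + B (f' t) (g t)"])
qed

lemma Cn_on_Pair: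
  assumes "Cn_on n I f" "Cn_on n I g"
  shows "Cn_on n I (\<lambda>t. (f t, g t))"
proof -
  have "Cn_on n I (\<lambda>t. (f t, 0) + (0, g t))"
    by (intro Cn_on_add Cn_on_linear[OF _ assms(1)] Cn_on_linear[OF _ assms(2)])
       (auto intro!: bounded_linear_intros)
  then show ?thesis by simp
qed

text \<open>The witnesses for different orders \<open>n\<close> are unrelated a priori. Uniqueness
  of derivatives identifies all of them on \<open>I\<close> with iterates of
  \<open>vector_derivative\<close>, which yields one sequence for all orders.\<close>

lemma smooth_curve_on_if_Cn_on:
  assumes "open I" "\<And>n. Cn_on n I f"
  shows "smooth_curve_on I f"
proof -
  define d :: "(real \<Rightarrow> 'a) \<Rightarrow> real \<Rightarrow> 'a" where "d = (\<lambda>f t. vector_derivative f (at t))"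
  have step: "\<forall>n. Cn_on n I (d g)" "\<forall>t\<in>I. (g has_vector_derivative d g t) (at t)"
    if g: "\<forall>n. Cn_on n I g" for g
  proof -
    have ex: "\<exists>g'. (\<forall>t\<in>I. (g has_vector_derivative g' t) (at t)) \<and> Cn_on n I g'" for n
      using g by (metis Cn_on.simps(2))
    show "\<forall>t\<in>I. (g has_vector_derivative d g t) (at t)"
      using ex[of 0] by (auto simp: d_def vector_derivative_works[symmetric] intro: differentiableI_vector)
    show "\<forall>n. Cn_on n I (d g)"
    proof
      fix n
      obtain g' where "\<forall>t\<in>I. (g has_vector_derivative g' t) (at t)" "Cn_on n I g'"
        using ex by blast
      then show "Cn_on n I (d g)"
        using Cn_on_cong[OF assms(1), of g' "d g"] by (metis d_def vector_derivative_at)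
    qed
  qed
  have all: "\<forall>m. Cn_on m I ((d ^^ n) f)" for n
    using assms(2) step(1) by (induction n) auto
  show ?thesis
    unfolding smooth_curve_on_def
    using step(2)[OF all] by (intro exI[of _ "\<lambda>n. (d ^^ n) f"]) auto
qed

lemma Cn_on_if_smooth_curve_on:
  assumes "smooth_curve_on I f" "open I"
  shows "Cn_on n I f"
proof -
  obtain D where D: "\<forall>t\<in>I. D 0 t = f t" "\<forall>n. \<forall>t\<in>I. (D n has_vector_derivative D (Suc n) t) (at t)"
    using assms unfolding smooth_curve_on_def by auto
  have "Cn_on n I (D m)" for m
  proof (induction n arbitrary: m)
    case 0
    then show ?case using D
      by (auto intro!: continuous_at_imp_continuous_on has_vector_derivative_continuous)
  next
    case (Suc n)
    then show ?case using D(2) by auto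
  qed
  then show ?thesis using Cn_on_cong[OF assms(2), of "D 0" f] D(1) by auto
qed

section \<open>Linear equations close to the identity\<close>

lemma has_vector_derivative_iff_quotient:
  "(f has_vector_derivative d) (at t) \<longleftrightarrow> ((\<lambda>s. (f s - f t) /\<^sub>R (s - t)) \<longlongrightarrow> d) (at t)"
proof -
  have eq: "norm (f s - f t - (s - t) *\<^sub>R d) / norm (s - t) = norm ((f s - f t) /\<^sub>R (s - t) - d)"
    if "s \<noteq> t" for s
  proof -
    have "(f s - f t) /\<^sub>R (s - t) - d = (f s - f t - (s - t) *\<^sub>R d) /\<^sub>R (s - t)"
      using that by (simp add: scaleR_diff_right)
    then show ?thesis by (simp add: divide_inverse mult.commute)
  qed
  have "(f has_vector_derivative d) (at t) \<longleftrightarrow>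
      ((\<lambda>s. norm (f s - f t - (s - t) *\<^sub>R d) / norm (s - t)) \<longlongrightarrow> 0) (at t)"
    by (simp add: has_vector_derivative_def has_derivative_iff_norm bounded_linear_scaleR_left)
  also have "\<dots> \<longleftrightarrow> ((\<lambda>s. norm ((f s - f t) /\<^sub>R (s - t) - d)) \<longlongrightarrow> 0) (at t)"
    by (rule tendsto_cong) (simp add: eventually_at_filter eq[unfolded real_norm_def])
  finally show ?thesis by (simp add: tendsto_norm_zero_iff LIM_zero_iff)
qed

lemma norm_blinfun_le: "norm A \<le> c \<Longrightarrow> norm (blinfun_apply A x) \<le> c * norm x"
  by (rule order_trans[OF norm_blinfun]) (rule mult_right_mono, auto)

text \<open>Subtracting the equations gives
  \<open>q s - z = A s (q s - z) + (A s - A0) z + (r s - r0)\<close>, and the first term on the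
  right takes up at most half of the left side. With \<open>q\<close> a solution or its difference
  quotient, this yields continuity and differentiability alike.\<close>

lemma near_identity_tendsto:
  fixes A :: "real \<Rightarrow> 'a::real_normed_vector \<Rightarrow>\<^sub>L 'a"
  assumes "(A \<longlongrightarrow> A0) F" "(r \<longlongrightarrow> r0) F" "\<forall>\<^sub>F s in F. norm (A s) \<le> 1/2"
    "\<forall>\<^sub>F s in F. q s = A s (q s) + r s" "z = A0 z + r0"
  shows "(q \<longlongrightarrow> z) F"
proof -
  have "\<forall>\<^sub>F s in F. norm (q s - z) \<le> 2 * (norm (A s - A0) * norm z + norm (r s - r0))"
    using assms(3,4)
  proof eventually_elim
    case (elim s)
    have "q s - z = A s (q s - z) + ((A s - A0) z + (r s - r0))"
    proof -
      have "A s (q s - z) + ((A s - A0) z + (r s - r0)) = (A s (q s) + r s) - (A0 z + r0)"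
        by (simp add: blinfun.diff_left blinfun.diff_right)
      then show ?thesis using elim(2) assms(5) by metis
    qed
    moreover have "norm (A s (q s - z)) \<le> 1/2 * norm (q s - z)"
      by (rule norm_blinfun_le) (rule elim)
    moreover have "norm ((A s - A0) z) \<le> norm (A s - A0) * norm z" by (rule norm_blinfun)
    ultimately show ?case
      using norm_triangle_ineq[of "A s (q s - z)" "(A s - A0) z + (r s - r0)"]
        norm_triangle_ineq[of "(A s - A0) z" "r s - r0"] by simp
  qed
  moreover have "((\<lambda>s. 2 * (norm (A s - A0) * norm z + norm (r s - r0))) \<longlongrightarrow> 2 * (0 * norm z + 0)) F"
    using assms(1,2) by (intro tendsto_intros) (auto simp: tendsto_norm_zero LIM_zero)
  ultimately have "((\<lambda>s. q s - z) \<longlongrightarrow> 0) F"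
    by (intro Lim_null_comparison[of "\<lambda>s. q s - z"]) auto
  then show ?thesis by (simp add: LIM_zero_iff)
qed

lemma near_identity_solvable:
  fixes A :: "'a::banach \<Rightarrow>\<^sub>L 'a"
  assumes "norm A \<le> 1/2"
  shows "\<exists>z. z = A z + r"
proof -
  have "\<exists>!z. A z + r = z"
  proof (rule banach_fix_type[of "1/2"])
    show "\<forall>x y. dist (A x + r) (A y + r) \<le> 1/2 * dist x y"
    proof (intro allI)
      fix x y
      have "dist (A x + r) (A y + r) = norm (A (x - y))"
        by (simp add: dist_norm blinfun.bilinear_simps)
      also have "\<dots> \<le> 1/2 * dist x y"
        unfolding dist_norm
        by (rule norm_blinfun_le) (rule assms)
      finally show "dist (A x + r) (A y + r) \<le> 1/2 * dist x y" .
    qed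
  qed auto
  then show ?thesis by metis
qed

text \<open>Differentiating \<open>y = A y + g\<close> gives an equation of the same kind for the
  derivative, with the same \<open>A\<close> and the new inhomogeneity \<open>A' y + g'\<close>.
  Hence the induction runs over all \<open>y\<close> and \<open>g\<close> with \<open>A\<close>
  fixed.\<close>

lemma Cn_on_near_identity:
  fixes A :: "real \<Rightarrow> 'a::banach \<Rightarrow>\<^sub>L 'a"
  assumes "open I" "\<And>t. t \<in> I \<Longrightarrow> norm (A t) \<le> 1/2" "Cn_on n I A" "Cn_on n I g"
    "\<And>t. t \<in> I \<Longrightarrow> y t = A t (y t) + g t"
  shows "Cn_on n I y"
  using assms(3-5)
proof (induction n arbitrary: y g)
  case 0
  have "isCont y t" if "t \<in> I" for t
    unfolding isCont_def
  proof (rule near_identity_tendsto[of A "A t" _ g "g t"])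
    show "A \<midarrow>t\<rightarrow> A t" "g \<midarrow>t\<rightarrow> g t"
      using 0 that assms(1) by (auto simp: continuous_on_eq_continuous_at isCont_def)
    have ev: "\<forall>\<^sub>F s in at t. s \<in> I" using assms(1) that by (rule eventually_at_in_open')
    show "\<forall>\<^sub>F s in at t. norm (A s) \<le> 1/2"
      using ev by (rule eventually_mono) (rule assms(2))
    show "\<forall>\<^sub>F s in at t. y s = A s (y s) + g s"
      using ev by (rule eventually_mono) (rule 0)
    show "y t = A t (y t) + g t" using 0 that by auto
  qed
  then show ?case by (simp add: continuous_at_imp_continuous_on)
next
  case (Suc n)
  obtain A' where A': "\<forall>t\<in>I. (A has_vector_derivative A' t) (at t)" "Cn_on n I A'"
    using Suc.prems by auto
  obtain g' where g': "\<forall>t\<in>I. (g has_vector_derivative g' t) (at t)" "Cn_on n I g'"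
    using Suc.prems by auto
  have An: "Cn_on n I A" "Cn_on n I g" using Suc.prems Cn_on_Suc_imp by blast+
  have yn: "Cn_on n I y" by (rule Suc.IH[OF An]) (rule Suc.prems)
  \<comment> \<open>The formally differentiated equation still has the operator \<open>A t\<close>,
    so a contraction argument solves it before \<open>y\<close> is known to be
    differentiable.\<close>
  define z where "z t = (SOME z. z = A t z + (A' t (y t) + g' t))" for t
  have z: "z t = A t (z t) + (A' t (y t) + g' t)" if "t \<in> I" for t
    unfolding z_def by (rule someI_ex) (rule near_identity_solvable[OF assms(2)[OF that]])
  have "Cn_on n I (\<lambda>t. A' t (y t) + g' t)"
    by (intro Cn_on_add g' Cn_on_bilinear[OF bounded_bilinear_blinfun_apply] A' yn)
  then have zn: "Cn_on n I z" by (rule Suc.IH[OF An(1)]) (rule z)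
  have "(y has_vector_derivative z t) (at t)" if t: "t \<in> I" for t
  proof -
    have "((\<lambda>s. (y s - y t) /\<^sub>R (s - t)) \<longlongrightarrow> z t) (at t)"
    proof (rule near_identity_tendsto)
      show "A \<midarrow>t\<rightarrow> A t"
        using A'(1) t has_vector_derivative_continuous isCont_def by blast
      have "((\<lambda>s. ((A s - A t) /\<^sub>R (s - t)) (y t) + (g s - g t) /\<^sub>R (s - t)) \<longlongrightarrow> A' t (y t) + g' t) (at t)"
        using A'(1) g'(1) t by (intro tendsto_intros) (auto simp: has_vector_derivative_iff_quotient)
      then show "((\<lambda>s. ((A s - A t) /\<^sub>R (s - t)) (y t) + (g s - g t) /\<^sub>R (s - t)) \<longlongrightarrow> A' t (y t) + g' t) (at t)" .
      have ev: "\<forall>\<^sub>F s in at t. s \<in> I" using assms(1) t by (rule eventually_at_in_open')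
      show "\<forall>\<^sub>F s in at t. norm (A s) \<le> 1/2"
        using ev by (rule eventually_mono) (rule assms(2))
      show "\<forall>\<^sub>F s in at t. (y s - y t) /\<^sub>R (s - t) = A s ((y s - y t) /\<^sub>R (s - t)) +
          (((A s - A t) /\<^sub>R (s - t)) (y t) + (g s - g t) /\<^sub>R (s - t))"
        using ev
      proof (rule eventually_mono)
        fix s assume s: "s \<in> I"
        have "y s - y t = A s (y s - y t) + ((A s - A t) (y t) + (g s - g t))"
          using Suc.prems(3)[OF s] Suc.prems(3)[OF t] by (simp add: blinfun.bilinear_simps algebra_simps)
        then have "(y s - y t) /\<^sub>R (s - t) = (A s (y s - y t) + ((A s - A t) (y t) + (g s - g t))) /\<^sub>R (s - t)"
          by simp
        also have "\<dots> = A s ((y s - y t) /\<^sub>R (s - t)) +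
          (((A s - A t) /\<^sub>R (s - t)) (y t) + (g s - g t) /\<^sub>R (s - t))"
          by (simp only: blinfun.scaleR_left blinfun.scaleR_right scaleR_add_right)
        finally show "(y s - y t) /\<^sub>R (s - t) = A s ((y s - y t) /\<^sub>R (s - t)) +
          (((A s - A t) /\<^sub>R (s - t)) (y t) + (g s - g t) /\<^sub>R (s - t))" .
      qed
      show "z t = A t (z t) + (A' t (y t) + g' t)" by (rule z[OF t])
    qed
    then show ?thesis by (simp add: has_vector_derivative_iff_quotient)
  qed
  then show ?case using zn by auto
qed

text \<open>Smoothness is bootstrapped: the derivative of the solution solves the linearised
  equation, whose coefficients are as regular as the solution itself.\<close>

theorem quadratic_fixed_point_branch:
  fixes P Q :: "'a::banach \<Rightarrow> 'a \<Rightarrow> 'a" and e :: 'a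
  assumes P: "bounded_bilinear P" and Q: "bounded_bilinear Q"
    and S: "closed S" "subspace S"
    and PS: "\<And>x y. x \<in> S \<Longrightarrow> y \<in> S \<Longrightarrow> P x y \<in> S"
    and QS: "\<And>x y. x \<in> S \<Longrightarrow> y \<in> S \<Longrightarrow> Q x y \<in> S"
    and eS: "e \<in> S"
  shows "\<exists>\<delta> r x. 0 < \<delta> \<and> 0 < r \<and> x 0 = 0 \<and> smooth_curve_on {-\<delta><..<\<delta>} x \<and>
    (\<forall>t. \<bar>t\<bar> < \<delta> \<longrightarrow> x t \<in> S \<and> norm (x t) \<le> r \<and> x t = P (x t) (x t) + t *\<^sub>R Q (e + x t) (e + x t) \<and>
      (\<forall>y. norm y \<le> r \<longrightarrow> y = P y y + t *\<^sub>R Q (e + y) (e + y) \<longrightarrow> y = x t))"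
proof -
  interpret P: bounded_bilinear P by (rule P)
  interpret Q: bounded_bilinear Q by (rule Q)
  obtain KP where KP: "\<And>a b. norm (P a b) \<le> norm a * norm b * KP" "KP > 0" using P.pos_bounded by auto
  obtain KQ where KQ: "\<And>a b. norm (Q a b) \<le> norm a * norm b * KQ" "KQ > 0" using Q.pos_bounded by auto
  define K where "K = max KP KQ"
  have K: "K > 0" using KP by (auto simp: K_def)
  have PK: "norm (P a b) \<le> K * norm a * norm b" and QK: "norm (Q a b) \<le> K * norm a * norm b" for a b
    using order_trans[OF KP(1) mult_left_mono[of KP K "norm a * norm b"]]
      order_trans[OF KQ(1) mult_left_mono[of KQ K "norm a * norm b"]]
    by (auto simp: K_def mult_ac)
  \<comment> \<open>On the ball of radius \<open>r\<close> each of the two \<open>P\<close> terms of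
    the operator \<open>A\<close> below has norm at most \<open>K * r = 1/8\<close>, and the two
    \<open>Q\<close> terms together at most \<open>2 * \<bar>t\<bar> * K * N \<le> 1/4\<close>; this
    adds up to the contraction constant \<open>1/2\<close>. The second bound in
    \<open>\<delta>\<close> keeps the ball invariant, since
    \<open>K * r^2 + \<bar>t\<bar> * K * N^2 \<le> r/8 + r/2\<close>.\<close>
  define r where "r = 1 / (8 * K)"
  define N where "N = norm e + r"
  define \<delta> where "\<delta> = min (1 / (8 * K * N)) (r / (2 * K * N\<^sup>2))"
  have r: "r > 0" using K by (simp add: r_def)
  have N: "N > 0" using r by (simp add: N_def add_nonneg_pos)
  have \<delta>: "\<delta> > 0" using K r N by (simp add: \<delta>_def)
  have d1: "\<bar>t\<bar> * (K * N) \<le> 1/8" and d2: "\<bar>t\<bar> * (K * N\<^sup>2) \<le> r / 2" if "\<bar>t\<bar> < \<delta>" for t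
  proof -
    have "\<bar>t\<bar> \<le> 1 / (8 * K * N)" "\<bar>t\<bar> \<le> r / (2 * K * N\<^sup>2)" using that by (auto simp: \<delta>_def)
    then show "\<bar>t\<bar> * (K * N) \<le> 1/8" "\<bar>t\<bar> * (K * N\<^sup>2) \<le> r / 2"
      using K N by (auto simp: field_simps)
  qed
  have Kr: "K * r = 1/8" using K by (simp add: r_def)
  define f where "f t x = P x x + t *\<^sub>R Q (e + x) (e + x)" for t x
  \<comment> \<open>The divided difference of the quadratic map \<open>f t\<close>: it represents
    \<open>f t x - f t y\<close> exactly, and on the diagonal it is the derivative.\<close>
  define A where "A t x y = P.prod_left x + P.prod_right y
      + t *\<^sub>R (Q.prod_left (e + x) + Q.prod_right (e + y))" for t x y
  have A_apply: "A t x y h = P h x + P y h + t *\<^sub>R (Q h (e + x) + Q (e + y) h)" for t x y h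
    by (simp add: A_def blinfun.bilinear_simps)
  have f_diff: "f t x - f t y = A t x y (x - y)" for t x y
    by (simp add: f_def A_apply P.diff_left P.diff_right Q.add_left Q.add_right Q.diff_left Q.diff_right algebra_simps)
  have A_norm: "norm (A t x y) \<le> 1/2" if "\<bar>t\<bar> < \<delta>" "norm x \<le> r" "norm y \<le> r" for t x y
  proof (rule norm_blinfun_bound)
    fix h
    have eN: "norm (e + x) \<le> N" "norm (e + y) \<le> N"
      using that norm_triangle_ineq[of e x] norm_triangle_ineq[of e y] by (auto simp: N_def)
    have "norm (P h x) \<le> 1/8 * norm h"
    proof -
      have "norm (P h x) \<le> K * norm h * r"
        by (rule order_trans[OF PK]) (use K that in \<open>auto intro!: mult_left_mono\<close>)
      also have "\<dots> = (K * r) * norm h" by simp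
      finally show ?thesis by (simp add: Kr)
    qed
    moreover have "norm (P y h) \<le> 1/8 * norm h"
    proof -
      have "norm (P y h) \<le> K * r * norm h"
        by (rule order_trans[OF PK]) (use K that in \<open>auto intro!: mult_left_mono mult_right_mono\<close>)
      then show ?thesis by (simp add: Kr)
    qed
    moreover have "norm (t *\<^sub>R (Q h (e + x) + Q (e + y) h)) \<le> 1/4 * norm h"
    proof -
      have "norm (Q h (e + x)) \<le> K * norm h * N" "norm (Q (e + y) h) \<le> K * N * norm h"
        using eN K by (auto intro!: order_trans[OF QK] mult_left_mono mult_right_mono)
      then have "norm (Q h (e + x) + Q (e + y) h) \<le> 2 * (K * N * norm h)"
        using norm_triangle_ineq[of "Q h (e + x)" "Q (e + y) h"] by (simp add: algebra_simps)
      then have "norm (t *\<^sub>R (Q h (e + x) + Q (e + y) h)) \<le> \<bar>t\<bar> * (2 * (K * N * norm h))"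
        by (auto intro!: mult_left_mono)
      also have "\<dots> = 2 * (\<bar>t\<bar> * (K * N)) * norm h" by simp
      also have "\<dots> \<le> 2 * (1/8) * norm h"
        using d1[OF that(1)] by (intro mult_right_mono mult_left_mono) auto
      finally show ?thesis by simp
    qed
    ultimately show "norm (A t x y h) \<le> 1/2 * norm h"
      unfolding A_apply
      using norm_triangle_ineq[of "P h x + P y h" "t *\<^sub>R (Q h (e + x) + Q (e + y) h)"]
        norm_triangle_ineq[of "P h x" "P y h"] by linarith
  qed simp
  have f_ball: "norm (f t x) \<le> r" if "\<bar>t\<bar> < \<delta>" "norm x \<le> r" for t x
  proof -
    have eN: "norm (e + x) \<le> N" using that norm_triangle_ineq[of e x] by (auto simp: N_def)
    have "norm (P x x) \<le> K * r * r"
      by (rule order_trans[OF PK]) (use K r that in \<open>auto intro!: mult_mono\<close>)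
    moreover have "norm (Q (e + x) (e + x)) \<le> K * N * N"
      by (rule order_trans[OF QK]) (use K N eN in \<open>auto intro!: mult_mono\<close>)
    then have "\<bar>t\<bar> * norm (Q (e + x) (e + x)) \<le> \<bar>t\<bar> * (K * N * N)"
      by (rule mult_left_mono) simp
    then have "norm (t *\<^sub>R Q (e + x) (e + x)) \<le> \<bar>t\<bar> * (K * N\<^sup>2)"
      by (simp add: power2_eq_square mult.assoc)
    ultimately show ?thesis
      using norm_triangle_ineq[of "P x x" "t *\<^sub>R Q (e + x) (e + x)"] d2[OF that(1)] r
      by (simp add: f_def Kr)
  qed
  have contr: "norm (f t x - f t y) \<le> 1/2 * norm (x - y)"
    if "\<bar>t\<bar> < \<delta>" "norm x \<le> r" "norm y \<le> r" for t x y
    unfolding f_diff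
    by (rule norm_blinfun_le) (rule A_norm[OF that])
  have fS: "f t x \<in> S" if "x \<in> S" for t x
    unfolding f_def
    by (intro subspace_add[OF S(2)] subspace_scale[OF S(2)] PS QS that eS)
  \<comment> \<open>The fixed point is sought inside \<open>S\<close> so that it belongs to
    \<open>S\<close>; the contraction estimate makes it unique even in the whole ball.\<close>
  have "\<exists>!x. x \<in> S \<inter> cball 0 r \<and> f t x = x" if "\<bar>t\<bar> < \<delta>" for t
  proof (rule Banach_fix[where c = "1/2"])
    show "complete (S \<inter> cball 0 r)" using S(1) by (simp add: complete_eq_closed closed_Int)
    show "S \<inter> cball 0 r \<noteq> {}" using subspace_0[OF S(2)] r by force
    show "f t ` (S \<inter> cball 0 r) \<subseteq> S \<inter> cball 0 r"
      using fS f_ball[OF that] by (auto simp: dist_norm)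
    show "dist (f t x) (f t y) \<le> 1/2 * dist x y" if "x \<in> S \<inter> cball 0 r" "y \<in> S \<inter> cball 0 r" for x y
      using contr[OF \<open>\<bar>t\<bar> < \<delta>\<close>] that by (auto simp: dist_norm)
  qed auto
  then have "\<forall>t. \<exists>x. \<bar>t\<bar> < \<delta> \<longrightarrow> x \<in> S \<inter> cball 0 r \<and> f t x = x" by metis
  then obtain x where x: "\<And>t. \<bar>t\<bar> < \<delta> \<Longrightarrow> x t \<in> S \<inter> cball 0 r \<and> f t (x t) = x t"
    by metis
  have xr: "norm (x t) \<le> r" if "\<bar>t\<bar> < \<delta>" for t using x[OF that] by auto
  have uniq: "y = x t" if "\<bar>t\<bar> < \<delta>" "norm y \<le> r" "y = f t y" for t y
    using contr[OF that(1,2) xr[OF that(1)]] x[OF that(1)] that(3) by simp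
  have x0: "x 0 = 0" using uniq[of 0 0] \<delta> r by (auto simp: f_def P.zero_left)
  define I where "I = {-\<delta><..<\<delta>}"
  have I: "open I" "\<And>t. t \<in> I \<longleftrightarrow> \<bar>t\<bar> < \<delta>" by (auto simp: I_def)
  define g where "g t = Q (e + x t) (e + x t)" for t
  \<comment> \<open>The increment splits into moving the point at the fixed parameter
    \<open>s\<close>, which is what \<open>A\<close> measures, and moving the parameter at the fixed
    point \<open>x t\<close>, on which \<open>f\<close> depends affinely.\<close>
  have diff_eq: "x s - x t = A s (x s) (x t) (x s - x t) + (s - t) *\<^sub>R g t" if "s \<in> I" "t \<in> I" for s t
  proof -
    have "x s - x t = (f s (x s) - f s (x t)) + (f s (x t) - f t (x t))"
      using x that I by auto
    then show ?thesis by (simp add: f_diff) (simp add: f_def g_def algebra_simps)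
  qed
  have x_cont: "isCont x t" if t: "t \<in> I" for t
  proof -
    have "\<forall>\<^sub>F s in at t. s \<in> I" using I(1) t by (rule eventually_at_in_open')
    then have "\<forall>\<^sub>F s in at t. norm (x s - x t) \<le> 2 * (\<bar>s - t\<bar> * norm (g t))"
    proof (rule eventually_mono)
      fix s assume s: "s \<in> I"
      have "norm (A s (x s) (x t) (x s - x t)) \<le> 1/2 * norm (x s - x t)"
        by (rule norm_blinfun_le) (use A_norm[of s "x s" "x t"] xr s t I in auto)
      then show "norm (x s - x t) \<le> 2 * (\<bar>s - t\<bar> * norm (g t))"
        using arg_cong[OF diff_eq[OF s t], of norm]
          norm_triangle_ineq[of "A s (x s) (x t) (x s - x t)" "(s - t) *\<^sub>R g t"]
        by (simp only: norm_scaleR real_norm_def)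
    qed
    moreover have "((\<lambda>s. 2 * (\<bar>s - t\<bar> * norm (g t))) \<longlongrightarrow> 2 * (\<bar>t - t\<bar> * norm (g t))) (at t)"
      by (intro tendsto_intros)
    ultimately have "((\<lambda>s. x s - x t) \<longlongrightarrow> 0) (at t)"
      by (intro Lim_null_comparison[of "\<lambda>s. x s - x t"]) auto
    then show ?thesis by (simp add: LIM_zero_iff isCont_def)
  qed
  define z where "z t = (SOME z. z = A t (x t) (x t) z + g t)" for t
  have An: "norm (A t (x t) (x t)) \<le> 1/2" if "t \<in> I" for t
    using A_norm xr that I by auto
  have z: "z t = A t (x t) (x t) (z t) + g t" if "t \<in> I" for t
    unfolding z_def by (rule someI_ex) (rule near_identity_solvable[OF An[OF that]])
  have deriv: "(x has_vector_derivative z t) (at t)" if t: "t \<in> I" for t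
  proof -
    have "((\<lambda>s. (x s - x t) /\<^sub>R (s - t)) \<longlongrightarrow> z t) (at t)"
    proof (rule near_identity_tendsto)
      show "((\<lambda>s. A s (x s) (x t)) \<longlongrightarrow> A t (x t) (x t)) (at t)"
        unfolding A_def using x_cont[OF t]
        by (intro tendsto_intros bounded_linear.tendsto[OF P.bounded_linear_prod_left]
            bounded_linear.tendsto[OF P.bounded_linear_prod_right] bounded_linear.tendsto[OF Q.bounded_linear_prod_left]
            bounded_linear.tendsto[OF Q.bounded_linear_prod_right]) (auto simp: isCont_def)
      show "((\<lambda>s. g t) \<longlongrightarrow> g t) (at t)" by simp
      have ev: "\<forall>\<^sub>F s in at t. s \<in> I" using I(1) t by (rule eventually_at_in_open')
      show "\<forall>\<^sub>F s in at t. norm (A s (x s) (x t)) \<le> 1/2"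
        using ev by (rule eventually_mono) (use A_norm xr t I in auto)
      have ne: "\<forall>\<^sub>F s in at t. s \<noteq> t" by (rule eventually_neq_at_within)
      show "\<forall>\<^sub>F s in at t. (x s - x t) /\<^sub>R (s - t) = A s (x s) (x t) ((x s - x t) /\<^sub>R (s - t)) + g t"
        using ev ne
      proof eventually_elim
        fix s assume s: "s \<in> I" "s \<noteq> t"
        have "(x s - x t) /\<^sub>R (s - t) = (A s (x s) (x t) (x s - x t) + (s - t) *\<^sub>R g t) /\<^sub>R (s - t)"
          using diff_eq[OF s(1) t] by simp
        also have "\<dots> = A s (x s) (x t) ((x s - x t) /\<^sub>R (s - t)) + g t"
          using s(2) by (simp add: scaleR_add_right blinfun.scaleR_right)
        finally show "(x s - x t) /\<^sub>R (s - t) = A s (x s) (x t) ((x s - x t) /\<^sub>R (s - t)) + g t" .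
      qed
      show "z t = A t (x t) (x t) (z t) + g t" by (rule z[OF t])
    qed
    then show ?thesis by (simp add: has_vector_derivative_iff_quotient)
  qed
  have "Cn_on n I x" for n
  proof (induction n)
    case 0
    then show ?case using x_cont by (simp add: continuous_at_imp_continuous_on)
  next
    case (Suc n)
    have ex: "Cn_on n I (\<lambda>t. e + x t)" by (intro Cn_on_add Cn_on_const Suc)
    have "Cn_on n I (\<lambda>t. A t (x t) (x t))"
      unfolding A_def
      by (intro Cn_on_add Cn_on_bilinear[OF bounded_bilinear_scaleR] Cn_on_ident
          Cn_on_linear[OF P.bounded_linear_prod_left] Cn_on_linear[OF P.bounded_linear_prod_right]
          Cn_on_linear[OF Q.bounded_linear_prod_left] Cn_on_linear[OF Q.bounded_linear_prod_right] Suc ex Cn_on_const)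
    moreover have "Cn_on n I g" unfolding g_def by (rule Cn_on_bilinear[OF Q ex ex])
    ultimately have "Cn_on n I z"
      using Cn_on_near_identity[of I "\<lambda>t. A t (x t) (x t)" n g z] I(1) An z by blast
    then show ?case using deriv by auto
  qed
  then have "smooth_curve_on I x" using I(1) by (rule smooth_curve_on_if_Cn_on[rotated])
  then show ?thesis
    using \<delta> r x0 x xr uniq by (intro exI[of _ \<delta>] exI[of _ r] exI[of _ x]) (auto simp: I_def f_def)
qed

section \<open>The Banach algebra of continuous functions on the circle\<close>

lemma periodic_shift_int:
  assumes "periodic f"
  shows "f (x + 2 * pi * of_int m) = f x"
proof -
  have nat: "f (x + 2 * pi * real n) = f x" for x n
  proof (induction n)
    case (Suc n)
    have "f (x + 2 * pi * real n + 2 * pi) = f (x + 2 * pi * real n)"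
      using assms unfolding periodic_def by blast
    then show ?case using Suc by (simp add: algebra_simps)
  qed simp
  show ?thesis
  proof (cases "m \<ge> 0")
    case True
    then show ?thesis using nat[of x "nat m"] by simp
  next
    case False
    then show ?thesis using nat[of "x + 2 * pi * of_int m" "nat (- m)"] by simp
  qed
qed

lemma periodic_reduce:
  assumes "periodic f"
  obtains y where "y \<in> {0..2 * pi}" "f y = f x"
proof
  define m where "m = \<lfloor>x / (2 * pi)\<rfloor>"
  have "of_int m \<le> x / (2 * pi)" "x / (2 * pi) < of_int m + 1" by (auto simp: m_def)
  then show "x + 2 * pi * of_int (- m) \<in> {0..2 * pi}" by (auto simp: field_simps)
  show "f (x + 2 * pi * of_int (- m)) = f x" by (rule periodic_shift_int[OF assms])
qed

lemma periodic_bounded: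
  fixes f :: "real \<Rightarrow> 'a::real_normed_vector"
  assumes "periodic f" "continuous_on UNIV f"
  shows "\<exists>B. \<forall>x. norm (f x) \<le> B"
proof -
  have "compact (f ` {0..2 * pi})"
    by (rule compact_continuous_image[OF continuous_on_subset[OF assms(2)]]) auto
  then obtain B where B: "\<forall>y\<in>f ` {0..2 * pi}. norm y \<le> B"
    using compact_imp_bounded bounded_iff by metis
  have "norm (f x) \<le> B" for x
    using periodic_reduce[OF assms(1), of x] B by (metis imageI)
  then show ?thesis by blast
qed

text \<open>A closed subspace of the bounded continuous functions, hence complete in the sup norm.
  As a type it can be used to build the Banach space in which the fixed point equation is
  solved.\<close>

typedef per = "{f :: real \<Rightarrow>\<^sub>C real. periodic (apply_bcontfun f)}"
  morphisms per_bcontfun Abs_per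
  by (rule exI[of _ 0]) (simp add: periodic_def)

setup_lifting type_definition_per

definition ev :: "per \<Rightarrow> real \<Rightarrow> real" where
  "ev f = apply_bcontfun (per_bcontfun f)"

definition mkper :: "(real \<Rightarrow> real) \<Rightarrow> per" where
  "mkper f = Abs_per (Bcontfun f)"

lemma ev_mkper:
  assumes "periodic f" "continuous_on UNIV f"
  shows "ev (mkper f) = f"
proof -
  have "f \<in> bcontfun"
    using periodic_bounded[OF assms] bcontfun_normI[OF assms(2)] by auto
  then show ?thesis
    using assms(1) by (simp add: ev_def mkper_def Abs_per_inverse Bcontfun_inverse)
qed

lemma periodic_ev: "periodic (ev f)"
  using per_bcontfun by (simp add: ev_def)

lemma continuous_on_ev [continuous_intros]: "continuous_on A (ev f)"
  by (simp add: ev_def)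

lemma per_eqI: "(\<And>x. ev f x = ev g x) \<Longrightarrow> f = g"
  by (metis bcontfun_eqI ev_def per_bcontfun_inject)

instantiation per :: real_vector
begin

lift_definition zero_per :: per is 0 by (simp add: periodic_def)
lift_definition plus_per :: "per \<Rightarrow> per \<Rightarrow> per" is "(+)" by (simp add: periodic_def)
lift_definition minus_per :: "per \<Rightarrow> per \<Rightarrow> per" is "(-)" by (simp add: periodic_def)
lift_definition uminus_per :: "per \<Rightarrow> per" is "uminus" by (simp add: periodic_def)
lift_definition scaleR_per :: "real \<Rightarrow> per \<Rightarrow> per" is "scaleR" by (simp add: periodic_def)

instance
proof
  fix f g h :: per and a b :: real
  show "f + g + h = f + (g + h)" by transfer (simp add: add.assoc)
  show "f + g = g + f" by transfer (simp add: add.commute)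
  show "0 + f = f" by transfer simp
  show "- f + f = 0" by transfer simp
  show "f - g = f + - g" by transfer simp
  show "a *\<^sub>R (f + g) = a *\<^sub>R f + a *\<^sub>R g" by transfer (simp add: scaleR_add_right)
  show "(a + b) *\<^sub>R f = a *\<^sub>R f + b *\<^sub>R f" by transfer (simp add: scaleR_add_left)
  show "a *\<^sub>R b *\<^sub>R f = (a * b) *\<^sub>R f" by transfer simp
  show "1 *\<^sub>R f = f" by transfer simp
qed

end

instantiation per :: real_normed_vector
begin

lift_definition norm_per :: "per \<Rightarrow> real" is norm .
definition dist_per :: "per \<Rightarrow> per \<Rightarrow> real" where "dist_per f g = norm (f - g)"
definition sgn_per :: "per \<Rightarrow> per" where "sgn_per f = f /\<^sub>R norm f"
definition uniformity_per :: "(per \<times> per) filter" where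
  "uniformity_per = (INF e\<in>{0 <..}. principal {(x, y). dist x y < e})"
definition open_per :: "per set \<Rightarrow> bool" where
  "open_per S = (\<forall>x\<in>S. \<forall>\<^sub>F (x', y) in uniformity. x' = x \<longrightarrow> y \<in> S)"

instance
proof
  fix f g :: per and a :: real and U :: "per set"
  show "dist f g = norm (f - g)" by (rule dist_per_def)
  show "sgn f = f /\<^sub>R norm f" by (rule sgn_per_def)
  show "uniformity = (INF e\<in>{0 <..}. principal {(x, y :: per). dist x y < e})"
    by (rule uniformity_per_def)
  show "open U = (\<forall>x\<in>U. \<forall>\<^sub>F (x', y) in uniformity. x' = x \<longrightarrow> y \<in> U)" by (rule open_per_def)
  show "norm f = 0 \<longleftrightarrow> f = 0" by transfer simp
  show "norm (f + g) \<le> norm f + norm g" by transfer (rule norm_triangle_ineq)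
  show "norm (a *\<^sub>R f) = \<bar>a\<bar> * norm f" by transfer simp
qed

end

instance per :: banach
proof
  fix X :: "nat \<Rightarrow> per"
  assume X: "Cauchy X"
  have d: "dist f g = dist (per_bcontfun f) (per_bcontfun g)" for f g
    by (simp add: dist_per_def dist_norm norm_per.rep_eq minus_per.rep_eq)
  have "Cauchy (\<lambda>n. per_bcontfun (X n))"
    using X by (simp add: Cauchy_def d)
  then obtain L where L: "(\<lambda>n. per_bcontfun (X n)) \<longlonglongrightarrow> L"
    using Cauchy_convergent_iff convergent_def by blast
  have pt: "(\<lambda>n. ev (X n) x) \<longlonglongrightarrow> apply_bcontfun L x" for x
    using tendsto_uniform_limitI[OF tendsto_bcontfun_uniform_limit[OF L], of x] by (simp add: ev_def)
  have "periodic (apply_bcontfun L)"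
    unfolding periodic_def
  proof
    fix x
    have "ev (X n) (x + 2 * pi) = ev (X n) x" for n
      using periodic_ev by (simp add: periodic_def)
    then show "apply_bcontfun L (x + 2 * pi) = apply_bcontfun L x"
      using pt[of "x + 2 * pi"] pt[of x] LIMSEQ_unique by simp
  qed
  then have "per_bcontfun (Abs_per L) = L" by (simp add: Abs_per_inverse)
  then have "X \<longlonglongrightarrow> Abs_per L"
    using L by (simp add: tendsto_iff d)
  then show "convergent X" by (auto simp: convergent_def)
qed



lemma ev_0 [simp]: "ev 0 x = 0"
  and ev_add [simp]: "ev (f + g) x = ev f x + ev g x"
  and ev_diff [simp]: "ev (f - g) x = ev f x - ev g x"
  and ev_minus [simp]: "ev (- f) x = - ev f x"
  and ev_scaleR [simp]: "ev (c *\<^sub>R f) x = c * ev f x"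
  by (simp_all add: ev_def zero_per.rep_eq plus_per.rep_eq minus_per.rep_eq uminus_per.rep_eq scaleR_per.rep_eq)

lemma abs_ev_le: "\<bar>ev f x\<bar> \<le> norm f"
  using norm_bounded[of "per_bcontfun f" x] by (simp add: ev_def norm_per.rep_eq)

lemma norm_per_le: "(\<And>x. \<bar>ev f x\<bar> \<le> b) \<Longrightarrow> norm f \<le> b"
  by (simp add: ev_def norm_per.rep_eq norm_bound)

instantiation per :: "{comm_ring, real_normed_algebra_1}"
begin

definition one_per :: per where "one_per = mkper (\<lambda>_. 1)"
definition times_per :: "per \<Rightarrow> per \<Rightarrow> per" where "f * g = mkper (\<lambda>x. ev f x * ev g x)"

lemma ev_1: "ev 1 x = 1"
  by (simp add: one_per_def ev_mkper periodic_def)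

lemma ev_mult: "ev (f * g) x = ev f x * ev g x"
proof -
  have "periodic (\<lambda>x. ev f x * ev g x)"
    using periodic_ev by (simp add: periodic_def)
  then show ?thesis by (simp add: times_per_def ev_mkper continuous_intros)
qed

instance
proof
  fix f g h :: per and a :: real
  show "f * g * h = f * (g * h)" "f * g = g * f" "1 * f = f" "f * 1 = f"
    "(f + g) * h = f * h + g * h" "f * (g + h) = f * g + f * h"
    "a *\<^sub>R f * g = a *\<^sub>R (f * g)" "f * a *\<^sub>R g = a *\<^sub>R (f * g)"
    by (rule per_eqI; simp add: ev_mult ev_1 algebra_simps)+
  show "(0::per) \<noteq> 1" by (metis ev_0 ev_1 zero_neq_one)
  show "norm (f * g) \<le> norm f * norm g"
    by (rule norm_per_le) (auto simp: ev_mult abs_mult intro!: mult_mono abs_ev_le)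
  show "norm (1::per) = 1"
    by (rule antisym, rule norm_per_le) (use abs_ev_le[of 1 0] in \<open>simp_all add: ev_1\<close>)
qed

end

lemmas ev_ring [simp] = ev_1 ev_mult

lemma bounded_linear_ev [bounded_linear]: "bounded_linear (\<lambda>f. ev f x)"
  by (rule bounded_linear_intro[where K = 1]) (use abs_ev_le in auto)

section \<open>Reflection and parity\<close>

definition refl_per :: "per \<Rightarrow> per" where
  "refl_per f = mkper (\<lambda>x. ev f (- x))"

lemma ev_refl_per [simp]: "ev (refl_per f) x = ev f (- x)"
proof -
  have "periodic (\<lambda>x. ev f (- x))"
    unfolding periodic_def
  proof
    fix x
    have "ev f ((- x - 2 * pi) + 2 * pi) = ev f (- x - 2 * pi)"
      using periodic_ev unfolding periodic_def by blast
    then show "ev f (- (x + 2 * pi)) = ev f (- x)" by (simp add: algebra_simps)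
  qed
  moreover have "continuous_on UNIV (\<lambda>x. ev f (- x))"
    by (rule continuous_on_compose2[OF continuous_on_ev[of UNIV]]) (auto intro: continuous_intros)
  ultimately show ?thesis by (simp add: refl_per_def ev_mkper)
qed

definition even_per :: "per \<Rightarrow> bool" where "even_per f \<longleftrightarrow> (\<forall>x. ev f (- x) = ev f x)"
definition odd_per :: "per \<Rightarrow> bool" where "odd_per f \<longleftrightarrow> (\<forall>x. ev f (- x) = - ev f x)"

lemma parity_intros:
  "even_per 0" "odd_per 0" "even_per 1"
  "even_per f \<Longrightarrow> even_per g \<Longrightarrow> even_per (f + g)" "odd_per f \<Longrightarrow> odd_per g \<Longrightarrow> odd_per (f + g)"
  "even_per f \<Longrightarrow> even_per g \<Longrightarrow> even_per (f - g)" "odd_per f \<Longrightarrow> odd_per g \<Longrightarrow> odd_per (f - g)"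
  "even_per f \<Longrightarrow> even_per (- f)" "odd_per f \<Longrightarrow> odd_per (- f)"
  "even_per f \<Longrightarrow> even_per (c *\<^sub>R f)" "odd_per f \<Longrightarrow> odd_per (c *\<^sub>R f)"
  "even_per f \<Longrightarrow> even_per g \<Longrightarrow> even_per (f * g)" "odd_per f \<Longrightarrow> odd_per g \<Longrightarrow> even_per (f * g)"
  "even_per f \<Longrightarrow> odd_per g \<Longrightarrow> odd_per (f * g)" "odd_per f \<Longrightarrow> even_per g \<Longrightarrow> odd_per (f * g)"
  by (simp_all add: even_per_def odd_per_def)

lemma closed_even_per: "closed {f. even_per f}"
proof -
  have "{f. even_per f} = (\<Inter>x. {f. ev f (- x) - ev f x = 0})" by (auto simp: even_per_def)
  also have "closed \<dots>"
    by (intro closed_INT ballI closed_Collect_eq continuous_intros bounded_linear.continuous_on[OF bounded_linear_ev])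
  finally show ?thesis .
qed

lemma closed_odd_per: "closed {f. odd_per f}"
proof -
  have "{f. odd_per f} = (\<Inter>x. {f. ev f (- x) + ev f x = 0})" by (auto simp: odd_per_def eq_neg_iff_add_eq_0)
  also have "closed \<dots>"
    by (intro closed_INT ballI closed_Collect_eq continuous_intros bounded_linear.continuous_on[OF bounded_linear_ev])
  finally show ?thesis .
qed

text \<open>A relation, because not every element of \<open>per\<close> is differentiable; taking
  the derivative in \<open>per\<close> includes its continuity.\<close>

definition pderiv_per :: "per \<Rightarrow> per \<Rightarrow> bool" where
  "pderiv_per f g \<longleftrightarrow> (\<forall>x. (ev f has_real_derivative ev g x) (at x))"

lemma ev_fun: "ev (f + g) = (\<lambda>x. ev f x + ev g x)" "ev (f - g) = (\<lambda>x. ev f x - ev g x)"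
  "ev (- f) = (\<lambda>x. - ev f x)" "ev (c *\<^sub>R f) = (\<lambda>x. c * ev f x)" "ev (f * g) = (\<lambda>x. ev f x * ev g x)"
  "ev 1 = (\<lambda>x. 1)" "ev 0 = (\<lambda>x. 0)" "ev (refl_per f) = (\<lambda>x. ev f (- x))"
  by auto

lemma pderiv_per_intros:
  "pderiv_per f f' \<Longrightarrow> pderiv_per g g' \<Longrightarrow> pderiv_per (f + g) (f' + g')"
  "pderiv_per f f' \<Longrightarrow> pderiv_per g g' \<Longrightarrow> pderiv_per (f - g) (f' - g')"
  "pderiv_per f f' \<Longrightarrow> pderiv_per (- f) (- f')"
  "pderiv_per f f' \<Longrightarrow> pderiv_per (c *\<^sub>R f) (c *\<^sub>R f')"
  "pderiv_per f f' \<Longrightarrow> pderiv_per g g' \<Longrightarrow> pderiv_per (f * g) (f' * g + f * g')"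
  "pderiv_per 1 0" "pderiv_per 0 0"
  unfolding pderiv_per_def ev_fun
  by (auto intro!: derivative_eq_intros simp: algebra_simps)

lemma pderiv_per_refl:
  assumes "pderiv_per f f'" shows "pderiv_per (refl_per f) (- refl_per f')"
  unfolding pderiv_per_def
proof
  fix x
  have "(ev f has_real_derivative ev f' (- x)) (at (- x))"
    using assms by (simp add: pderiv_per_def)
  then have "((\<lambda>x. ev f (- x)) has_real_derivative ev f' (- x) * (- 1)) (at x)"
    by (rule DERIV_chain2) (auto intro!: derivative_eq_intros)
  then show "(ev (refl_per f) has_real_derivative ev (- refl_per f') x) (at x)"
    by (simp add: ev_fun)
qed

lemma pderiv_per_0:
  assumes "pderiv_per f 0" shows "f = ev f 0 *\<^sub>R 1"
proof (rule per_eqI)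
  fix x
  have "ev f x = ev f 0"
    by (rule DERIV_isconst_all) (use assms in \<open>auto simp: pderiv_per_def\<close>)
  then show "ev f x = ev (ev f 0 *\<^sub>R 1) x" by simp
qed

section \<open>Means and periodic primitives\<close>

definition mean :: "per \<Rightarrow> real" where
  "mean f = integral {0..2 * pi} (ev f) / (2 * pi)"

lemma ev_integrable: "ev f integrable_on {a..b}"
  by (intro integrable_continuous_interval continuous_intros)

lemma mean_add: "mean (f + g) = mean f + mean g"
  and mean_diff: "mean (f - g) = mean f - mean g"
  and mean_scaleR: "mean (c *\<^sub>R f) = c * mean f"
  and mean_minus: "mean (- f) = - mean f"
  and mean_0: "mean 0 = 0"
  and mean_1: "mean 1 = 1"
  unfolding mean_def ev_fun
  by (simp_all add: integral_add integral_diff ev_integrable add_divide_distrib diff_divide_distrib)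

lemmas mean_simps [simp] = mean_add mean_diff mean_scaleR mean_minus mean_0 mean_1

lemma abs_mean_le: "\<bar>mean f\<bar> \<le> norm f"
proof -
  have "norm (integral {0..2 * pi} (ev f)) \<le> norm f * (2 * pi - 0)"
    by (rule integral_bound) (auto intro: continuous_intros abs_ev_le)
  then show ?thesis by (simp add: mean_def field_simps abs_mult)
qed

lemma bounded_linear_mean [bounded_linear]: "bounded_linear mean"
  by (rule bounded_linear_intro[where K = 1]) (use abs_mean_le in auto)

lemma mean_pderiv:
  assumes "pderiv_per f g" shows "mean g = 0"
proof -
  have "(ev g has_integral (ev f (2 * pi) - ev f 0)) {0..2 * pi}"
    using assms
    by (intro fundamental_theorem_of_calculus)
       (auto simp: pderiv_per_def has_real_derivative_iff_has_vector_derivative intro: has_vector_derivative_at_within)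
  moreover have "ev f (2 * pi) = ev f 0" using periodic_ev[of f] unfolding periodic_def by (metis add_0)
  ultimately show ?thesis by (simp add: mean_def integral_unique)
qed

text \<open>A primitive grows by \<open>2 * pi * mean f\<close> over one period, so a vanishing mean
  is what makes it periodic. Subtracting a constant then normalises its own mean.\<close>

lemma pderiv_per_exists:
  assumes "mean f = 0"
  shows "\<exists>g. pderiv_per g f \<and> mean g = 0"
proof -
  have "\<exists>F. \<forall>x. -\<infinity> < ereal x \<longrightarrow> ereal x < \<infinity> \<longrightarrow> (F has_vector_derivative ev f x) (at x)"
    by (rule einterval_antiderivative) (use continuous_on_ev[of UNIV f] in \<open>auto simp: continuous_on_eq_continuous_at\<close>)
  then obtain F where F: "\<And>x. (F has_real_derivative ev f x) (at x)"
    by (auto simp: has_real_derivative_iff_has_vector_derivative)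
  have "(ev f has_integral (F (2 * pi) - F 0)) {0..2 * pi}"
    using F by (intro fundamental_theorem_of_calculus)
       (auto simp: has_real_derivative_iff_has_vector_derivative intro: has_vector_derivative_at_within)
  then have F0: "F (2 * pi) = F 0" using assms by (simp add: mean_def integral_unique)
  have "((\<lambda>x. F (x + 2 * pi) - F x) has_real_derivative 0) (at x)" for x
  proof -
    have "((\<lambda>x. F (x + 2 * pi)) has_real_derivative ev f (x + 2 * pi) * 1) (at x)"
      by (rule DERIV_chain2[of F]) (auto intro!: F derivative_eq_intros)
    then show ?thesis
      using F[of x] periodic_ev[of f] by (auto intro!: derivative_eq_intros simp: periodic_def)
  qed
  then have "F (x + 2 * pi) - F x = F (0 + 2 * pi) - F 0" for x
    using DERIV_isconst_all[of "\<lambda>x. F (x + 2 * pi) - F x" x 0] by blast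
  then have "periodic F" by (simp add: periodic_def F0)
  moreover have "continuous_on UNIV F" by (meson F DERIV_continuous_on has_field_derivative_at_within)
  ultimately have G: "ev (mkper F) = F" by (rule ev_mkper)
  have "pderiv_per (mkper F) f" using F by (simp add: pderiv_per_def G)
  then have "pderiv_per (mkper F - mean (mkper F) *\<^sub>R 1) (f - mean (mkper F) *\<^sub>R 0)"
    by (intro pderiv_per_intros)
  then show ?thesis by (intro exI[of _ "mkper F - mean (mkper F) *\<^sub>R 1"]) simp
qed

text \<open>The inverse of differentiation on functions of mean zero. Discarding the mean first
  makes it total, so that it becomes a bounded linear operator on all of \<open>per\<close>;
  solvability conditions are treated separately as vanishing means.\<close>

definition J :: "per \<Rightarrow> per" where
  "J f = (SOME g. pderiv_per g (f - mean f *\<^sub>R 1) \<and> mean g = 0)"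

lemma pderiv_J: "pderiv_per (J f) (f - mean f *\<^sub>R 1)" and mean_J [simp]: "mean (J f) = 0"
proof -
  have "\<exists>g. pderiv_per g (f - mean f *\<^sub>R 1) \<and> mean g = 0"
    by (rule pderiv_per_exists) simp
  then show "pderiv_per (J f) (f - mean f *\<^sub>R 1)" "mean (J f) = 0"
    unfolding J_def by (rule someI2_ex, simp)+
qed

lemma pderiv_J': "mean f = 0 \<Longrightarrow> pderiv_per (J f) f"
  using pderiv_J[of f] by simp

lemma pderiv_per_eq:
  assumes "pderiv_per f h" "pderiv_per g h" "mean f = mean g"
  shows "f = g"
proof -
  have "pderiv_per (f - g) (h - h)" using assms by (intro pderiv_per_intros)
  then have *: "f - g = ev (f - g) 0 *\<^sub>R 1" by (intro pderiv_per_0) simp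
  have "mean (f - g) = ev (f - g) 0" by (subst *) simp
  then have "ev (f - g) 0 = 0" using assms by simp
  then show ?thesis using * by simp
qed

lemma J_eqI: "pderiv_per g (f - mean f *\<^sub>R 1) \<Longrightarrow> mean g = 0 \<Longrightarrow> J f = g"
  by (rule pderiv_per_eq[OF pderiv_J]) auto

lemma J_pderiv: "pderiv_per f f' \<Longrightarrow> J f' = f - mean f *\<^sub>R 1"
proof (rule J_eqI)
  assume f: "pderiv_per f f'"
  have "pderiv_per (f - mean f *\<^sub>R 1) (f' - mean f *\<^sub>R 0)" by (intro pderiv_per_intros f)
  then show "pderiv_per (f - mean f *\<^sub>R 1) (f' - mean f' *\<^sub>R 1)" by (simp add: mean_pderiv[OF f])
qed simp

text \<open>The values of \<open>f\<close> stay within \<open>2 * pi * norm f'\<close> of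
  \<open>f 0\<close>, and as the mean is zero, \<open>f 0\<close> itself obeys the same bound.
  Together this gives the factor \<open>4 * pi\<close>.\<close>

lemma norm_le_pderiv:
  assumes "pderiv_per f f'" "mean f = 0"
  shows "norm f \<le> 4 * pi * norm f'"
proof -
  have b: "\<bar>ev f x - ev f 0\<bar> \<le> 2 * pi * norm f'" for x
  proof -
    obtain y where y: "y \<in> {0..2 * pi}" "ev f y = ev f x" using periodic_reduce[OF periodic_ev] .
    have "norm (ev f y - ev f 0) \<le> norm f' * norm (y - 0)"
      by (rule field_differentiable_bound[of UNIV])
         (use assms abs_ev_le in \<open>auto simp: pderiv_per_def\<close>)
    also have "\<dots> \<le> norm f' * (2 * pi)" using y by (intro mult_left_mono) auto
    finally show ?thesis using y by (simp add: mult_ac)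
  qed
  have "norm (f - ev f 0 *\<^sub>R 1) \<le> 2 * pi * norm f'" by (rule norm_per_le) (simp add: b)
  moreover from this have "\<bar>ev f 0\<bar> \<le> 2 * pi * norm f'"
    using abs_mean_le[of "f - ev f 0 *\<^sub>R 1"] assms(2) by simp
  ultimately show ?thesis
    using norm_triangle_ineq[of "f - ev f 0 *\<^sub>R 1" "ev f 0 *\<^sub>R 1"] by simp
qed

lemma bounded_linear_J [bounded_linear]: "bounded_linear J"
proof (rule bounded_linear_intro[where K = "8 * pi"])
  show "J (f + g) = J f + J g" for f g
  proof (rule J_eqI)
    have "pderiv_per (J f + J g) ((f - mean f *\<^sub>R 1) + (g - mean g *\<^sub>R 1))"
      by (intro pderiv_per_intros pderiv_J)
    then show "pderiv_per (J f + J g) (f + g - mean (f + g) *\<^sub>R 1)" by (simp add: algebra_simps)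
  qed simp
  show "J (c *\<^sub>R f) = c *\<^sub>R J f" for c f
  proof (rule J_eqI)
    have "pderiv_per (c *\<^sub>R J f) (c *\<^sub>R (f - mean f *\<^sub>R 1))"
      by (intro pderiv_per_intros pderiv_J)
    then show "pderiv_per (c *\<^sub>R J f) (c *\<^sub>R f - mean (c *\<^sub>R f) *\<^sub>R 1)" by (simp add: algebra_simps)
  qed simp
  show "norm (J f) \<le> norm f * (8 * pi)" for f
  proof -
    have "norm (f - mean f *\<^sub>R 1) \<le> 2 * norm f"
      using norm_triangle_ineq4[of f "mean f *\<^sub>R 1"] abs_mean_le[of f] by simp
    then have "4 * pi * norm (f - mean f *\<^sub>R 1) \<le> 4 * pi * (2 * norm f)"
      by (intro mult_left_mono) auto
    with norm_le_pderiv[OF pderiv_J mean_J, of f] have "norm (J f) \<le> 4 * pi * (2 * norm f)"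
      by (rule order_trans)
    then show ?thesis by (simp add: mult_ac)
  qed
qed

lemma even_per_refl: "even_per f \<longleftrightarrow> refl_per f = f"
  and odd_per_refl: "odd_per f \<longleftrightarrow> refl_per f = - f"
  by (auto simp: even_per_def odd_per_def intro!: per_eqI) (metis ev_refl_per ev_minus)+

text \<open>For odd \<open>f\<close> the periodic function \<open>refl_per (J f) - J f\<close> has
  the constant derivative \<open>2 * mean f\<close>. Derivatives of periodic functions have mean
  zero, so this constant vanishes; no substitution in the integral is made.\<close>

lemma mean_odd [simp]:
  assumes "odd_per f" shows "mean f = 0"
proof -
  let ?g = "J f"
  have "pderiv_per (refl_per ?g - ?g) (- refl_per (f - mean f *\<^sub>R 1) - (f - mean f *\<^sub>R 1))"
    by (intro pderiv_per_intros pderiv_J pderiv_per_refl)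
  then have "mean (- refl_per (f - mean f *\<^sub>R 1) - (f - mean f *\<^sub>R 1)) = 0" by (rule mean_pderiv)
  moreover have "- refl_per (f - mean f *\<^sub>R 1) - (f - mean f *\<^sub>R 1) = (2 * mean f) *\<^sub>R 1"
    by (rule per_eqI) (use assms in \<open>simp add: odd_per_def\<close>)
  ultimately show ?thesis by simp
qed

lemma even_J:
  assumes "odd_per f" shows "even_per (J f)"
proof -
  have f: "pderiv_per (J f) f" using assms by (simp add: pderiv_J')
  have "pderiv_per (refl_per (J f) - J f) (- refl_per f - f)"
    by (intro pderiv_per_intros pderiv_per_refl f)
  then have "pderiv_per (refl_per (J f) - J f) 0" using assms by (simp add: odd_per_refl)
  from pderiv_per_0[OF this] show ?thesis by (simp add: even_per_refl)
qed

text \<open>The sum of \<open>J f\<close> and its reflection is constant. Its mean is zero because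
  reflection does not change the mean: \<open>J f - refl_per (J f)\<close> is odd.\<close>

lemma odd_J:
  assumes "even_per f" shows "odd_per (J f)"
proof -
  let ?g = "J f"
  have "pderiv_per (?g + refl_per ?g) ((f - mean f *\<^sub>R 1) + (- refl_per (f - mean f *\<^sub>R 1)))"
    by (intro pderiv_per_intros pderiv_per_refl pderiv_J)
  moreover have "refl_per (f - mean f *\<^sub>R 1) = f - mean f *\<^sub>R 1"
    by (rule per_eqI) (use assms in \<open>simp add: even_per_def\<close>)
  ultimately have "pderiv_per (?g + refl_per ?g) 0" by simp
  then have c: "?g + refl_per ?g = ev (?g + refl_per ?g) 0 *\<^sub>R 1" by (rule pderiv_per_0)
  have "odd_per (?g - refl_per ?g)" by (simp add: odd_per_def)
  then have "mean (?g - refl_per ?g) = 0" by (rule mean_odd)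
  then have "mean (refl_per ?g) = 0" by simp
  then have "mean (?g + refl_per ?g) = 0" by simp
  then have "ev (?g + refl_per ?g) 0 = 0" using c by (metis mean_scaleR mean_1 mult.right_neutral)
  then have "?g + refl_per ?g = 0" using c by simp
  then show ?thesis by (simp add: odd_per_refl eq_neg_iff_add_eq_0 add.commute)
qed

definition cosp :: "nat \<Rightarrow> per" where "cosp k = mkper (\<lambda>x. cos (real k * x))"
definition sinp :: "nat \<Rightarrow> per" where "sinp k = mkper (\<lambda>x. sin (real k * x))"

lemma ev_cosp [simp]: "ev (cosp k) x = cos (real k * x)"
  and ev_sinp [simp]: "ev (sinp k) x = sin (real k * x)"
proof -
  have "periodic (\<lambda>x. cos (real k * x))" "periodic (\<lambda>x. sin (real k * x))"
    using sin.plus_of_nat[of "real k * _" k] cos.plus_of_nat[of "real k * _" k]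
    by (simp_all add: periodic_def algebra_simps)
  then show "ev (cosp k) x = cos (real k * x)" "ev (sinp k) x = sin (real k * x)"
    by (simp_all add: cosp_def sinp_def ev_mkper continuous_intros)
qed

lemma ev_cosp_fun: "ev (cosp k) = (\<lambda>x. cos (real k * x))" "ev (sinp k) = (\<lambda>x. sin (real k * x))"
  by auto

lemma pderiv_cosp: "pderiv_per (cosp k) (- real k *\<^sub>R sinp k)"
  and pderiv_sinp: "pderiv_per (sinp k) (real k *\<^sub>R cosp k)"
  unfolding pderiv_per_def ev_cosp_fun ev_fun
  by (auto intro!: derivative_eq_intros)

lemma even_cosp [simp]: "even_per (cosp k)" and odd_sinp [simp]: "odd_per (sinp k)"
  by (simp_all add: even_per_def odd_per_def)

lemma sinp_cosp_square: "sinp k * sinp k + cosp k * cosp k = 1"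
  by (rule per_eqI) (simp add: sin_cos_squared_add3 add.commute[of "sin _ * sin _"])

lemma mean_cosp [simp]: "k \<noteq> 0 \<Longrightarrow> mean (cosp k) = 0"
  using mean_pderiv[OF pderiv_sinp[of k]] by simp

text \<open>The derivative of \<open>sinp k * cosp k\<close> has mean zero, so both means agree;
  their sum is 1.\<close>

lemma mean_squares:
  assumes "k \<noteq> 0"
  shows "mean (sinp k * sinp k) = 1/2" "mean (cosp k * cosp k) = 1/2"
proof -
  have "pderiv_per (sinp k * cosp k) (real k *\<^sub>R cosp k * cosp k + sinp k * (- real k *\<^sub>R sinp k))"
    by (intro pderiv_per_intros pderiv_sinp pderiv_cosp)
  then have "mean (real k *\<^sub>R cosp k * cosp k + sinp k * (- real k *\<^sub>R sinp k)) = 0" by (rule mean_pderiv)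
  then have "mean (cosp k * cosp k) = mean (sinp k * sinp k)" using assms by simp
  moreover have "mean (sinp k * sinp k) + mean (cosp k * cosp k) = 1"
    using arg_cong[OF sinp_cosp_square[of k], of mean] by simp
  ultimately show "mean (sinp k * sinp k) = 1/2" "mean (cosp k * cosp k) = 1/2" by auto
qed

section \<open>Bounded bilinear maps into products\<close>

lemma bounded_bilinear_linear:
  assumes "bounded_bilinear B" "bounded_linear L"
  shows "bounded_bilinear (\<lambda>x y. L (B x y))"
proof -
  interpret B: bounded_bilinear B by fact
  interpret L: bounded_linear L by fact
  obtain K where K: "\<And>x y. norm (B x y) \<le> norm x * norm y * K" "K > 0" using B.pos_bounded by auto
  obtain M where M: "\<And>x. norm (L x) \<le> norm x * M" "M > 0" using L.pos_bounded by auto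
  show ?thesis
  proof
    show "\<exists>K. \<forall>a b. norm (L (B a b)) \<le> norm a * norm b * K"
    proof (intro exI allI)
      fix a b
      have "norm (L (B a b)) \<le> norm (B a b) * M" by (rule M)
      also have "\<dots> \<le> (norm a * norm b * K) * M" by (intro mult_right_mono K) (use M in simp)
      finally show "norm (L (B a b)) \<le> norm a * norm b * (K * M)" by (simp add: mult.assoc)
    qed
  qed (simp_all add: B.add_left B.add_right B.scaleR_left B.scaleR_right L.add L.scaleR)
qed

lemma bounded_bilinear_add:
  assumes "bounded_bilinear B" "bounded_bilinear C"
  shows "bounded_bilinear (\<lambda>x y. B x y + C x y)"
proof -
  interpret B: bounded_bilinear B by fact
  interpret C: bounded_bilinear C by fact
  obtain K where K: "\<And>x y. norm (B x y) \<le> norm x * norm y * K" using B.bounded by auto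
  obtain M where M: "\<And>x y. norm (C x y) \<le> norm x * norm y * M" using C.bounded by auto
  show ?thesis
  proof
    show "\<exists>K. \<forall>a b. norm (B a b + C a b) \<le> norm a * norm b * K"
      by (rule exI[of _ "K + M"], intro allI, rule norm_triangle_le)
         (use add_mono[OF K M] in \<open>simp add: algebra_simps\<close>)
  qed (simp_all add: B.add_left B.add_right B.scaleR_left B.scaleR_right
      C.add_left C.add_right C.scaleR_left C.scaleR_right scaleR_add_right)
qed

lemma bounded_bilinear_diff:
  assumes "bounded_bilinear B" "bounded_bilinear C"
  shows "bounded_bilinear (\<lambda>x y. B x y - C x y)"
  using bounded_bilinear_add[OF assms(1) bounded_bilinear_linear[OF assms(2) bounded_linear_minus[OF bounded_linear_ident]]]
  by simp

lemma bounded_bilinear_zero: "bounded_bilinear (\<lambda>x y. 0)"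
  by standard (auto intro: exI[of _ 0])

lemma bounded_bilinear_Pair:
  assumes "bounded_bilinear B" "bounded_bilinear C"
  shows "bounded_bilinear (\<lambda>x y. (B x y, C x y))"
proof -
  have "bounded_linear (\<lambda>b. (b, 0))" "bounded_linear (\<lambda>c. (0, c))"
    by (auto intro!: bounded_linear_intros)
  then have "bounded_bilinear (\<lambda>x y. (B x y, 0) + (0, C x y))"
    by (intro bounded_bilinear_add bounded_bilinear_linear[OF assms(1)] bounded_bilinear_linear[OF assms(2)])
  then show ?thesis by simp
qed

lemmas bounded_bilinear_intros = bounded_bilinear_add bounded_bilinear_diff bounded_bilinear_zero
  bounded_bilinear_Pair
  bounded_bilinear_linear[OF _ bounded_linear_scaleR_right]
  bounded_bilinear_linear[OF _ bounded_linear_minus[OF bounded_linear_ident]]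
  bounded_bilinear_linear[OF _ bounded_linear_mult_right]
  bounded_bilinear_linear[OF _ bounded_linear_divide]
  bounded_bilinear.comp[OF bounded_bilinear_mult]
  bounded_bilinear.comp[OF bounded_bilinear_scaleR]

section \<open>The linearised equation\<close>

text \<open>In the rotating frame \<open>E\<^sub>1, E\<^sub>2, E\<^sub>3\<close> write \<open>x = (R + a) E\<^sub>1 + b E\<^sub>2 + c E\<^sub>3\<close> and
  \<open>x \<times> x' + \<lambda> x = (\<lambda> R + p) E\<^sub>1 + q E\<^sub>2 + (R\<^sup>2 + n) E\<^sub>3\<close>; the scalar \<open>n\<close> is a constant of motion.
  The unknowns are \<open>(n, a, s, b, c, y)\<close> with \<open>s = p + R c\<close> and \<open>y = \<lambda>\<^sub>k b - q\<close>, which turns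
  \<open>a\<close> and \<open>s\<close> into constants of the linearised flow.\<close>

type_synonym state = "real \<times> per \<times> per \<times> per \<times> per \<times> per"
text \<open>Inhomogeneities of the linearised problem: five functions for the differential equations
  and two numbers for the conditions at \<eta> = 0. The scalar unknown \<open>n\<close> has no
  differential equation.\<close>

type_synonym data = "per \<times> per \<times> per \<times> per \<times> per \<times> real \<times> real"

definition zn :: "state \<Rightarrow> real" where "zn z = fst z"
definition za :: "state \<Rightarrow> per" where "za z = fst (snd z)"
definition zs :: "state \<Rightarrow> per" where "zs z = fst (snd (snd z))"
definition zb :: "state \<Rightarrow> per" where "zb z = fst (snd (snd (snd z)))"
definition zc :: "state \<Rightarrow> per" where "zc z = fst (snd (snd (snd (snd z))))"
definition zy :: "state \<Rightarrow> per" where "zy z = snd (snd (snd (snd (snd z))))"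
definition d1 :: "data \<Rightarrow> per" where "d1 d = fst d"
definition d2 :: "data \<Rightarrow> per" where "d2 d = fst (snd d)"
definition d3 :: "data \<Rightarrow> per" where "d3 d = fst (snd (snd d))"
definition d4 :: "data \<Rightarrow> per" where "d4 d = fst (snd (snd (snd d)))"
definition d5 :: "data \<Rightarrow> per" where "d5 d = fst (snd (snd (snd (snd d))))"
definition d6 :: "data \<Rightarrow> real" where "d6 d = fst (snd (snd (snd (snd (snd d)))))"
definition d7 :: "data \<Rightarrow> real" where "d7 d = snd (snd (snd (snd (snd (snd d)))))"

lemmas sel_defs = zn_def za_def zs_def zb_def zc_def zy_def d1_def d2_def d3_def d4_def d5_def d6_def d7_def

lemma sel_tuple [simp]:
  "zn (n, a, s, b, c, y) = n" "za (n, a, s, b, c, y) = a" "zs (n, a, s, b, c, y) = s"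
  "zb (n, a, s, b, c, y) = b" "zc (n, a, s, b, c, y) = c" "zy (n, a, s, b, c, y) = y"
  "d1 (f1, f2, f3, f4, f5, g1, g2) = f1" "d2 (f1, f2, f3, f4, f5, g1, g2) = f2"
  "d3 (f1, f2, f3, f4, f5, g1, g2) = f3" "d4 (f1, f2, f3, f4, f5, g1, g2) = f4"
  "d5 (f1, f2, f3, f4, f5, g1, g2) = f5" "d6 (f1, f2, f3, f4, f5, g1, g2) = g1"
  "d7 (f1, f2, f3, f4, f5, g1, g2) = g2"
  by (simp_all add: sel_defs)

lemma sel_linear [simp]:
  "zn (z + w) = zn z + zn w" "za (z + w) = za z + za w" "zs (z + w) = zs z + zs w"
  "zb (z + w) = zb z + zb w" "zc (z + w) = zc z + zc w" "zy (z + w) = zy z + zy w"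
  "zn (z - w) = zn z - zn w" "za (z - w) = za z - za w" "zs (z - w) = zs z - zs w"
  "zb (z - w) = zb z - zb w" "zc (z - w) = zc z - zc w" "zy (z - w) = zy z - zy w"
  "zn (t *\<^sub>R z) = t * zn z" "za (t *\<^sub>R z) = t *\<^sub>R za z" "zs (t *\<^sub>R z) = t *\<^sub>R zs z"
  "zb (t *\<^sub>R z) = t *\<^sub>R zb z" "zc (t *\<^sub>R z) = t *\<^sub>R zc z" "zy (t *\<^sub>R z) = t *\<^sub>R zy z"
  "d1 (d + e) = d1 d + d1 e" "d2 (d + e) = d2 d + d2 e" "d3 (d + e) = d3 d + d3 e"
  "d4 (d + e) = d4 d + d4 e" "d5 (d + e) = d5 d + d5 e" "d6 (d + e) = d6 d + d6 e"
  "d7 (d + e) = d7 d + d7 e"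
  "d1 (d - e) = d1 d - d1 e" "d2 (d - e) = d2 d - d2 e" "d3 (d - e) = d3 d - d3 e"
  "d4 (d - e) = d4 d - d4 e" "d5 (d - e) = d5 d - d5 e" "d6 (d - e) = d6 d - d6 e"
  "d7 (d - e) = d7 d - d7 e"
  "d1 (t *\<^sub>R d) = t *\<^sub>R d1 d" "d2 (t *\<^sub>R d) = t *\<^sub>R d2 d" "d3 (t *\<^sub>R d) = t *\<^sub>R d3 d"
  "d4 (t *\<^sub>R d) = t *\<^sub>R d4 d" "d5 (t *\<^sub>R d) = t *\<^sub>R d5 d" "d6 (t *\<^sub>R d) = t * d6 d"
  "d7 (t *\<^sub>R d) = t * d7 d"
  "zn 0 = 0" "za 0 = 0" "zs 0 = 0" "zb 0 = 0" "zc 0 = 0" "zy 0 = 0"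
  "d1 0 = 0" "d2 0 = 0" "d3 0 = 0" "d4 0 = 0" "d5 0 = 0" "d6 0 = 0" "d7 0 = 0"
  by (simp_all add: sel_defs)

lemma bounded_linear_sel [bounded_linear]:
  "bounded_linear zn" "bounded_linear za" "bounded_linear zs" "bounded_linear zb" "bounded_linear zc"
  "bounded_linear zy" "bounded_linear d1" "bounded_linear d2" "bounded_linear d3" "bounded_linear d4"
  "bounded_linear d5" "bounded_linear d6" "bounded_linear d7"
  unfolding sel_defs[abs_def]
  by (intro bounded_linear_fst_comp bounded_linear_snd_comp bounded_linear_ident)+

lemma state_eqI:
  "zn z = zn w \<Longrightarrow> za z = za w \<Longrightarrow> zs z = zs w \<Longrightarrow> zb z = zb w \<Longrightarrow> zc z = zc w \<Longrightarrow> zy z = zy w \<Longrightarrow> z = w"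
  by (simp add: sel_defs prod_eq_iff)

definition rev_state :: "state \<Rightarrow> bool" where
  "rev_state z \<longleftrightarrow> even_per (za z) \<and> even_per (zs z) \<and> odd_per (zb z) \<and> even_per (zc z) \<and> odd_per (zy z)"

text \<open>Each slot has the parity opposite to that of its unknown, since differentiation
  exchanges even and odd functions.\<close>

definition rev_data :: "data \<Rightarrow> bool" where
  "rev_data d \<longleftrightarrow> odd_per (d1 d) \<and> odd_per (d2 d) \<and> even_per (d3 d) \<and> odd_per (d4 d) \<and> even_per (d5 d)"

lemma pderiv_per_rhs: "pderiv_per f g \<Longrightarrow> g = h \<Longrightarrow> pderiv_per f h"
  by simp

lemma bounded_linear_mult_per: "bounded_linear L \<Longrightarrow> bounded_linear (\<lambda>d. (c :: per) * L d)"
  by (rule bounded_linear_compose[OF bounded_linear_mult_right])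

lemma bounded_linear_scaleR_one: "bounded_linear L \<Longrightarrow> bounded_linear (\<lambda>d. L d *\<^sub>R (c :: per))"
  by (rule bounded_linear_compose[OF bounded_linear_scaleR_left])

lemmas per_linear_intros =
  bounded_linear_mult_per bounded_linear_scaleR_one
  bounded_linear_add bounded_linear_sub bounded_linear_minus bounded_linear_Pair
  bounded_linear_const_scaleR bounded_linear_const_mult
  bounded_linear_sel[THEN bounded_linear_compose]
  bounded_linear_J[THEN bounded_linear_compose] bounded_linear_mean[THEN bounded_linear_compose]
  bounded_linear_ev[THEN bounded_linear_compose] bounded_linear_ident

locale mode =
  fixes R :: real and k :: nat
  assumes R: "R > 0" and k: "k \<ge> 2"
begin

definition kap :: real where "kap = R * sqrt ((real k)\<^sup>2 - 1)"
definition kp :: real where "kp = real k / sqrt ((real k)\<^sup>2 - 1)"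

lemma k_sq: "(real k)\<^sup>2 > 1"
proof -
  have "2\<^sup>2 \<le> (real k)\<^sup>2" using k by (intro power_mono) auto
  then show ?thesis by simp
qed

lemma kap_pos: "kap > 0" and kp_pos: "kp > 0"
  using R k k_sq by (simp_all add: kap_def kp_def)

text \<open>The second identity reads \<open>kap^2 + R^2 = (k R)^2\<close>. It turns the linearised
  equations \<open>R c' = y\<close>, \<open>y' = - (kap^2 / R + R) c\<close> into an oscillator of
  frequency \<open>k\<close>. The first one matches the amplitudes of \<open>b\<close> and
  \<open>c\<close> in \<open>V\<close>.\<close>

lemma kap_kp: "kap * kp = R * real k" and kap_sq: "kap * kap = R\<^sup>2 * ((real k)\<^sup>2 - 1)"
  using k_sq by (simp_all add: kap_def kp_def power2_eq_square)

lemma k_pos: "real k > 0" "k \<noteq> 0" using k by auto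

text \<open>The entries for \<open>b\<close> and \<open>c\<close> are the frame components of
  \<open>v_k\<close>, and the last entry is \<open>R c'\<close>, as the linearised equation for
  \<open>c\<close> demands.\<close>

definition V :: state where
  "V = (0, 0, 0, sinp k, - kp *\<^sub>R cosp k, (R * kp * real k) *\<^sub>R sinp k)"

text \<open>Up to the factor \<open>2\<pi>\<close> this is the \<open>H\<^sup>2\<close> inner product with \<open>v\<^sub>k\<close>, after moving all
  derivatives to \<open>v\<^sub>k\<close>.\<close>

definition ell :: "state \<Rightarrow> real" where
  "ell z = mean ((4 * real k ^ 3 + 6 * real k) *\<^sub>R (cosp k * za z)
     + (real k ^ 4 + 7 * (real k)\<^sup>2 + 3) *\<^sub>R (sinp k * zb z)
     - (kp * (1 + (real k)\<^sup>2 + real k ^ 4)) *\<^sub>R (cosp k * zc z))"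

lemma bounded_linear_ell: "bounded_linear ell"
  unfolding ell_def[abs_def] by (intro per_linear_intros)

lemmas ell_linear [simp] = bounded_linear_ell[THEN bounded_linear.linear, THEN linear_add]
  bounded_linear_ell[THEN bounded_linear.linear, THEN linear_diff]
  bounded_linear_ell[THEN bounded_linear.linear, THEN linear_scale]
  bounded_linear_ell[THEN bounded_linear.linear, THEN linear_0]

lemma ell_V: "ell V > 0"
proof -
  have "ell V = ((real k ^ 4 + 7 * (real k)\<^sup>2 + 3) + kp * (kp * (1 + (real k)\<^sup>2 + real k ^ 4))) / 2"
    using k_pos by (simp add: ell_def V_def mean_squares field_simps)
  also have "\<dots> > 0" using kp_pos k_pos by (intro divide_pos_pos add_pos_pos mult_pos_pos) auto
  finally show ?thesis .
qed

lemma rev_V: "rev_state V"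
  by (simp add: rev_state_def V_def parity_intros)

text \<open>The linearised equation with data \<open>d\<close>; the multiple \<open>m\<close> of the transversal direction
  (the derivative in \<open>\<lambda>\<close> of the linear part, applied to \<open>V\<close>) restores solvability.\<close>

definition lin_sol :: "real \<Rightarrow> state \<Rightarrow> data \<Rightarrow> bool" where
  "lin_sol m z d \<longleftrightarrow>
     pderiv_per (za z) (d1 d) \<and> pderiv_per (zs z) (d2 d) \<and>
     pderiv_per (zb z) ((1/R) *\<^sub>R (zn z *\<^sub>R 1 - kap *\<^sub>R zc z) + (m * kp / R) *\<^sub>R cosp k + d3 d) \<and>
     pderiv_per (zc z) ((1/R) *\<^sub>R zy z + (m / R) *\<^sub>R sinp k + d4 d) \<and>
     pderiv_per (zy z) (- ((real k)\<^sup>2 * R) *\<^sub>R zc z + (kap * zn z / R) *\<^sub>R 1 - kap *\<^sub>R za z + zs z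
        + (m * real k) *\<^sub>R cosp k + kap *\<^sub>R d3 d - d5 d) \<and>
     R * ev (za z) 0 = d6 d \<and> kap * ev (za z) 0 + ev (zs z) 0 = d7 d"

lemma lin_sol_add:
  assumes "lin_sol m z d" "lin_sol m' z' d'"
  shows "lin_sol (m + m') (z + z') (d + d')"
  using assms unfolding lin_sol_def
  by (auto simp: add_divide_distrib distrib_left distrib_right scaleR_add_left scaleR_add_right
      intro!: pderiv_per_intros(1)[THEN pderiv_per_rhs]) (auto simp: algebra_simps)

lemma lin_sol_scaleR:
  assumes "lin_sol m z d"
  shows "lin_sol (t * m) (t *\<^sub>R z) (t *\<^sub>R d)"
  using assms unfolding lin_sol_def
  by (auto intro!: pderiv_per_intros(4)[THEN pderiv_per_rhs] simp: scaleR_add_right scaleR_diff_right algebra_simps)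
     (metis distrib_left mult.left_commute)

lemma lin_sol_diff:
  assumes "lin_sol m z d" "lin_sol m' z' d'"
  shows "lin_sol (m - m') (z - z') (d - d')"
  using lin_sol_add[OF assms(1) lin_sol_scaleR[OF assms(2), of "-1"]] by simp

lemma lin_sol_V: "lin_sol 0 V 0"
proof -
  have 1: "pderiv_per (- (kp *\<^sub>R cosp k)) ((kp * real k) *\<^sub>R sinp k)"
    by (rule pderiv_per_rhs[OF pderiv_per_intros(3)[OF pderiv_per_intros(4)[OF pderiv_cosp]]]) simp
  have 2: "pderiv_per ((R * kp * real k) *\<^sub>R sinp k) ((kp * ((real k)\<^sup>2 * R)) *\<^sub>R cosp k)"
    by (rule pderiv_per_rhs, (rule pderiv_per_intros pderiv_sinp)+) (simp add: power2_eq_square mult_ac)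
  have 3: "kap * kp / R = real k" using kap_kp R by simp
  show ?thesis
    unfolding lin_sol_def V_def using R pderiv_sinp[of k] 1 2 3
    by (simp add: pderiv_per_intros mult_ac)
qed

section \<open>An explicit solution operator for the linearised equation\<close>

definition fa :: "data \<Rightarrow> per" where
  "fa d = J (d1 d) + ((1/R) * d6 d - ev (J (d1 d)) 0) *\<^sub>R 1"
definition fs :: "data \<Rightarrow> per" where
  "fs d = J (d2 d) + (d7 d - (kap / R) * d6 d - ev (J (d2 d)) 0) *\<^sub>R 1"
definition fH :: "data \<Rightarrow> per" where
  "fH d = kap *\<^sub>R d3 d - kap *\<^sub>R fa d + fs d - d5 d"
text \<open>Chosen so that \<open>mean (fQ d) = 0\<close>, the resonance condition that parity does
  not settle. The transversal direction contributes \<open>fm d / R\<close> to this mean, which is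
  the transversality of the bifurcation.\<close>

definition fm :: "data \<Rightarrow> real" where
  "fm d = (- 1 / real k) * mean ((real k * R) *\<^sub>R (sinp k * d4 d) + cosp k * fH d)"
definition fF :: "data \<Rightarrow> per" where
  "fF d = d4 d + ((1/R) * fm d) *\<^sub>R sinp k"
definition fG :: "data \<Rightarrow> per" where
  "fG d = fH d + (real k * fm d) *\<^sub>R cosp k"
text \<open>Variation of constants: \<open>fP\<close> and \<open>fQ\<close> are the derivatives of
  the coordinates of \<open>(c, y / (k R))\<close> in a plane rotating by the angle
  \<open>k \<eta>\<close>, where the homogeneous oscillator is at rest. The maps \<open>fch\<close>
  and \<open>fy\<close> rotate back.\<close>

definition fP :: "data \<Rightarrow> per" where
  "fP d = cosp k * fF d - (1 / (real k * R)) *\<^sub>R (sinp k * fG d)"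
definition fQ :: "data \<Rightarrow> per" where
  "fQ d = sinp k * fF d + (1 / (real k * R)) *\<^sub>R (cosp k * fG d)"
definition fch :: "data \<Rightarrow> per" where
  "fch d = cosp k * J (fP d) + sinp k * J (fQ d)"
definition fy :: "data \<Rightarrow> per" where
  "fy d = (real k * R) *\<^sub>R (cosp k * J (fQ d) - sinp k * J (fP d))"
text \<open>Determined by the requirement that the right side of the equation for \<open>b\<close>
  has mean zero. Through the shift in \<open>fc\<close>, the number \<open>n\<close> enters this
  mean with the factor \<open>1 - kap^2 / (k R)^2 = 1 / k^2\<close>, whose inverse stands in
  front.\<close>

definition fn :: "data \<Rightarrow> real" where
  "fn d = (real k)\<^sup>2 * (kap * mean (fch d) - R * mean (d3 d))"
text \<open>A constant shift of \<open>c\<close> absorbs the constant \<open>kap n / R\<close> in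
  the equation for \<open>y\<close>; that constant is therefore absent from
  \<open>fH\<close>.\<close>

definition fc :: "data \<Rightarrow> per" where
  "fc d = fch d + ((kap / ((real k)\<^sup>2 * R\<^sup>2)) * fn d) *\<^sub>R 1"
definition fb' :: "data \<Rightarrow> per" where
  "fb' d = (1/R) *\<^sub>R (fn d *\<^sub>R 1 - kap *\<^sub>R fc d) + ((kp / R) * fm d) *\<^sub>R cosp k + d3 d"
definition fz :: "data \<Rightarrow> state" where
  "fz d = (fn d, fa d, fs d, J (fb' d), fc d, fy d)"

text \<open>Subtracting a solution of the homogeneous problem selects the solution with
  \<open>ell = 0\<close>, the normalisation corresponding to orthogonality to
  \<open>v_k\<close>.\<close>

definition K :: "data \<Rightarrow> real \<times> state" where
  "K d = (fm d, fz d - ((1 / ell V) * ell (fz d)) *\<^sub>R V)"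

lemma bounded_linear_K: "bounded_linear K"
proof -
  have a: "bounded_linear fa" unfolding fa_def[abs_def] by (intro per_linear_intros)
  have s: "bounded_linear fs" unfolding fs_def[abs_def] by (intro per_linear_intros)
  have H: "bounded_linear fH" unfolding fH_def[abs_def] by (intro per_linear_intros a s)
  have m: "bounded_linear fm" unfolding fm_def[abs_def] by (intro per_linear_intros H)
  have F: "bounded_linear fF" unfolding fF_def[abs_def] by (intro per_linear_intros m)
  have G: "bounded_linear fG" unfolding fG_def[abs_def] by (intro per_linear_intros H m)
  have P: "bounded_linear fP" unfolding fP_def[abs_def] by (intro per_linear_intros F G)
  have Q: "bounded_linear fQ" unfolding fQ_def[abs_def] by (intro per_linear_intros F G)
  have ch: "bounded_linear fch" unfolding fch_def[abs_def] by (intro per_linear_intros P Q)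
  have y: "bounded_linear fy" unfolding fy_def[abs_def] by (intro per_linear_intros P Q)
  have n: "bounded_linear fn" unfolding fn_def[abs_def] by (intro per_linear_intros ch)
  have c: "bounded_linear fc" unfolding fc_def[abs_def] by (intro per_linear_intros ch n)
  have b: "bounded_linear fb'" unfolding fb'_def[abs_def] by (intro per_linear_intros n c m)
  have z: "bounded_linear fz" unfolding fz_def[abs_def] by (intro per_linear_intros n a s b c y)
  have "bounded_linear (\<lambda>d. ((1 / ell V) * ell (fz d)) *\<^sub>R V)"
    by (intro bounded_linear_compose[OF bounded_linear_scaleR_left] bounded_linear_const_mult
        bounded_linear_compose[OF bounded_linear_ell] z)
  then show ?thesis unfolding K_def[abs_def] by (intro per_linear_intros m z)
qed

lemma ell_K: "ell (snd (K d)) = 0"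
  using ell_V by (simp add: K_def)

lemma parity_f:
  assumes "rev_data d"
  shows "even_per (fa d)" "even_per (fs d)" "odd_per (fF d)" "even_per (fG d)"
    "odd_per (fP d)" "even_per (fQ d)" "even_per (fch d)" "odd_per (fy d)" "even_per (fc d)" "even_per (fb' d)"
proof -
  note i = parity_intros even_J odd_J even_cosp odd_sinp
  have d: "odd_per (d1 d)" "odd_per (d2 d)" "even_per (d3 d)" "odd_per (d4 d)" "even_per (d5 d)"
    using assms by (auto simp: rev_data_def)
  show a: "even_per (fa d)" and s: "even_per (fs d)" unfolding fa_def fs_def by (intro i d)+
  show F: "odd_per (fF d)" unfolding fF_def by (intro i d)
  show G: "even_per (fG d)" unfolding fG_def fH_def by (intro i d a s)
  show P: "odd_per (fP d)" unfolding fP_def by (intro i F G)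
  show Q: "even_per (fQ d)" unfolding fQ_def by (intro i F G)
  show ch: "even_per (fch d)" unfolding fch_def by (intro i P Q)
  show "odd_per (fy d)" unfolding fy_def by (intro i P Q)
  show c: "even_per (fc d)" unfolding fc_def by (intro i ch)
  show "even_per (fb' d)" unfolding fb'_def by (intro i c d)
qed

lemma rev_K: "rev_data d \<Longrightarrow> rev_state (snd (K d))"
  using parity_f[of d] rev_V by (auto simp: rev_state_def K_def fz_def intro!: parity_intros odd_J)

text \<open>Five primitives have to be periodic: those of \<open>d1\<close>, \<open>d2\<close> and
  \<open>fP\<close> by parity, that of \<open>fQ\<close> by the choice of \<open>fm\<close>, and
  that of \<open>fb'\<close> by the choice of \<open>fn\<close>.\<close>

lemma K_solves:
  assumes d: "rev_data d"
  shows "lin_sol (fst (K d)) (snd (K d)) d"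
proof -
  have kR: "real k * R \<noteq> 0" "R \<noteq> 0" "real k \<noteq> 0" using k R by auto
  have od: "mean (d1 d) = 0" "mean (d2 d) = 0" using d by (auto simp: rev_data_def)
  have mP: "mean (fP d) = 0" using parity_f[OF d] by simp
  have mQ: "mean (fQ d) = 0"
  proof -
    have "fQ d = (1 / (real k * R)) *\<^sub>R ((real k * R) *\<^sub>R (sinp k * d4 d) + cosp k * fH d)
        + (fm d / R) *\<^sub>R (sinp k * sinp k) + (fm d / R) *\<^sub>R (cosp k * cosp k)"
      by (rule per_eqI) (use kR in \<open>simp add: fQ_def fF_def fG_def field_simps\<close>)
    moreover have "mean ((real k * R) *\<^sub>R (sinp k * d4 d) + cosp k * fH d) = - real k * fm d"
      using kR by (simp add: fm_def)
    ultimately have "mean (fQ d) = (1 / (real k * R)) * (- real k * fm d) + fm d / R * (1/2) + fm d / R * (1/2)"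
      using mean_squares[OF k_pos(2)] by (simp only: mean_simps)
    then show ?thesis using kR by (simp add: field_simps)
  qed
  have PJ: "pderiv_per (J (fP d)) (fP d)" and QJ: "pderiv_per (J (fQ d)) (fQ d)"
    using mP mQ by (simp_all add: pderiv_J')
  have cs: "cos x * cos x = 1 - sin x * sin x" for x :: real
    using sin_cos_squared_add3[of x] by linarith
  have cs2: "cos u * (cos u * w) = w - sin u * (sin u * w)" for u w :: real
    by (simp add: cs left_diff_distrib flip: mult.assoc)
  have a: "pderiv_per (fa d) (d1 d)"
    unfolding fa_def by (rule pderiv_per_rhs, (rule pderiv_per_intros pderiv_J)+) (simp add: od)
  have s: "pderiv_per (fs d) (d2 d)"
    unfolding fs_def by (rule pderiv_per_rhs, (rule pderiv_per_intros pderiv_J)+) (simp add: od)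
  have ch: "pderiv_per (fch d) ((1/R) *\<^sub>R fy d + fF d)"
    unfolding fch_def
  proof (rule pderiv_per_rhs, (rule pderiv_per_intros pderiv_sinp pderiv_cosp PJ QJ)+, rule per_eqI)
    fix x
    have "cos (real k * x) * ev (fP d) x + sin (real k * x) * ev (fQ d) x = ev (fF d) x"
      by (simp add: fP_def fQ_def algebra_simps cs2)
    then show "ev (- real k *\<^sub>R sinp k * J (fP d) + cosp k * fP d + (real k *\<^sub>R cosp k * J (fQ d) + sinp k * fQ d)) x
      = ev ((1 / R) *\<^sub>R fy d + fF d) x"
      using kR by (simp add: fy_def algebra_simps)
  qed
  have y: "pderiv_per (fy d) (- ((real k)\<^sup>2 * R) *\<^sub>R fch d + fG d)"
    unfolding fy_def
  proof (rule pderiv_per_rhs, (rule pderiv_per_intros pderiv_sinp pderiv_cosp PJ QJ)+, rule per_eqI)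
    fix x
    have "(real k * R) * (cos (real k * x) * ev (fQ d) x - sin (real k * x) * ev (fP d) x) = ev (fG d) x"
      using kR by (simp add: fP_def fQ_def field_simps cs2)
    then show "ev ((real k * R) *\<^sub>R (- real k *\<^sub>R sinp k * J (fQ d) + cosp k * fQ d
          - (real k *\<^sub>R cosp k * J (fP d) + sinp k * fP d))) x
      = ev (- ((real k)\<^sup>2 * R) *\<^sub>R fch d + fG d) x"
      by (simp add: fch_def algebra_simps power2_eq_square)
  qed
  have c: "pderiv_per (fc d) ((1/R) *\<^sub>R fy d + fF d)"
    unfolding fc_def by (rule pderiv_per_rhs, (rule pderiv_per_intros ch)+) simp
  have mb: "mean (fb' d) = 0"
  proof -
    have "mean (fb' d) = (1/R) * (fn d - kap * (mean (fch d) + (kap / ((real k)\<^sup>2 * R\<^sup>2)) * fn d)) + mean (d3 d)"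
      using k_pos by (simp add: fb'_def fc_def)
    also have "\<dots> = (1/R) * (fn d * (1 - kap * kap / ((real k)\<^sup>2 * R\<^sup>2)) - kap * mean (fch d) + R * mean (d3 d))"
      using kR by (simp add: algebra_simps)
    also have "1 - kap * kap / ((real k)\<^sup>2 * R\<^sup>2) = 1 / (real k)\<^sup>2"
      using kR by (simp add: kap_sq field_simps)
    finally show ?thesis using kR by (simp add: fn_def)
  qed
  have b: "pderiv_per (J (fb' d)) (fb' d)" by (rule pderiv_J'[OF mb])
  have "lin_sol (fm d) (fz d) d"
    unfolding lin_sol_def fz_def sel_tuple
  proof (intro conjI a s)
    show "pderiv_per (J (fb' d)) ((1 / R) *\<^sub>R (fn d *\<^sub>R 1 - kap *\<^sub>R fc d) + (fm d * kp / R) *\<^sub>R cosp k + d3 d)"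
      using b by (simp add: fb'_def mult_ac)
    show "pderiv_per (fc d) ((1 / R) *\<^sub>R fy d + (fm d / R) *\<^sub>R sinp k + d4 d)"
      using c by (simp add: fF_def algebra_simps)
    show "pderiv_per (fy d) (- ((real k)\<^sup>2 * R) *\<^sub>R fc d + (kap * fn d / R) *\<^sub>R 1 - kap *\<^sub>R fa d + fs d
        + (fm d * real k) *\<^sub>R cosp k + kap *\<^sub>R d3 d - d5 d)"
    proof (rule pderiv_per_rhs[OF y], rule per_eqI)
      fix x
      show "ev (- ((real k)\<^sup>2 * R) *\<^sub>R fch d + fG d) x = ev (- ((real k)\<^sup>2 * R) *\<^sub>R fc d + (kap * fn d / R) *\<^sub>R 1 - kap *\<^sub>R fa d + fs d
        + (fm d * real k) *\<^sub>R cosp k + kap *\<^sub>R d3 d - d5 d) x"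
        using kR by (simp add: fc_def fG_def fH_def field_simps power2_eq_square)
    qed
    show "R * ev (fa d) 0 = d6 d" "kap * ev (fa d) 0 + ev (fs d) 0 = d7 d"
      using kR by (simp_all add: fa_def fs_def)
  qed
  from lin_sol_diff[OF this lin_sol_scaleR[OF lin_sol_V, of "(1 / ell V) * ell (fz d)"]]
  show ?thesis by (simp add: K_def)
qed

text \<open>In the rotating plane of the oscillator the coordinate \<open>q\<close> has the constant
  derivative \<open>m / R\<close>, so periodicity forces \<open>m = 0\<close>. Then both coordinates
  are constant; oddness kills \<open>q\<close>, and the other constant is the amplitude of a
  multiple of \<open>V\<close>.\<close>

lemma lin_sol_kernel:
  assumes L: "lin_sol m z 0" and rev: "rev_state z"
  shows "m = 0 \<and> (\<exists>t. z = t *\<^sub>R V)"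
proof -
  have kR: "real k * R \<noteq> 0" "R \<noteq> 0" "real k \<noteq> 0" using k R by auto
  have p: "odd_per (zb z)" "even_per (zc z)" "odd_per (zy z)" using rev by (auto simp: rev_state_def)
  have cs: "cos x * cos x = 1 - sin x * sin x" for x :: real
    using sin_cos_squared_add3[of x] by linarith
  have e: "pderiv_per (za z) 0" "pderiv_per (zs z) 0"
     "pderiv_per (zb z) ((1/R) *\<^sub>R (zn z *\<^sub>R 1 - kap *\<^sub>R zc z) + (m * kp / R) *\<^sub>R cosp k)"
     "pderiv_per (zc z) ((1/R) *\<^sub>R zy z + (m / R) *\<^sub>R sinp k)"
     "pderiv_per (zy z) (- ((real k)\<^sup>2 * R) *\<^sub>R zc z + (kap * zn z / R) *\<^sub>R 1 - kap *\<^sub>R za z + zs z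
        + (m * real k) *\<^sub>R cosp k)"
     "R * ev (za z) 0 = 0" "kap * ev (za z) 0 + ev (zs z) 0 = 0"
    using L by (auto simp: lin_sol_def)
  have a0: "za z = 0" and s0: "zs z = 0"
    using e(6,7) R pderiv_per_0[OF e(1)] pderiv_per_0[OF e(2)] by auto
  define ch where "ch = zc z - (kap * zn z / ((real k)\<^sup>2 * R\<^sup>2)) *\<^sub>R 1"
  have ch: "pderiv_per ch ((1/R) *\<^sub>R zy z + (m / R) *\<^sub>R sinp k)"
    unfolding ch_def by (rule pderiv_per_rhs, (rule pderiv_per_intros e(4))+) simp
  have y: "pderiv_per (zy z) (- ((real k)\<^sup>2 * R) *\<^sub>R ch + (m * real k) *\<^sub>R cosp k)"
    by (rule pderiv_per_rhs[OF e(5)], rule per_eqI)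
       (use kR in \<open>simp add: a0 s0 ch_def field_simps power2_eq_square\<close>)
  define q where "q = sinp k * ch + (1 / (real k * R)) *\<^sub>R (cosp k * zy z)"
  define p' where "p' = cosp k * ch - (1 / (real k * R)) *\<^sub>R (sinp k * zy z)"
  have q': "pderiv_per q ((m / R) *\<^sub>R 1)"
    unfolding q_def
  proof (rule pderiv_per_rhs, (rule pderiv_per_intros pderiv_sinp pderiv_cosp ch y)+, rule per_eqI)
    fix x
    show "ev (real k *\<^sub>R cosp k * ch + sinp k * ((1 / R) *\<^sub>R zy z + (m / R) *\<^sub>R sinp k)
      + (1 / (real k * R)) *\<^sub>R (- real k *\<^sub>R sinp k * zy z + cosp k * (- ((real k)\<^sup>2 * R) *\<^sub>R ch + (m * real k) *\<^sub>R cosp k))) x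
      = ev ((m / R) *\<^sub>R 1) x"
      using kR by (simp add: field_simps power2_eq_square cs)
  qed
  have m0: "m = 0" using mean_pderiv[OF q'] R by simp
  have q0: "q = 0"
  proof -
    have c: "q = ev q 0 *\<^sub>R 1" using q' m0 by (intro pderiv_per_0) simp
    have "odd_per q" unfolding q_def ch_def by (intro parity_intros odd_sinp even_cosp p)
    then have "ev q 0 = 0" by (auto simp: odd_per_def dest: spec[of _ 0])
    then show ?thesis using c by simp
  qed
  have p'': "pderiv_per p' 0"
    unfolding p'_def
  proof (rule pderiv_per_rhs, (rule pderiv_per_intros pderiv_sinp pderiv_cosp ch y)+, rule per_eqI)
    fix x
    show "ev (- real k *\<^sub>R sinp k * ch + cosp k * ((1 / R) *\<^sub>R zy z + (m / R) *\<^sub>R sinp k)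
      - (1 / (real k * R)) *\<^sub>R (real k *\<^sub>R cosp k * zy z + sinp k * (- ((real k)\<^sup>2 * R) *\<^sub>R ch + (m * real k) *\<^sub>R cosp k))) x
      = ev 0 x"
      using kR by (simp add: field_simps power2_eq_square m0)
  qed
  define C where "C = ev p' 0"
  have pC: "p' = C *\<^sub>R 1" using pderiv_per_0[OF p''] by (simp add: C_def)
  have chC: "ch = C *\<^sub>R cosp k"
  proof -
    have "ch = cosp k * p' + sinp k * q"
      by (rule per_eqI) (simp add: p'_def q_def algebra_simps, simp add: cs algebra_simps)
    then show ?thesis by (simp add: pC q0)
  qed
  have yC: "zy z = (- (real k * R * C)) *\<^sub>R sinp k"
  proof -
    have "zy z = (real k * R) *\<^sub>R (cosp k * q - sinp k * p')"
      by (rule per_eqI) (use kR in \<open>simp add: p'_def q_def field_simps, simp add: cs algebra_simps\<close>)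
    then show ?thesis by (simp add: pC q0)
  qed
  \<comment> \<open>The equation for \<open>b\<close> must have mean zero on the right; the mean of
    \<open>c\<close> depends on \<open>n\<close>, and the same factor \<open>1 / k^2\<close> as in
    \<open>fn\<close> remains.\<close>
  have n0: "zn z = 0"
  proof -
    have mc: "mean (zc z) = kap * zn z / ((real k)\<^sup>2 * R\<^sup>2)"
      using arg_cong[OF chC, of mean] k_pos by (simp add: ch_def)
    have "zn z - kap * mean (zc z) = 0" using mean_pderiv[OF e(3)] R by (simp add: m0)
    then have "zn z * (1 - kap * kap / ((real k)\<^sup>2 * R\<^sup>2)) = 0" by (simp add: mc algebra_simps)
    moreover have "1 - kap * kap / ((real k)\<^sup>2 * R\<^sup>2) = 1 / (real k)\<^sup>2"
      using kR by (simp add: kap_sq field_simps)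
    ultimately show ?thesis using kR by simp
  qed
  have cC: "zc z = C *\<^sub>R cosp k" using chC by (simp add: ch_def n0)
  define t where "t = - C / kp"
  have C: "C = - (t * kp)" using kp_pos by (simp add: t_def)
  have bt: "zb z = t *\<^sub>R sinp k"
  proof (rule pderiv_per_eq[OF e(3)])
    have "kap * kp / R = real k" using kap_kp R by simp
    then show "pderiv_per (t *\<^sub>R sinp k) ((1/R) *\<^sub>R (zn z *\<^sub>R 1 - kap *\<^sub>R zc z) + (m * kp / R) *\<^sub>R cosp k)"
      by (intro pderiv_per_rhs[OF pderiv_per_intros(4)[OF pderiv_sinp]])
         (simp add: n0 m0 cC C mult_ac)
    show "mean (zb z) = mean (t *\<^sub>R sinp k)" using p by simp
  qed
  have "z = t *\<^sub>R V"
    by (rule state_eqI) (simp_all add: V_def n0 a0 s0 bt cC yC C mult_ac)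
  then show ?thesis using m0 by blast
qed

lemma lin_sol_unique:
  assumes "lin_sol m z d" "rev_state z" "ell z = 0" "rev_data d"
  shows "(m, z) = K d"
proof -
  have "lin_sol (m - fst (K d)) (z - snd (K d)) 0"
    using lin_sol_diff[OF assms(1) K_solves[OF assms(4)]] by simp
  moreover have "rev_state (z - snd (K d))"
    using assms(2) rev_K[OF assms(4)] by (auto simp: rev_state_def intro!: parity_intros)
  ultimately obtain t where t: "m - fst (K d) = 0" "z - snd (K d) = t *\<^sub>R V"
    using lin_sol_kernel by blast
  have "t * ell V = 0" using arg_cong[OF t(2), of ell] assms(3) ell_K by simp
  then show ?thesis using t ell_V by (simp add: prod_eq_iff)
qed

end

section \<open>The branch of reversible solutions of the nonlinear equation\<close>

context mode
begin

definition zp :: "state \<Rightarrow> per" where "zp z = zs z - R *\<^sub>R zc z"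
definition zq :: "state \<Rightarrow> per" where "zq z = kap *\<^sub>R zb z - zy z"

text \<open>The terms linear in both the parameter shift and the state; \<open>dQ\<close> collects
  those quadratic in the state. The fifth slot belongs to \<open>q'\<close>: as
  \<open>y = kap b - q\<close>, the equation for \<open>y\<close> in \<open>lin_sol\<close> contains
  \<open>kap\<close> times the third slot minus the fifth.\<close>

definition dP :: "real \<Rightarrow> state \<Rightarrow> data" where
  "dP \<mu> z = (0, 0, (1/R) *\<^sub>R (- (\<mu> *\<^sub>R zc z)), (1/R) *\<^sub>R (\<mu> *\<^sub>R zb z), \<mu> *\<^sub>R za z, 0, - (\<mu> * ev (za z) 0))"

text \<open>The last two slots come from \<open>\<bar>x\<bar> = R\<close> and
  \<open>M \<cdot> x = \<lambda> R^2\<close> at \<eta> = 0, where \<open>b\<close> and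
  \<open>q\<close> vanish by oddness. One point is enough because both quantities are
  conserved.\<close>

definition dQ :: "state \<Rightarrow> state \<Rightarrow> data" where
  "dQ z w = ((1/R\<^sup>2) *\<^sub>R (zq z * zc w - zn z *\<^sub>R zb w),
     (1/R) *\<^sub>R (zp z * zb w - zq z * za w),
     (1/R\<^sup>2) *\<^sub>R (zn z *\<^sub>R za w - zp z * zc w),
     (1/R\<^sup>2) *\<^sub>R (zp z * zb w - zq z * za w),
     0,
     (- 1/2) * (ev (za z) 0 * ev (za w) 0 + ev (zc z) 0 * ev (zc w) 0),
     (- 1/R) * (ev (zp z) 0 * ev (za w) 0 + zn z * ev (zc w) 0))"

lemma bounded_linear_zpq: "bounded_linear zp" "bounded_linear zq"
  unfolding zp_def[abs_def] zq_def[abs_def] by (intro per_linear_intros)+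

lemmas state_linear = bounded_linear_zpq bounded_linear_sel
  bounded_linear_compose[OF bounded_linear_ev bounded_linear_zpq(1)]
  bounded_linear_compose[OF bounded_linear_ev bounded_linear_sel(2)]
  bounded_linear_compose[OF bounded_linear_ev bounded_linear_sel(5)]

lemma bounded_bilinear_dP: "bounded_bilinear dP"
  unfolding dP_def[abs_def]
  by (intro bounded_bilinear_intros state_linear bounded_linear_ident)

lemma bounded_bilinear_dQ: "bounded_bilinear dQ"
  unfolding dQ_def[abs_def]
  by (intro bounded_bilinear_intros state_linear)

lemma rev_dP: "rev_state z \<Longrightarrow> rev_data (dP \<mu> z)"
  by (auto simp: rev_state_def rev_data_def dP_def intro!: parity_intros)

lemma rev_zpq: "rev_state z \<Longrightarrow> even_per (zp z)" "rev_state z \<Longrightarrow> odd_per (zq z)"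
  by (auto simp: rev_state_def zp_def zq_def intro!: parity_intros)

lemma rev_dQ: "rev_state z \<Longrightarrow> rev_state w \<Longrightarrow> rev_data (dQ z w)"
  using rev_zpq[of z] by (simp add: rev_state_def rev_data_def dQ_def even_per_def odd_per_def diff_divide_distrib)

lemma rev_state_linear:
  "rev_state z \<Longrightarrow> rev_state w \<Longrightarrow> rev_state (z + w)" "rev_state z \<Longrightarrow> rev_state w \<Longrightarrow> rev_state (z - w)"
  "rev_state z \<Longrightarrow> rev_state (t *\<^sub>R z)" "rev_state 0"
  by (auto simp: rev_state_def intro!: parity_intros)

lemma rev_data_linear:
  "rev_data z \<Longrightarrow> rev_data w \<Longrightarrow> rev_data (z + w)" "rev_data z \<Longrightarrow> rev_data (t *\<^sub>R z)"
  by (auto simp: rev_data_def intro!: parity_intros)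

definition nonlin_sol :: "real \<Rightarrow> state \<Rightarrow> bool" where
  "nonlin_sol \<mu> z \<longleftrightarrow> lin_sol 0 z (dP \<mu> z + dQ z z)"

text \<open>The parameter derivative of the linear part at \<open>V\<close> is exactly the
  transversal direction built into \<open>lin_sol\<close>. Thus the parameter shift takes over the
  role of the multiplier \<open>m\<close> and becomes an unknown of the linear problem.\<close>

lemma lin_sol_dP_V: "lin_sol 0 z (dP \<mu> V + d) \<longleftrightarrow> lin_sol \<mu> z d"
proof -
  have kk: "kap * (\<mu> * kp) / R = \<mu> * real k" "kap * (\<mu> * kp / R) = \<mu> * real k"
    "\<mu> * (kp * kap) / R = \<mu> * real k"
    using kap_kp R by (simp_all add: field_simps)
  show ?thesis
    unfolding lin_sol_def using R
    by (simp add: dP_def V_def scaleR_add_right kk add.assoc mult_ac)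
qed

text \<open>After division by \<open>t\<close> the vector \<open>V\<close> leaves the linear part
  because it lies in the kernel, \<open>dP \<mu> V\<close> becomes the multiplier, and the quadratic
  term keeps one factor \<open>t\<close>.\<close>

lemma nonlin_sol_blowup:
  assumes "t \<noteq> 0"
  shows "nonlin_sol \<mu> (t *\<^sub>R (V + w)) \<longleftrightarrow> lin_sol \<mu> w (dP \<mu> w + t *\<^sub>R dQ (V + w) (V + w))"
proof -
  interpret P: bounded_bilinear dP by (rule bounded_bilinear_dP)
  interpret Q: bounded_bilinear dQ by (rule bounded_bilinear_dQ)
  let ?d = "dP \<mu> w + t *\<^sub>R dQ (V + w) (V + w)"
  have eq: "dP \<mu> (t *\<^sub>R (V + w)) + dQ (t *\<^sub>R (V + w)) (t *\<^sub>R (V + w)) = t *\<^sub>R (dP \<mu> V + ?d)"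
  proof -
    have "dP \<mu> (t *\<^sub>R u) + dQ (t *\<^sub>R u) (t *\<^sub>R u) = t *\<^sub>R (dP \<mu> u + t *\<^sub>R dQ u u)" for u
      by (simp add: P.scaleR_right Q.scaleR_left Q.scaleR_right scaleR_add_right)
    then show ?thesis by (simp only: P.add_right add.assoc)
  qed
  have "nonlin_sol \<mu> (t *\<^sub>R (V + w)) \<longleftrightarrow> lin_sol 0 (t *\<^sub>R (V + w)) (t *\<^sub>R (dP \<mu> V + ?d))"
    unfolding nonlin_sol_def eq ..
  also have "\<dots> \<longleftrightarrow> lin_sol 0 w (dP \<mu> V + ?d)"
  proof
    assume "lin_sol 0 (t *\<^sub>R (V + w)) (t *\<^sub>R (dP \<mu> V + ?d))"
    from lin_sol_diff[OF lin_sol_scaleR[OF this, of "1/t"] lin_sol_V]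
    show "lin_sol 0 w (dP \<mu> V + ?d)" using assms by simp
  next
    assume "lin_sol 0 w (dP \<mu> V + ?d)"
    from lin_sol_scaleR[OF lin_sol_add[OF lin_sol_V this], of t]
    show "lin_sol 0 (t *\<^sub>R (V + w)) (t *\<^sub>R (dP \<mu> V + ?d))" by simp
  qed
  finally show ?thesis by (simp add: lin_sol_dP_V)
qed

lemma nonlin_sol_0: "nonlin_sol \<mu> 0"
proof -
  interpret P: bounded_bilinear dP by (rule bounded_bilinear_dP)
  interpret Q: bounded_bilinear dQ by (rule bounded_bilinear_dQ)
  show ?thesis by (simp add: nonlin_sol_def P.zero_right Q.zero_right lin_sol_def pderiv_per_intros)
qed

lemma closed_rev_state: "closed {z. rev_state z}"
proof -
  have "{z. rev_state z} = (za -` {f. even_per f}) \<inter> (zs -` {f. even_per f}) \<inter> (zb -` {f. odd_per f})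
    \<inter> (zc -` {f. even_per f}) \<inter> (zy -` {f. odd_per f})"
    by (auto simp: rev_state_def)
  also have "closed \<dots>"
    by (intro closed_Int continuous_closed_vimage closed_even_per closed_odd_per
        linear_continuous_at bounded_linear_sel)
  finally show ?thesis .
qed

theorem rev_branch:
  "\<exists>\<delta> \<rho> \<mu> w. 0 < \<delta> \<and> 0 < \<rho> \<and> \<mu> 0 = 0 \<and> w 0 = 0 \<and>
    smooth_curve_on {-\<delta><..<\<delta>} (\<lambda>t. (\<mu> t, w t)) \<and>
    (\<forall>t. \<bar>t\<bar> < \<delta> \<longrightarrow> rev_state (w t) \<and> ell (w t) = 0 \<and> nonlin_sol (\<mu> t) (t *\<^sub>R (V + w t)) \<and>
      lin_sol (\<mu> t) (w t) (dP (\<mu> t) (w t) + t *\<^sub>R dQ (V + w t) (V + w t))) \<and>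
    (\<forall>\<nu> z. \<bar>\<nu>\<bar> < \<rho> \<longrightarrow> norm z < \<rho> \<longrightarrow> rev_state z \<longrightarrow> nonlin_sol \<nu> z \<longrightarrow>
       z = 0 \<or> (\<exists>t. \<bar>t\<bar> < \<delta> \<and> \<nu> = \<mu> t \<and> z = t *\<^sub>R (V + w t)))"
proof -
  interpret P: bounded_bilinear dP by (rule bounded_bilinear_dP)
  interpret Q: bounded_bilinear dQ by (rule bounded_bilinear_dQ)
  interpret K: bounded_linear K by (rule bounded_linear_K)
  \<comment> \<open>The unknown is the pair of parameter shift and correction. \<open>PP\<close>
    multiplies one by the other and so has no linear part at 0, while the shift by
    \<open>(0, V)\<close> affects only \<open>QQ\<close>.\<close>
  define PP :: "real \<times> state \<Rightarrow> real \<times> state \<Rightarrow> real \<times> state" where "PP x y = K (dP (fst x) (snd y))" for x y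
  define QQ :: "real \<times> state \<Rightarrow> real \<times> state \<Rightarrow> real \<times> state" where "QQ x y = K (dQ (snd x) (snd y))" for x y
  define S :: "(real \<times> state) set" where "S = UNIV \<times> {z. rev_state z}"
  have PP: "bounded_bilinear PP" unfolding PP_def[abs_def]
    by (intro bounded_bilinear_linear[OF _ bounded_linear_K] bounded_bilinear.comp[OF bounded_bilinear_dP]
        bounded_linear_fst bounded_linear_snd)
  have QQ: "bounded_bilinear QQ" unfolding QQ_def[abs_def]
    by (intro bounded_bilinear_linear[OF _ bounded_linear_K] bounded_bilinear.comp[OF bounded_bilinear_dQ]
        bounded_linear_snd)
  have S: "closed S" unfolding S_def by (intro closed_Times closed_UNIV closed_rev_state)
  have subS: "subspace S" by (auto simp: subspace_def S_def rev_state_linear mem_Times_iff)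
  have KS: "K d \<in> S" if "rev_data d" for d
    using rev_K[OF that] by (simp add: S_def mem_Times_iff)
  have PS: "PP x y \<in> S" if "x \<in> S" "y \<in> S" for x y
    unfolding PP_def by (rule KS, rule rev_dP) (use that in \<open>auto simp: S_def\<close>)
  have QS: "QQ x y \<in> S" if "x \<in> S" "y \<in> S" for x y
    unfolding QQ_def by (rule KS, rule rev_dQ) (use that in \<open>auto simp: S_def\<close>)
  have eS: "(0, V) \<in> S" using rev_V by (simp add: S_def)
  have "\<exists>\<delta> r x. 0 < \<delta> \<and> 0 < r \<and> x 0 = 0 \<and> smooth_curve_on {-\<delta><..<\<delta>} x \<and>
    (\<forall>t. \<bar>t\<bar> < \<delta> \<longrightarrow> x t \<in> S \<and> norm (x t) \<le> r \<and> x t = PP (x t) (x t) + t *\<^sub>R QQ ((0, V) + x t) ((0, V) + x t) \<and>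
      (\<forall>y. norm y \<le> r \<longrightarrow> y = PP y y + t *\<^sub>R QQ ((0, V) + y) ((0, V) + y) \<longrightarrow> y = x t))"
    by (rule quadratic_fixed_point_branch[OF PP QQ S subS _ _ eS]) (fact PS, fact QS)
  then obtain \<delta> r x where b: "\<delta> > 0" "r > 0" "x 0 = 0" "smooth_curve_on {-\<delta><..<\<delta>} x"
    "\<And>t. \<bar>t\<bar> < \<delta> \<Longrightarrow> x t \<in> S \<and> norm (x t) \<le> r \<and> x t = PP (x t) (x t) + t *\<^sub>R QQ ((0, V) + x t) ((0, V) + x t)"
    "\<And>t y. \<bar>t\<bar> < \<delta> \<Longrightarrow> norm y \<le> r \<Longrightarrow> y = PP y y + t *\<^sub>R QQ ((0, V) + y) ((0, V) + y) \<Longrightarrow> y = x t"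
    by blast
  have fp: "PP y y + t *\<^sub>R QQ ((0, V) + y) ((0, V) + y) = K (dP (fst y) (snd y) + t *\<^sub>R dQ (V + snd y) (V + snd y))" for y t
    by (simp add: PP_def QQ_def K.add K.scaleR)
  define \<mu> where "\<mu> t = fst (x t)" for t
  define w where "w t = snd (x t)" for t
  have rw: "rev_state (w t)" if "\<bar>t\<bar> < \<delta>" for t using b(5)[OF that] by (auto simp: S_def w_def)
  have xK: "(\<mu> t, w t) = K (dP (\<mu> t) (w t) + t *\<^sub>R dQ (V + w t) (V + w t))" if "\<bar>t\<bar> < \<delta>" for t
    using b(5)[OF that] unfolding fp \<mu>_def w_def by simp
  have rd: "rev_data (dP \<nu> z + t *\<^sub>R dQ (V + z) (V + z))" if "rev_state z" for \<nu> t z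
    using that rev_V by (intro rev_data_linear rev_dP rev_dQ rev_state_linear)
  have lw: "lin_sol (\<mu> t) (w t) (dP (\<mu> t) (w t) + t *\<^sub>R dQ (V + w t) (V + w t))" if t: "\<bar>t\<bar> < \<delta>" for t
    using K_solves[OF rd[OF rw[OF t]]] xK[OF t] by (metis fst_conv snd_conv)
  have ellw: "ell (w t) = 0" if t: "\<bar>t\<bar> < \<delta>" for t
    using ell_K by (metis xK[OF t] snd_conv)
  have nl: "nonlin_sol (\<mu> t) (t *\<^sub>R (V + w t))" if "\<bar>t\<bar> < \<delta>" for t
    using lw[OF that] nonlin_sol_0 by (cases "t = 0") (auto simp: nonlin_sol_blowup)
  obtain L where L: "\<And>z. norm (ell z) \<le> norm z * L" "L > 0"
    using bounded_linear.pos_bounded[OF bounded_linear_ell] by auto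
  obtain KP where KP: "\<And>a c. norm (dP a c) \<le> norm a * norm c * KP" "KP > 0" using P.pos_bounded by auto
  obtain KQ where KQ: "\<And>a c. norm (dQ a c) \<le> norm a * norm c * KQ" "KQ > 0" using Q.pos_bounded by auto
  obtain KK where KK: "\<And>d. norm (K d) \<le> norm d * KK" "KK > 0" using K.pos_bounded by auto
  define M where "M = KK * (KP + KQ)"
  have M: "M > 0" using KK KP KQ by (simp add: M_def)
  \<comment> \<open>The conditions ensure in turn that the amplitude \<open>t\<close> of a zero is
    below \<open>\<delta>\<close>, that the part of the right side proportional to
    \<open>norm y\<close> can be absorbed, and that the pair \<open>(\<nu>, y / t)\<close> lies in
    the ball where the fixed point is unique.\<close>
  have ev: "\<forall>\<^sub>F \<rho> in at_right 0. 0 < \<rho> \<and> \<rho> * L / ell V < \<delta> \<and> M * \<rho> < 1/2 \<and> 2 * M * \<rho> * norm V + \<rho> < r"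
  proof (intro eventually_conj)
    show "\<forall>\<^sub>F \<rho>::real in at_right 0. 0 < \<rho>" by (rule eventually_at_right_less)
    have "((\<lambda>\<rho>. \<rho> * L / ell V) \<longlongrightarrow> 0 * L / ell V) (at_right 0)" by (intro tendsto_intros) (use ell_V in auto)
    then show "\<forall>\<^sub>F \<rho> in at_right 0. \<rho> * L / ell V < \<delta>" using b(1) by (auto dest: order_tendstoD(2))
    have "((\<lambda>\<rho>. M * \<rho>) \<longlongrightarrow> M * 0) (at_right 0)" by (intro tendsto_intros)
    then show "\<forall>\<^sub>F \<rho> in at_right 0. M * \<rho> < 1/2" by (auto dest: order_tendstoD(2)[of _ _ _ "1/2"])
    have "((\<lambda>\<rho>. 2 * M * \<rho> * norm V + \<rho>) \<longlongrightarrow> 2 * M * 0 * norm V + 0) (at_right 0)" by (intro tendsto_intros)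
    then show "\<forall>\<^sub>F \<rho> in at_right 0. 2 * M * \<rho> * norm V + \<rho> < r" using b(2) by (auto dest: order_tendstoD(2))
  qed
  obtain \<rho> where \<rho>: "0 < \<rho>" "\<rho> * L / ell V < \<delta>" "M * \<rho> < 1/2" "2 * M * \<rho> * norm V + \<rho> < r"
    using eventually_happens[OF ev] by auto
  have uniq: "z = 0 \<or> (\<exists>t. \<bar>t\<bar> < \<delta> \<and> \<nu> = \<mu> t \<and> z = t *\<^sub>R (V + w t))"
    if h: "\<bar>\<nu>\<bar> < \<rho>" "norm z < \<rho>" "rev_state z" "nonlin_sol \<nu> z" for \<nu> z
  proof -
    define t where "t = ell z / ell V"
    define y where "y = z - t *\<^sub>R V"
    have z: "z = t *\<^sub>R V + y" by (simp add: y_def)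
    have ry: "rev_state y" unfolding y_def by (intro rev_state_linear h rev_V)
    have ey: "ell y = 0" using ell_V by (simp add: y_def t_def)
    have t\<delta>: "\<bar>t\<bar> < \<delta>"
    proof -
      have "\<bar>t\<bar> = \<bar>ell z\<bar> / ell V" using ell_V by (simp add: t_def abs_divide)
      also have "\<dots> \<le> (\<rho> * L) / ell V"
      proof (rule divide_right_mono)
        have "norm z * L \<le> \<rho> * L" using h L(2) by (intro mult_right_mono) auto
        then show "\<bar>ell z\<bar> \<le> \<rho> * L" using L(1)[of z] by simp
      qed (use ell_V in simp)
      finally show ?thesis using \<rho> by simp
    qed
    have "lin_sol 0 y (dP \<nu> z + dQ z z)"
      using lin_sol_diff[OF h(4)[unfolded nonlin_sol_def] lin_sol_scaleR[OF lin_sol_V, of t]]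
      by (simp add: y_def)
    then have "lin_sol 0 y (t *\<^sub>R dP \<nu> V + (dP \<nu> y + dQ z z))"
      by (subst (asm) z) (simp add: P.add_right P.scaleR_right add.assoc)
    then have "lin_sol 0 y (dP (t * \<nu>) V + (dP \<nu> y + dQ z z))"
      by (simp add: P.scaleR_left[symmetric])
    then have ls: "lin_sol (t * \<nu>) y (dP \<nu> y + dQ z z)" by (simp add: lin_sol_dP_V)
    have "rev_data (dP \<nu> y + dQ z z)" by (intro rev_data_linear rev_dP rev_dQ ry h)
    then have Ky: "(t * \<nu>, y) = K (dP \<nu> y + dQ z z)" by (rule lin_sol_unique[OF ls ry ey])
    \<comment> \<open>Dividing by \<open>t\<close> is only safe once \<open>norm y\<close> is known
      to be at most a small multiple of \<open>\<bar>t\<bar>\<close>. This follows by inverting with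
      \<open>K\<close> before the blow-up and absorbing \<open>norm y\<close>; it also disposes of
      the case \<open>t = 0\<close>.\<close>
    have "norm y \<le> norm (K (dP \<nu> y + dQ z z))"
      unfolding Ky[symmetric] by (simp add: norm_Pair)
    also have "\<dots> \<le> (\<rho> * norm y * KP + \<rho> * norm z * KQ) * KK"
    proof (rule order_trans[OF KK(1)], rule mult_right_mono)
      have "norm (dP \<nu> y) \<le> \<rho> * norm y * KP"
        by (rule order_trans[OF KP(1)]) (use h KP in \<open>auto intro!: mult_right_mono\<close>)
      moreover have "norm (dQ z z) \<le> \<rho> * norm z * KQ"
        by (rule order_trans[OF KQ(1)]) (use h KQ in \<open>auto intro!: mult_right_mono\<close>)
      ultimately show "norm (dP \<nu> y + dQ z z) \<le> \<rho> * norm y * KP + \<rho> * norm z * KQ"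
        using norm_triangle_ineq[of "dP \<nu> y" "dQ z z"] by linarith
    qed (use KK in simp)
    also have "\<dots> \<le> (\<rho> * (norm y + \<bar>t\<bar> * norm V) * KP + \<rho> * (norm y + \<bar>t\<bar> * norm V) * KQ) * KK"
    proof -
      have "norm z \<le> norm y + \<bar>t\<bar> * norm V"
        using norm_triangle_ineq[of "t *\<^sub>R V" y] z by (simp add: add.commute)
      then show ?thesis
        using \<rho>(1) KP KQ KK by (intro mult_right_mono add_mono mult_left_mono) auto
    qed
    also have "\<dots> = M * \<rho> * norm y + M * \<rho> * (\<bar>t\<bar> * norm V)" by (simp add: M_def algebra_simps)
    also have "\<dots> \<le> 1/2 * norm y + M * \<rho> * (\<bar>t\<bar> * norm V)"
      using \<rho>(3) by (intro add_right_mono mult_right_mono) simp_all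
    finally have "norm y \<le> 2 * (M * \<rho> * (\<bar>t\<bar> * norm V))" by linarith
    then have ny: "norm y \<le> 2 * M * \<rho> * norm V * \<bar>t\<bar>" by (simp add: mult_ac)
    show ?thesis
    proof (cases "t = 0")
      case True
      then have "y = 0" using ny by simp
      then show ?thesis using z True by simp
    next
      case False
      define v where "v = (1/t) *\<^sub>R y"
      have zv: "z = t *\<^sub>R (V + v)" using False by (simp add: z v_def scaleR_add_right)
      have rv: "rev_state v" unfolding v_def by (intro rev_state_linear ry)
      have ev: "ell v = 0" using ey by (simp add: v_def)
      have "lin_sol \<nu> v (dP \<nu> v + t *\<^sub>R dQ (V + v) (V + v))"
        using h(4) unfolding zv nonlin_sol_blowup[OF False] .
      then have "(\<nu>, v) = K (dP \<nu> v + t *\<^sub>R dQ (V + v) (V + v))"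
        by (rule lin_sol_unique[OF _ rv ev rd[OF rv]])
      then have "(\<nu>, v) = PP (\<nu>, v) (\<nu>, v) + t *\<^sub>R QQ ((0, V) + (\<nu>, v)) ((0, V) + (\<nu>, v))"
        unfolding fp fst_conv snd_conv .
      moreover have "norm (\<nu>, v) \<le> r"
      proof -
        have "norm v = norm y / \<bar>t\<bar>" by (simp add: v_def divide_inverse mult.commute)
        also have "\<dots> \<le> 2 * M * \<rho> * norm V" using ny False by (simp add: divide_le_eq)
        finally show ?thesis
          using norm_Pair_le[of \<nu> v] h(1) \<rho>(4) by simp
      qed
      ultimately have "(\<nu>, v) = x t" using b(6)[OF t\<delta>] by blast
      then have "\<nu> = \<mu> t" "v = w t" by (simp_all add: \<mu>_def w_def prod_eq_iff)
      then show ?thesis using zv t\<delta> by blast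
    qed
  qed
  have z: "\<mu> 0 = 0" "w 0 = 0" "smooth_curve_on {-\<delta><..<\<delta>} (\<lambda>t. (\<mu> t, w t))"
    using b(3,4) by (simp_all add: \<mu>_def w_def)
  show ?thesis
    by (rule exI[of _ \<delta>], rule exI[of _ \<rho>], rule exI[of _ \<mu>], rule exI[of _ w])
       (use z b(1) \<rho>(1) rw ellw nl lw uniq in blast)
qed

end

section \<open>Products and embeddings of \<open>H\<^sup>2\<close> functions\<close>

lemma integrable_on_cmult_real: "f integrable_on S \<Longrightarrow> (\<lambda>x. (c::real) * f x) integrable_on S"
  using integrable_cmul[of f S c] by simp

text \<open>On one period \<open>norm v \<le> 1 + (norm v)^2\<close> gives integrability, and
  finitely many translates of the period cover any interval.\<close>

lemma absolutely_integrable_L2: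
  assumes "L2 f"
  shows "f absolutely_integrable_on {a..b}"
proof -
  have per: "periodic f" and m: "f \<in> borel_measurable lebesgue"
    using assms by (auto simp: L2_def)
  have "set_integrable lebesgue {0..2*pi} (\<lambda>\<eta>. 1 + (norm (f \<eta>))\<^sup>2)"
    using assms absolutely_integrable_continuous_real[of 0 "2*pi" "\<lambda>_. 1::real"]
    by (intro set_integral_add) (auto simp: L2_def)
  then have 0: "set_integrable lebesgue {0..2*pi} f"
    unfolding set_integrable_def
  proof (rule Bochner_Integration.integrable_bound)
    show "(\<lambda>x. indicat_real {0..2*pi} x *\<^sub>R f x) \<in> borel_measurable lebesgue"
      by (intro borel_measurable_scaleR borel_measurable_indicator m) simp
    have "norm y \<le> 1 + (norm y)\<^sup>2" for y :: 'a
    proof -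
      have "2 * norm y \<le> 1 + (norm y)\<^sup>2" using sum_squares_bound[of 1 "norm y"] by simp
      with norm_ge_zero[of y] show ?thesis by linarith
    qed
    then show "AE x in lebesgue. norm (indicat_real {0..2*pi} x *\<^sub>R f x)
        \<le> norm (indicat_real {0..2*pi} x *\<^sub>R (1 + (norm (f x))\<^sup>2))"
      by (auto simp: indicator_def)
  qed
  have shift: "f absolutely_integrable_on {2*pi * of_int j..2*pi * of_int j + 2*pi}" for j :: int
  proof -
    have "integrable lebesgue (\<lambda>x. indicat_real {0..2*pi} (- (2*pi * of_int j) + 1 * x) *\<^sub>R f (- (2*pi * of_int j) + 1 * x))"
      by (rule lebesgue_integrable_real_affine) (use 0 in \<open>auto simp: set_integrable_def\<close>)
    moreover have "f (- (2*pi * of_int j) + 1 * x) = f x" for x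
      using periodic_shift_int[OF per, of x "-j"] by (simp add: algebra_simps)
    moreover have "indicat_real {0..2*pi} (- (2*pi * of_int j) + 1 * x) = indicat_real {2*pi * of_int j..2*pi * of_int j + 2*pi} x" for x
      by (auto simp: indicator_def)
    ultimately show ?thesis by (simp add: set_integrable_def)
  qed
  have up: "f absolutely_integrable_on {2*pi * of_int i..2*pi * of_int i + 2*pi * real n}" for i n
  proof (induction n)
    case 0
    have "f absolutely_integrable_on {2*pi * of_int i..2*pi * of_int i}"
      by (rule set_integrable_subset[OF shift[of i]]) auto
    then show ?case by simp
  next
    case (Suc n)
    have e: "2*pi * of_int (i + int n) = 2*pi * of_int i + 2*pi * real n" by (simp add: algebra_simps)
    have "f absolutely_integrable_on {2*pi * of_int i + 2*pi * real n..2*pi * of_int i + 2*pi * real n + 2*pi}"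
      using shift[of "i + int n"] unfolding e .
    from absolutely_integrable_on_combine[OF Suc this] show ?case by (simp add: algebra_simps)
  qed
  define i where "i = \<lfloor>a / (2*pi)\<rfloor>"
  define n where "n = nat \<lceil>(b - 2*pi * of_int i) / (2*pi)\<rceil>"
  have "of_int i \<le> a / (2*pi)" by (simp add: i_def)
  then have "2*pi * of_int i \<le> a" by (simp add: field_simps)
  moreover have "(b - 2*pi * of_int i) / (2*pi) \<le> real n" unfolding n_def by linarith
  then have "b \<le> 2*pi * of_int i + 2*pi * real n" by (simp add: field_simps)
  ultimately show ?thesis
    by (intro set_integrable_subset[OF up[of i n]]) auto
qed

text \<open>Integration by parts against an absolutely continuous \<open>F\<close>: the defect
  \<open>B (F x) (g x) - \<integral>(B \<phi> g + B F g')\<close> changes over \<open>[x, y]\<close> by at most a constant times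
  \<open>(y - x) \<integral>\<bar>\<phi>\<bar>\<close>, so its derivative vanishes.\<close>

lemma has_integral_bilinear_AC:
  fixes F \<phi> :: "real \<Rightarrow> 'a::euclidean_space" and g :: "real \<Rightarrow> 'b::euclidean_space"
    and B :: "'a \<Rightarrow> 'b \<Rightarrow> 'c::euclidean_space"
  assumes B: "bounded_bilinear B" and "a \<le> b"
    and F: "\<And>x y. x \<le> y \<Longrightarrow> (\<phi> has_integral (F y - F x)) {x..y}"
    and \<phi>: "\<And>x y. \<phi> absolutely_integrable_on {x..y}"
    and g: "\<And>x. (g has_vector_derivative g' x) (at x)" "continuous_on UNIV g'"
  shows "((\<lambda>x. B (\<phi> x) (g x) + B (F x) (g' x)) has_integral (B (F b) (g b) - B (F a) (g a))) {a..b}"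
proof -
  interpret B: bounded_bilinear B by (rule B)
  obtain K where K: "\<And>x y. norm (B x y) \<le> norm x * norm y * K" "K > 0" using B.pos_bounded by auto
  have gc: "continuous_on S g" for S
    using g(1) by (auto intro!: continuous_at_imp_continuous_on has_vector_derivative_continuous)
  have g'c: "continuous_on S g'" for S by (rule continuous_on_subset[OF g(2)]) auto
  have Fc: "continuous_on {a..b} F"
  proof (rule continuous_on_eq)
    show "continuous_on {a..b} (\<lambda>y. integral {a..y} \<phi> + F a)"
      by (intro continuous_intros indefinite_integral_continuous_1) (use F[OF \<open>a \<le> b\<close>] in auto)
    show "integral {a..y} \<phi> + F a = F y" if "y \<in> {a..b}" for y
      using integral_unique[OF F[of a y]] that by simp
  qed
  have i1: "(\<lambda>x. B (\<phi> x) (h x)) integrable_on {x..y}" if h: "continuous_on {x..y} h" for h x y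
  proof -
    have "(\<lambda>s. B (\<phi> s) (h s)) absolutely_integrable_on {x..y}"
      by (rule absolutely_integrable_bounded_measurable_product[of "\<lambda>u v. B v u"])
         (use \<phi> h in \<open>auto simp: bilinear_conv_bounded_bilinear B.flip
            intro!: continuous_imp_measurable_on_sets_lebesgue compact_imp_bounded compact_continuous_image\<close>)
    then show ?thesis by (simp add: absolutely_integrable_on_def)
  qed
  have i2: "(\<lambda>x. B (F x) (g' x)) integrable_on {x..y}" if "{x..y} \<subseteq> {a..b}" for x y
    by (intro integrable_continuous_interval B.continuous_on continuous_on_subset[OF Fc that] g'c)
  define f where "f x = B (\<phi> x) (g x) + B (F x) (g' x)" for x
  have fi: "f integrable_on {x..y}" if "{x..y} \<subseteq> {a..b}" for x y
    unfolding f_def by (intro integrable_add i1 i2 gc that)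
  define \<Psi> where "\<Psi> x = B (F x) (g x) - integral {a..x} f" for x
  define \<Phi> where "\<Phi> x = integral {a..x} (\<lambda>s. norm (\<phi> s))" for x
  have ni: "(\<lambda>s. norm (\<phi> s)) integrable_on {x..y}" for x y
    using \<phi>[of x y] by (simp add: absolutely_integrable_on_def)
  have \<Phi>c: "continuous_on {a..b} \<Phi>"
    unfolding \<Phi>_def by (rule indefinite_integral_continuous_1[OF ni])
  obtain C where C: "\<And>x. x \<in> {a..b} \<Longrightarrow> norm (g' x) \<le> C" "C \<ge> 0"
  proof -
    have "bounded (g' ` {a..b})" by (intro compact_imp_bounded compact_continuous_image g'c) auto
    then obtain C where "C > 0" "\<forall>y\<in>g' ` {a..b}. norm y \<le> C" using bounded_pos by metis
    then show thesis using that[of C] by auto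
  qed
  \<comment> \<open>Freezing \<open>g\<close> at \<open>y\<close> and \<open>F\<close> at
    \<open>x\<close> makes both integrals explicit, and they add up to the increment of
    \<open>B F g\<close>. Each freezing error is a product of two factors, bounded through
    \<open>C * (y - x)\<close> and \<open>\<Phi> y - \<Phi> x\<close>.\<close>
  have est: "norm (\<Psi> y - \<Psi> x) \<le> 2 * (C * K) * (y - x) * (\<Phi> y - \<Phi> x)" if xy: "a \<le> x" "x \<le> y" "y \<le> b" for x y
  proof -
    have sub: "{x..y} \<subseteq> {a..b}" using xy by auto
    have I: "integral {a..y} f = integral {a..x} f + integral {x..y} f"
      using Henstock_Kurzweil_Integration.integral_combine[of a x y f] fi xy by (simp add: algebra_simps)
    have P: "\<Phi> y - \<Phi> x = integral {x..y} (\<lambda>s. norm (\<phi> s))"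
      unfolding \<Phi>_def
      using Henstock_Kurzweil_Integration.integral_combine[of a x y "\<lambda>s. norm (\<phi> s)"] ni xy by (simp add: algebra_simps)
    have 1: "((\<lambda>s. B (\<phi> s) (g y)) has_integral B (F y - F x) (g y)) {x..y}"
      using has_integral_linear[OF F[OF xy(2)] B.bounded_linear_left[of "g y"]] by (simp add: o_def)
    have 2: "((\<lambda>s. B (F x) (g' s)) has_integral B (F x) (g y - g x)) {x..y}"
    proof -
      have "(g' has_integral (g y - g x)) {x..y}"
        using xy g by (intro fundamental_theorem_of_calculus) (auto intro: has_vector_derivative_at_within)
      from has_integral_linear[OF this B.bounded_linear_right[of "F x"]] show ?thesis by (simp add: o_def)
    qed
    have h: "((\<lambda>s. B (\<phi> s) (g y) + B (F x) (g' s) - f s) has_integral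
        (B (F y - F x) (g y) + B (F x) (g y - g x) - integral {x..y} f)) {x..y}"
      by (intro has_integral_diff has_integral_add 1 2 integrable_integral fi sub)
    then have eq: "\<Psi> y - \<Psi> x = integral {x..y} (\<lambda>s. B (\<phi> s) (g y) + B (F x) (g' s) - f s)"
      and ii: "(\<lambda>s. B (\<phi> s) (g y) + B (F x) (g' s) - f s) integrable_on {x..y}"
      using integral_unique[OF h] has_integral_integrable[OF h]
      by (simp_all add: I \<Psi>_def B.diff_left B.diff_right)
    have le1: "norm (F s - F x) \<le> \<Phi> y - \<Phi> x" if s: "s \<in> {x..y}" for s
    proof -
      have "F s - F x = integral {x..s} \<phi>" using F[of x s] s by (simp add: integral_unique)
      also have "norm \<dots> \<le> integral {x..s} (\<lambda>s. norm (\<phi> s))"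
        by (rule integral_norm_bound_integral) (use F[of x s] s ni in auto)
      also have "\<dots> \<le> integral {x..y} (\<lambda>s. norm (\<phi> s))"
        by (rule integral_subset_le) (use s ni in auto)
      finally show ?thesis by (simp add: P)
    qed
    have le2: "norm (g y - g s) \<le> C * (y - x)" if s: "s \<in> {x..y}" for s
    proof -
      have "(g' has_integral (g y - g s)) {s..y}"
        using s g by (intro fundamental_theorem_of_calculus) (auto intro: has_vector_derivative_at_within)
      then have "g y - g s = integral {s..y} g'" by (simp add: integral_unique)
      also have "norm \<dots> \<le> C * (y - s)"
        by (rule integral_bound) (use s xy C g'c in auto)
      also have "\<dots> \<le> C * (y - x)" using s C(2) by (intro mult_left_mono) auto
      finally show ?thesis .
    qed
    have "norm (\<Psi> y - \<Psi> x) \<le> integral {x..y} (\<lambda>s. C * (y - x) * K * norm (\<phi> s) + C * K * (\<Phi> y - \<Phi> x))"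
      unfolding eq
    proof (rule integral_norm_bound_integral[OF ii])
      show "(\<lambda>s. C * (y - x) * K * norm (\<phi> s) + C * K * (\<Phi> y - \<Phi> x)) integrable_on {x..y}"
        by (intro integrable_add integrable_on_cmult_real ni integrable_const_ivl)
      fix s assume s: "s \<in> {x..y}"
      have "B (\<phi> s) (g y) + B (F x) (g' s) - f s = B (\<phi> s) (g y - g s) - B (F s - F x) (g' s)"
        by (simp add: f_def B.diff_left B.diff_right)
      moreover have "norm (B (\<phi> s) (g y - g s)) \<le> norm (\<phi> s) * (C * (y - x)) * K"
        by (rule order_trans[OF K(1)]) (use le2[OF s] K(2) in \<open>auto intro!: mult_right_mono mult_left_mono\<close>)
      moreover have "norm (B (F s - F x) (g' s)) \<le> (\<Phi> y - \<Phi> x) * C * K"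
        by (rule order_trans[OF K(1)])
           (use le1[OF s] C(1)[of s] C(2) K(2) s sub in \<open>auto intro!: mult_right_mono mult_mono order_trans[OF norm_ge_zero le1[OF s]]\<close>)
      ultimately show "norm (B (\<phi> s) (g y) + B (F x) (g' s) - f s) \<le> C * (y - x) * K * norm (\<phi> s) + C * K * (\<Phi> y - \<Phi> x)"
        using norm_triangle_ineq4[of "B (\<phi> s) (g y - g s)" "B (F s - F x) (g' s)"] by (simp add: mult_ac)
    qed
    also have "\<dots> = C * (y - x) * K * (\<Phi> y - \<Phi> x) + C * K * (\<Phi> y - \<Phi> x) * (y - x)"
      using ni xy by (simp add: integral_add P integrable_on_cmult_real integrable_const_ivl)
    finally show ?thesis by (simp add: algebra_simps)
  qed
  have "\<exists>c. \<forall>x\<in>{a..b}. \<Psi> x = c"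
  proof (rule has_derivative_zero_constant)
    fix x assume x: "x \<in> {a..b}"
    show "(\<Psi> has_derivative (\<lambda>h. 0)) (at x within {a..b})"
    proof (rule has_derivativeI_sandwich[of 1])
      show "bounded_linear (\<lambda>h::real. 0::'c)" by simp
      have "((\<lambda>y. 2 * (C * K) * \<bar>\<Phi> y - \<Phi> x\<bar>) \<longlongrightarrow> 2 * (C * K) * \<bar>\<Phi> x - \<Phi> x\<bar>) (at x within {a..b})"
        using \<Phi>c x by (intro tendsto_intros) (auto simp: continuous_on)
      then show "((\<lambda>y. 2 * (C * K) * \<bar>\<Phi> y - \<Phi> x\<bar>) \<longlongrightarrow> 0) (at x within {a..b})" by simp
      fix y assume y: "y \<in> {a..b}" "y \<noteq> x" "dist y x < 1"
      have "norm (\<Psi> y - \<Psi> x) \<le> 2 * (C * K) * \<bar>y - x\<bar> * \<bar>\<Phi> y - \<Phi> x\<bar>"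
      proof (cases "x \<le> y")
        case True
        then show ?thesis using est[of x y] x y C(2) K(2)
          by (auto intro!: order_trans[OF est[of x y]] mult_left_mono)
      next
        case False
        then have "norm (\<Psi> x - \<Psi> y) \<le> 2 * (C * K) * (x - y) * \<bar>\<Phi> x - \<Phi> y\<bar>"
          using x y C(2) K(2) by (intro order_trans[OF est[of y x]]) (auto intro!: mult_left_mono)
        then show ?thesis using False by (simp add: norm_minus_commute abs_minus_commute)
      qed
      then show "norm (\<Psi> y - \<Psi> x - 0) / norm (y - x) \<le> 2 * (C * K) * \<bar>\<Phi> y - \<Phi> x\<bar>"
        using y by (simp add: divide_le_eq mult_ac)
    qed simp
  qed simp
  then have "\<Psi> b = \<Psi> a" using \<open>a \<le> b\<close> by auto
  then have "integral {a..b} f = B (F b) (g b) - B (F a) (g a)" by (simp add: \<Psi>_def algebra_simps)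
  then show ?thesis using fi[of a b] by (auto simp: f_def[abs_def] has_integral_integral)
qed

lemma L2_bilinear_continuous:
  fixes f :: "real \<Rightarrow> 'a::euclidean_space" and g :: "real \<Rightarrow> 'b::euclidean_space"
    and B :: "'a \<Rightarrow> 'b \<Rightarrow> 'c::euclidean_space"
  assumes B: "bounded_bilinear B" and "L2 f" and g: "periodic g" "continuous_on UNIV g"
  shows "L2 (\<lambda>x. B (f x) (g x))"
proof -
  interpret B: bounded_bilinear B by (rule B)
  obtain K where K: "\<And>x y. norm (B x y) \<le> norm x * norm y * K" "K > 0" using B.pos_bounded by auto
  obtain C where C: "\<And>x. norm (g x) \<le> C" using periodic_bounded[OF g] by auto
  have C0: "C \<ge> 0" using order_trans[OF norm_ge_zero C] .
  have f: "periodic f" "f \<in> borel_measurable lebesgue" "set_integrable lebesgue {0..2 * pi} (\<lambda>\<eta>. (norm (f \<eta>))\<^sup>2)"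
    using assms(2) by (auto simp: L2_def)
  have gm: "g \<in> borel_measurable lebesgue"
    using g(2) by (simp add: borel_measurable_continuous_onI measurable_completion)
  have m: "(\<lambda>x. B (f x) (g x)) \<in> borel_measurable lebesgue"
    using borel_measurable_bilinear[of B f UNIV g] f(2) gm B by (simp add: bilinear_conv_bounded_bilinear)
  have "set_integrable lebesgue {0..2 * pi} (\<lambda>\<eta>. (C * K)\<^sup>2 * (norm (f \<eta>))\<^sup>2)"
    by (intro set_integrable_mult_right f)
  then have "set_integrable lebesgue {0..2 * pi} (\<lambda>\<eta>. (norm (B (f \<eta>) (g \<eta>)))\<^sup>2)"
    unfolding set_integrable_def
  proof (rule Bochner_Integration.integrable_bound)
    show "(\<lambda>x. indicat_real {0..2*pi} x *\<^sub>R (norm (B (f x) (g x)))\<^sup>2) \<in> borel_measurable lebesgue"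
      by (intro borel_measurable_scaleR borel_measurable_indicator borel_measurable_power
          measurable_compose[OF m borel_measurable_norm]) simp
    have "(norm (B (f x) (g x)))\<^sup>2 \<le> (C * K)\<^sup>2 * (norm (f x))\<^sup>2" for x
    proof -
      have "norm (B (f x) (g x)) \<le> norm (f x) * C * K"
        by (rule order_trans[OF K(1)]) (use C K(2) in \<open>auto intro!: mult_right_mono mult_left_mono\<close>)
      from power_mono[OF this norm_ge_zero, of 2] show ?thesis by (simp add: power_mult_distrib mult_ac)
    qed
    then show "AE x in lebesgue. norm (indicat_real {0..2*pi} x *\<^sub>R (norm (B (f x) (g x)))\<^sup>2)
        \<le> norm (indicat_real {0..2*pi} x *\<^sub>R ((C * K)\<^sup>2 * (norm (f x))\<^sup>2))"
      by (auto simp: indicator_def)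
  qed
  then show ?thesis using m f(1) g(1) by (simp add: L2_def periodic_def)
qed

lemma H2_vector_derivative: "H2 f \<Longrightarrow> (f has_vector_derivative D1 f x) (at x)"
  by (rule D1_works) (simp add: H2_def)

lemma AE_has_integral:
  fixes f g :: "real \<Rightarrow> 'a::euclidean_space"
  assumes "(f has_integral i) S" "AE x in lebesgue. f x = g x"
  shows "(g has_integral i) S"
proof -
  obtain N where N: "{x. f x \<noteq> g x} \<subseteq> N" "negligible N"
    using assms(2) by (auto elim!: AE_E simp: negligible_iff_null_sets null_sets_def)
  show ?thesis
    by (rule has_integral_spike[OF N(2) _ assms(1)]) (use N(1) in force)
qed

lemma H2_D1_bilinear_integral:
  fixes B :: "'a::euclidean_space \<Rightarrow> 'b::euclidean_space \<Rightarrow> 'c::euclidean_space"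
  assumes "bounded_bilinear B" "H2 f" "a \<le> b"
    "\<And>x. (g has_vector_derivative g' x) (at x)" "continuous_on UNIV g'"
  shows "((\<lambda>x. B (D2 f x) (g x) + B (D1 f x) (g' x)) has_integral (B (D1 f b) (g b) - B (D1 f a) (g a))) {a..b}"
  by (rule has_integral_bilinear_AC[OF assms(1,3) _ _ assms(4,5)])
     (use assms(2) absolutely_integrable_L2 in \<open>auto simp: H2_def\<close>)

text \<open>The product rule for the second derivative holds only almost everywhere. That it
  integrates to the first derivative follows from two integrations by parts, one for
  \<open>B f' g\<close> and one for \<open>B f g'\<close>, each with a single merely absolutely
  continuous factor.\<close>

lemma H2_bilinear:
  fixes B :: "'a::euclidean_space \<Rightarrow> 'b::euclidean_space \<Rightarrow> 'c::euclidean_space"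
  assumes B: "bounded_bilinear B" and f: "H2 f" and g: "H2 g"
  shows "H2 (\<lambda>x. B (f x) (g x))"
proof -
  interpret B: bounded_bilinear B by (rule B)
  let ?h = "\<lambda>x. B (f x) (g x)"
  have per: "periodic f" "periodic g" using f g by (auto simp: H2_def)
  have hper: "periodic ?h" using per by (simp add: periodic_def)
  have d: "(?h has_vector_derivative (B (f x) (D1 g x) + B (D1 f x) (g x))) (at x)" for x
    by (rule B.has_vector_derivative) (intro H2_vector_derivative f g)+
  have D1h: "D1 ?h = (\<lambda>x. B (f x) (D1 g x) + B (D1 f x) (g x))"
    by (rule ext) (rule D1_eqI[OF d])
  define s where "s x = B (D2 f x) (g x) + (2 *\<^sub>R B (D1 f x) (D1 g x) + B (f x) (D2 g x))" for x
  have "AE x in lebesgue. D1 f differentiable at x \<and> D1 g differentiable at x"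
    using f g by (auto simp: H2_def)
  then have ae: "AE x in lebesgue. D1 ?h differentiable at x \<and> s x = D2 ?h x"
  proof (rule AE_mp, intro AE_I2 impI)
    fix x assume a: "D1 f differentiable at x \<and> D1 g differentiable at x"
    then have "(D1 f has_vector_derivative D2 f x) (at x)" "(D1 g has_vector_derivative D2 g x) (at x)"
      by (auto simp: D2_def intro: D1_works)
    then have "((\<lambda>x. B (f x) (D1 g x) + B (D1 f x) (g x)) has_vector_derivative
        ((B (f x) (D2 g x) + B (D1 f x) (D1 g x)) + (B (D1 f x) (D1 g x) + B (D2 f x) (g x)))) (at x)"
      by (intro has_vector_derivative_add B.has_vector_derivative H2_vector_derivative f g)
    then have "(D1 ?h has_vector_derivative s x) (at x)"
      by (simp add: D1h s_def scaleR_2 algebra_simps)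
    then show "D1 ?h differentiable at x \<and> s x = D2 ?h x"
      by (auto simp: D2_def D1_eqI intro: differentiableI_vector)
  qed
  have ae2: "AE x in lebesgue. s x = D2 ?h x" using ae by (rule AE_mp) auto
  have cp: "periodic (D1 f)" "periodic (D1 g)" using per by (auto intro: periodic_D1)
  note c = H2_continuous[OF f] H2_continuous[OF g] H2_D1_continuous[OF f] H2_D1_continuous[OF g]
  have "L2 (\<lambda>x. B (D1 f x) (D1 g x))"
    by (rule L2_continuous) (use cp c in \<open>auto simp: periodic_def intro!: B.continuous_on\<close>)
  then have "L2 s"
    unfolding s_def using L2_bilinear_continuous[OF B H2_L2(3)[OF f] per(2) c(2)]
      L2_bilinear_continuous[OF B.flip H2_L2(3)[OF g] per(1) c(1)]
    by (intro L2_add L2_scaleR)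
  then have L: "L2 (D2 ?h)" by (rule L2_AE_cong[OF _ periodic_D2[OF hper] ae2])
  have int: "(D2 ?h has_integral (D1 ?h b - D1 ?h a)) {a..b}" if "a \<le> b" for a b
  proof (rule AE_has_integral[OF _ ae2])
    have "((\<lambda>x. (B (D2 f x) (g x) + B (D1 f x) (D1 g x)) + (B (f x) (D2 g x) + B (D1 f x) (D1 g x))) has_integral
       ((B (D1 f b) (g b) - B (D1 f a) (g a)) + (B (f b) (D1 g b) - B (f a) (D1 g a)))) {a..b}"
      by (intro has_integral_add H2_D1_bilinear_integral[OF B f that]
          H2_D1_bilinear_integral[OF B.flip g that] H2_vector_derivative f g H2_D1_continuous)
    then show "(s has_integral (D1 ?h b - D1 ?h a)) {a..b}"
      by (simp add: D1h s_def[abs_def] scaleR_2 algebra_simps)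
  qed
  have "AE x in lebesgue. D1 ?h differentiable at x" using ae by (rule AE_mp) auto
  moreover have "?h differentiable at x" for x using d by (rule differentiableI_vector)
  ultimately show ?thesis using hper L int by (simp add: H2_def)
qed

text \<open>Taking \<open>s\<close> of the size of the \<open>L\<^sup>2\<close> norm makes the bound linear in that norm.\<close>

lemma integral_norm_L2_le:
  assumes "L2 f" "s > 0"
  shows "integral {0..2*pi} (\<lambda>x. norm (f x)) \<le> (integral {0..2*pi} (\<lambda>x. (norm (f x))\<^sup>2) / s + 2 * pi * s) / 2"
proof -
  have i2: "(\<lambda>x. (norm (f x))\<^sup>2) integrable_on {0..2*pi}"
    using assms(1) set_lebesgue_integral_eq_integral(1) by (auto simp: L2_def)
  have i1: "(\<lambda>x. norm (f x)) integrable_on {0..2*pi}"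
    using absolutely_integrable_L2[OF assms(1), of 0 "2*pi"] by (simp add: absolutely_integrable_on_def)
  have "integral {0..2*pi} (\<lambda>x. norm (f x)) \<le> integral {0..2*pi} (\<lambda>x. (1 / (2 * s)) * (norm (f x))\<^sup>2 + s / 2)"
  proof (rule integral_le[OF i1])
    show "(\<lambda>x. (1 / (2 * s)) * (norm (f x))\<^sup>2 + s / 2) integrable_on {0..2*pi}"
      by (intro integrable_add integrable_on_cmult_real i2 integrable_const_ivl)
    fix x
    have "2 * s * norm (f x) \<le> (norm (f x))\<^sup>2 + s\<^sup>2" using sum_squares_bound[of s "norm (f x)"] by simp
    then show "norm (f x) \<le> (1 / (2 * s)) * (norm (f x))\<^sup>2 + s / 2"
      using assms(2) by (simp add: field_simps power2_eq_square)
  qed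
  also have "\<dots> = (1 / (2 * s)) * integral {0..2*pi} (\<lambda>x. (norm (f x))\<^sup>2) + s / 2 * (2 * pi)"
    using integral_add[OF integrable_on_cmult_real[OF i2, of "1 / (2 * s)"] integrable_const_ivl[of "s / 2" 0 "2*pi"]]
    by simp
  finally show ?thesis by (simp add: add_divide_distrib mult.commute)
qed

lemma norm_h2_parts:
  fixes u :: "'a::euclidean_space h2"
  shows "integral {0..2*pi} (\<lambda>x. (norm (h2_fun u x))\<^sup>2) \<le> (norm u)\<^sup>2"
    "integral {0..2*pi} (\<lambda>x. (norm (D1 (h2_fun u) x))\<^sup>2) \<le> (norm u)\<^sup>2"
    "integral {0..2*pi} (\<lambda>x. (norm (D2 (h2_fun u) x))\<^sup>2) \<le> (norm u)\<^sup>2"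
proof -
  let ?u = "h2_fun u"
  have H: "H2 ?u" by (rule H2_h2_fun)
  have i: "(\<lambda>x. (norm (?u x))\<^sup>2) integrable_on {0..2*pi}" "(\<lambda>x. (norm (D1 ?u x))\<^sup>2) integrable_on {0..2*pi}"
    "(\<lambda>x. (norm (D2 ?u x))\<^sup>2) integrable_on {0..2*pi}"
    using H2_L2[OF H] set_lebesgue_integral_eq_integral(1) by (auto simp: L2_def)
  have "(norm u)\<^sup>2 = u \<bullet> u" by (simp add: power2_norm_eq_inner)
  also have "\<dots> = integral {0..2*pi} (\<lambda>x. ?u x \<bullet> ?u x + D1 ?u x \<bullet> D1 ?u x + D2 ?u x \<bullet> D2 ?u x)"
    unfolding inner_h2.rep_eq using set_lebesgue_integral_eq_integral(2)[OF inner_h2_integrable[OF H H]] by simp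
  also have "\<dots> = integral {0..2*pi} (\<lambda>x. (norm (?u x))\<^sup>2 + (norm (D1 ?u x))\<^sup>2 + (norm (D2 ?u x))\<^sup>2)"
    by (simp add: power2_norm_eq_inner)
  also have "\<dots> = integral {0..2*pi} (\<lambda>x. (norm (?u x))\<^sup>2) + integral {0..2*pi} (\<lambda>x. (norm (D1 ?u x))\<^sup>2)
     + integral {0..2*pi} (\<lambda>x. (norm (D2 ?u x))\<^sup>2)"
    using i by (simp add: integral_add integrable_add)
  finally have eq: "(norm u)\<^sup>2 = integral {0..2*pi} (\<lambda>x. (norm (?u x))\<^sup>2) + integral {0..2*pi} (\<lambda>x. (norm (D1 ?u x))\<^sup>2)
     + integral {0..2*pi} (\<lambda>x. (norm (D2 ?u x))\<^sup>2)" .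
  have "0 \<le> integral {0..2*pi} (\<lambda>x. (norm (?u x))\<^sup>2)" "0 \<le> integral {0..2*pi} (\<lambda>x. (norm (D1 ?u x))\<^sup>2)"
    "0 \<le> integral {0..2*pi} (\<lambda>x. (norm (D2 ?u x))\<^sup>2)"
    using i by (auto intro!: integral_nonneg)
  then show "integral {0..2*pi} (\<lambda>x. (norm (h2_fun u x))\<^sup>2) \<le> (norm u)\<^sup>2"
    "integral {0..2*pi} (\<lambda>x. (norm (D1 (h2_fun u) x))\<^sup>2) \<le> (norm u)\<^sup>2"
    "integral {0..2*pi} (\<lambda>x. (norm (D2 (h2_fun u) x))\<^sup>2) \<le> (norm u)\<^sup>2"
    using eq by linarith+
qed

text \<open>Any two values of \<open>F\<close> differ by at most the integral of
  \<open>norm \<phi>\<close> over a period. Averaging over the second point bounds the supremum by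
  two such integral norms, each at most \<open>(1/2 + pi) * N\<close>; the 10 is a generous bound
  for \<open>(1/2 + pi) * (1 + 2 * pi) / (2 * pi)\<close>.\<close>

lemma sup_norm_le_AC:
  fixes F \<phi> :: "real \<Rightarrow> 'a::euclidean_space"
  assumes "periodic F" "continuous_on UNIV F" "L2 \<phi>"
    and F: "\<And>x y. x \<le> y \<Longrightarrow> (\<phi> has_integral (F y - F x)) {x..y}"
    and "N \<ge> 0" "integral {0..2*pi} (\<lambda>x. (norm (F x))\<^sup>2) \<le> N\<^sup>2" "integral {0..2*pi} (\<lambda>x. (norm (\<phi> x))\<^sup>2) \<le> N\<^sup>2"
  shows "norm (F x) \<le> 10 * N"
proof -
  have LF: "L2 F" by (rule L2_continuous[OF assms(1,2)])
  have b: "integral {0..2*pi} (\<lambda>x. norm (f x)) \<le> (1/2 + pi) * N"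
    if "L2 f" "integral {0..2*pi} (\<lambda>x. (norm (f x))\<^sup>2) \<le> N\<^sup>2" for f :: "real \<Rightarrow> 'a"
  proof (cases "N = 0")
    \<comment> \<open>For \<open>N = 0\<close> there is no positive scale to insert, so an
      arbitrarily small one is taken; \<open>e / pi\<close> makes the resulting bound equal to
      \<open>e\<close>.\<close>
    case True
    have "integral {0..2*pi} (\<lambda>x. norm (f x)) \<le> e" if "e > 0" for e
    proof -
      have "integral {0..2*pi} (\<lambda>x. norm (f x)) \<le> (integral {0..2*pi} (\<lambda>x. (norm (f x))\<^sup>2) / (e/pi) + 2 * pi * (e/pi)) / 2"
        using that by (intro integral_norm_L2_le \<open>L2 f\<close>) simp
      also have "\<dots> \<le> (0 / (e/pi) + 2 * pi * (e/pi)) / 2"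
        using \<open>integral {0..2*pi} (\<lambda>x. (norm (f x))\<^sup>2) \<le> N\<^sup>2\<close> True that
        by (intro divide_right_mono add_right_mono) auto
      finally show ?thesis by simp
    qed
    then show ?thesis using field_le_epsilon[of "integral {0..2*pi} (\<lambda>x. norm (f x))" 0] True by simp
  next
    case False
    then have N: "N > 0" using \<open>N \<ge> 0\<close> by simp
    have "integral {0..2*pi} (\<lambda>x. norm (f x)) \<le> (integral {0..2*pi} (\<lambda>x. (norm (f x))\<^sup>2) / N + 2 * pi * N) / 2"
      by (rule integral_norm_L2_le[OF that(1) N])
    also have "\<dots> \<le> (N\<^sup>2 / N + 2 * pi * N) / 2"
      using that(2) N by (intro divide_right_mono add_right_mono) auto
    finally show ?thesis using N by (simp add: power2_eq_square field_simps)
  qed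
  obtain y where y: "y \<in> {0..2*pi}" "F y = F x" using periodic_reduce[OF assms(1)] .
  have ni: "(\<lambda>s. norm (\<phi> s)) integrable_on {u..v}" for u v
    using absolutely_integrable_L2[OF assms(3), of u v] by (simp add: absolutely_integrable_on_def)
  have osc: "norm (F v - F u) \<le> (1/2 + pi) * N" if "0 \<le> u" "u \<le> v" "v \<le> 2*pi" for u v
  proof -
    have "F v - F u = integral {u..v} \<phi>" using F[OF that(2)] by (simp add: integral_unique)
    also have "norm \<dots> \<le> integral {u..v} (\<lambda>s. norm (\<phi> s))"
      by (rule integral_norm_bound_integral) (use F[OF that(2)] ni in auto)
    also have "\<dots> \<le> integral {0..2*pi} (\<lambda>s. norm (\<phi> s))"
      by (rule integral_subset_le) (use that ni in auto)
    also have "\<dots> \<le> (1/2 + pi) * N" by (rule b[OF assms(3,7)])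
    finally show ?thesis .
  qed
  have "norm (F y) \<le> norm (F s) + (1/2 + pi) * N" if "s \<in> {0..2*pi}" for s
  proof -
    have "norm (F y - F s) \<le> (1/2 + pi) * N"
      using osc[of s y] osc[of y s] that y by (cases "s \<le> y") (auto simp: norm_minus_commute)
    then show ?thesis using norm_triangle_sub[of "F y" "F s"] by simp
  qed
  then have "integral {0..2*pi} (\<lambda>s. norm (F y)) \<le> integral {0..2*pi} (\<lambda>s. norm (F s) + (1/2 + pi) * N)"
    using absolutely_integrable_L2[OF LF, of 0 "2*pi"]
    by (intro integral_le integrable_add integrable_const_ivl) (auto simp: absolutely_integrable_on_def)
  also have "\<dots> = integral {0..2*pi} (\<lambda>s. norm (F s)) + (1/2 + pi) * N * (2 * pi)"
    using absolutely_integrable_L2[OF LF, of 0 "2*pi"]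
    by (subst integral_add) (auto simp: absolutely_integrable_on_def)
  also have "\<dots> \<le> (1/2 + pi) * N + (1/2 + pi) * N * (2 * pi)"
    by (intro add_right_mono b[OF LF assms(6)])
  finally have "2 * pi * norm (F x) \<le> (1/2 + pi) * (1 + 2 * pi) * N"
    using y(2) by (simp add: algebra_simps)
  also have "\<dots> \<le> 2 * pi * (10 * N)"
  proof -
    have "pi * pi \<le> 4 * pi" "pi > 3" using pi_less_4 pi_gt3 by (auto intro!: mult_right_mono)
    moreover have "(1/2 + pi) * (1 + 2 * pi) = 1/2 + 2 * pi + 2 * (pi * pi)" by (simp add: algebra_simps)
    ultimately have "(1/2 + pi) * (1 + 2 * pi) \<le> 20 * pi" by linarith
    then show ?thesis using mult_right_mono[OF _ \<open>N \<ge> 0\<close>] by fastforce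
  qed
  finally show ?thesis by simp
qed

lemma h2_sup_le:
  fixes u :: "'a::euclidean_space h2"
  shows "norm (h2_fun u x) \<le> 10 * norm u" "norm (D1 (h2_fun u) x) \<le> 10 * norm u"
proof -
  let ?u = "h2_fun u"
  have H: "H2 ?u" by (rule H2_h2_fun)
  have per: "periodic ?u" using H by (simp add: H2_def)
  have 1: "(D1 ?u has_integral (?u y - ?u x)) {x..y}" if "x \<le> y" for x y
    using that H by (intro fundamental_theorem_of_calculus) (auto intro: has_vector_derivative_at_within H2_vector_derivative)
  show "norm (?u x) \<le> 10 * norm u"
    by (rule sup_norm_le_AC[OF per H2_continuous[OF H] H2_L2(2)[OF H] 1 norm_ge_zero norm_h2_parts(1,2)])
  show "norm (D1 ?u x) \<le> 10 * norm u"
    by (rule sup_norm_le_AC[OF periodic_D1[OF per] H2_D1_continuous[OF H] H2_L2(3)[OF H] _ norm_ge_zero norm_h2_parts(2,3)])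
       (use H in \<open>auto simp: H2_def\<close>)
qed

section \<open>The operators on the sphere\<close>

definition E1 :: "real \<Rightarrow> real^3" where "E1 \<eta> = vector [cos \<eta>, sin \<eta>, 0]"

lemma vec3_eq: "(v :: real^3) = w \<longleftrightarrow> v $ 1 = w $ 1 \<and> v $ 2 = w $ 2 \<and> v $ 3 = w $ 3"
  by (auto simp: vec_eq_iff forall_3)

lemma inner3: "(v :: real^3) \<bullet> w = v $ 1 * w $ 1 + v $ 2 * w $ 2 + v $ 3 * w $ 3"
  by (simp add: inner_vec_def sum_3)

lemma cross3_nth:
  "cross3 v w $ 1 = v $ 2 * w $ 3 - v $ 3 * w $ 2"
  "cross3 v w $ 2 = v $ 3 * w $ 1 - v $ 1 * w $ 3"
  "cross3 v w $ 3 = v $ 1 * w $ 2 - v $ 2 * w $ 1"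
  by (simp_all add: cross3_def)

lemmas vec3_simps = vec3_eq inner3 cross3_nth E1_def E2_def e3_def x0_def S_refl_def vector_3

lemma has_vector_derivative_vector3:
  assumes "(f has_real_derivative f') (at x)" "(g has_real_derivative g') (at x)" "(h has_real_derivative h') (at x)"
  shows "((\<lambda>x. vector [f x, g x, h x] :: real^3) has_vector_derivative vector [f', g', h']) (at x)"
proof -
  have e: "vector [a, b, c] = a *\<^sub>R (vector [1, 0, 0] :: real^3) + b *\<^sub>R vector [0, 1, 0] + c *\<^sub>R vector [0, 0, 1]" for a b c :: real
    by (simp add: vec3_eq)
  have "((\<lambda>x. f x *\<^sub>R (vector [1, 0, 0] :: real^3) + g x *\<^sub>R vector [0, 1, 0] + h x *\<^sub>R vector [0, 0, 1]) has_vector_derivative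
     (f' *\<^sub>R (vector [1, 0, 0] :: real^3) + g' *\<^sub>R vector [0, 1, 0] + h' *\<^sub>R vector [0, 0, 1])) (at x)"
    using assms by (intro has_vector_derivative_add)
      (auto simp: has_vector_derivative_def has_field_derivative_def mult.commute intro!: derivative_eq_intros)
  then show ?thesis by (simp add: e[symmetric])
qed

lemma bounded_bilinear_cross3: "bounded_bilinear cross3"
  using bilinear_cross by (simp add: bilinear_conv_bounded_bilinear)

lemma x0_derivs:
  "(x0 R has_vector_derivative R *\<^sub>R E2 \<eta>) (at \<eta>)"
  "((\<lambda>\<eta>. R *\<^sub>R E2 \<eta>) has_vector_derivative - x0 R \<eta>) (at \<eta>)"
proof -
  have "((\<lambda>\<eta>. vector [R * cos \<eta>, R * sin \<eta>, 0] :: real^3) has_vector_derivative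
      vector [- (R * sin \<eta>), R * cos \<eta>, 0]) (at \<eta>)"
    by (rule has_vector_derivative_vector3) (auto intro!: derivative_eq_intros)
  moreover have "x0 R = (\<lambda>\<eta>. vector [R * cos \<eta>, R * sin \<eta>, 0])"
    "R *\<^sub>R E2 \<eta> = vector [- (R * sin \<eta>), R * cos \<eta>, 0]"
    by (auto simp: vec3_simps)
  ultimately show "(x0 R has_vector_derivative R *\<^sub>R E2 \<eta>) (at \<eta>)" by simp
  have "((\<lambda>\<eta>. vector [- (R * sin \<eta>), R * cos \<eta>, 0] :: real^3) has_vector_derivative
      vector [- (R * cos \<eta>), - (R * sin \<eta>), 0]) (at \<eta>)"
    by (rule has_vector_derivative_vector3) (auto intro!: derivative_eq_intros)
  moreover have "(\<lambda>\<eta>. R *\<^sub>R E2 \<eta>) = (\<lambda>\<eta>. vector [- (R * sin \<eta>), R * cos \<eta>, 0])"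
    "- x0 R \<eta> = vector [- (R * cos \<eta>), - (R * sin \<eta>), 0]"
    by (auto simp: vec3_simps)
  ultimately show "((\<lambda>\<eta>. R *\<^sub>R E2 \<eta>) has_vector_derivative - x0 R \<eta>) (at \<eta>)" by simp
qed

lemma D1_x0: "D1 (x0 R) = (\<lambda>\<eta>. R *\<^sub>R E2 \<eta>)"
  by (rule ext) (rule D1_eqI[OF x0_derivs(1)])

lemma D2_x0: "D2 (x0 R) = (\<lambda>\<eta>. - x0 R \<eta>)"
  unfolding D2_def D1_x0 by (rule ext) (rule D1_eqI[OF x0_derivs(2)])

lemma periodic_x0: "periodic (x0 R)" and periodic_E2: "periodic E2"
  by (simp_all add: periodic_def x0_def E2_def)

lemma continuous_x0: "continuous_on S (x0 R)"
  by (auto intro!: continuous_at_imp_continuous_on has_vector_derivative_continuous x0_derivs)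

lemma continuous_E2: "continuous_on S E2"
  using has_vector_derivative_continuous[OF x0_derivs(2)[of 1]] by (simp add: continuous_at_imp_continuous_on)

lemma H2_x0: "H2 (x0 R)"
  by (rule H2_C2[OF periodic_x0 x0_derivs]) (intro continuous_intros continuous_x0)

text \<open>The terms without \<open>u\<close> cancel: \<open>x0''\<close> is parallel to
  \<open>x0\<close>, and \<open>e3 \<times> x0 = x0'\<close>. The identity is pointwise where
  \<open>u'\<close> is differentiable, since \<open>D2\<close> is arbitrary elsewhere.\<close>

lemma F_op_eq:
  fixes w :: "(real^3) h2"
  assumes "x = (\<lambda>\<eta>. x0 R \<eta> + h2_fun w \<eta>)" "D1 (h2_fun w) differentiable at \<eta>"
  shows "D2 x \<eta> = - x0 R \<eta> + D2 (h2_fun w) \<eta>"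
    "F_op R lam w \<eta> = cross3 (x \<eta>) (D2 x \<eta>) - lam *\<^sub>R cross3 e3 (x \<eta>) + lam *\<^sub>R D1 x \<eta>"
    "D1 x differentiable at \<eta>"
proof -
  let ?u = "h2_fun w"
  have D1: "D1 x = (\<lambda>\<eta>. R *\<^sub>R E2 \<eta> + D1 ?u \<eta>)"
    unfolding assms(1)
    by (rule ext, rule D1_eqI) (intro has_vector_derivative_add x0_derivs H2_vector_derivative H2_h2_fun)
  have d: "(D1 x has_vector_derivative (- x0 R \<eta> + D2 ?u \<eta>)) (at \<eta>)"
    unfolding D1 D2_def using assms(2) by (intro has_vector_derivative_add x0_derivs D1_works)
  then show D2: "D2 x \<eta> = - x0 R \<eta> + D2 ?u \<eta>" unfolding D2_def[of x] by (rule D1_eqI)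
  show "D1 x differentiable at \<eta>" using d by (rule differentiableI_vector)
  show "F_op R lam w \<eta> = cross3 (x \<eta>) (D2 x \<eta>) - lam *\<^sub>R cross3 e3 (x \<eta>) + lam *\<^sub>R D1 x \<eta>"
    unfolding D2 D1 F_op_def Let_def D2_x0 by (simp add: assms(1) vec3_simps algebra_simps)
qed

lemma D1_x_of:
  "D1 (\<lambda>\<eta>. x0 R \<eta> + h2_fun w \<eta>) \<eta> = R *\<^sub>R E2 \<eta> + D1 (h2_fun w) \<eta>"
  "((\<lambda>\<eta>. x0 R \<eta> + h2_fun w \<eta>) has_vector_derivative (R *\<^sub>R E2 \<eta> + D1 (h2_fun w) \<eta>)) (at \<eta>)"
proof -
  show d: "((\<lambda>\<eta>. x0 R \<eta> + h2_fun w \<eta>) has_vector_derivative (R *\<^sub>R E2 \<eta> + D1 (h2_fun w) \<eta>)) (at \<eta>)"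
    by (intro has_vector_derivative_add x0_derivs H2_vector_derivative H2_h2_fun)
  show "D1 (\<lambda>\<eta>. x0 R \<eta> + h2_fun w \<eta>) \<eta> = R *\<^sub>R E2 \<eta> + D1 (h2_fun w) \<eta>"
    by (rule D1_eqI[OF d])
qed

lemma C_op_eq: "C_op R w \<eta> = ((norm (x0 R \<eta> + h2_fun w \<eta>))\<^sup>2 - R\<^sup>2) / 2"
proof -
  have "x0 R \<eta> \<bullet> x0 R \<eta> = R * cos \<eta> * (R * cos \<eta>) + R * sin \<eta> * (R * sin \<eta>)"
    by (simp add: vec3_simps)
  also have "\<dots> = R\<^sup>2" using sin_cos_squared_add3[of \<eta>] by algebra
  finally have "x0 R \<eta> \<bullet> x0 R \<eta> = R\<^sup>2" .
  then show ?thesis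
    by (simp add: C_op_def Let_def power2_norm_eq_inner inner_add_left inner_add_right inner_commute)
qed

section \<open>Reversibility and the target space\<close>

lemma S_refl_linear: "S_refl (a + b) = S_refl a + S_refl b" "S_refl (c *\<^sub>R a) = c *\<^sub>R S_refl a"
  "S_refl (- a) = - S_refl a" "S_refl (S_refl a) = a" "S_refl (a - b) = S_refl a - S_refl b"
  by (simp_all add: vec3_simps)

lemma bounded_linear_S_refl: "bounded_linear S_refl"
  by (rule linear_conv_bounded_linear[THEN iffD1]) (auto intro!: linearI simp: S_refl_linear)

text \<open>\<open>S\<close> is a reflection and reverses the orientation, whence the sign. This
  sign makes the two projected components of the operator even and odd.\<close>

lemma S_refl_cross: "cross3 (S_refl a) (S_refl b) = - S_refl (cross3 a b)"
  by (simp add: vec3_simps)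

lemma S_refl_inner: "S_refl a \<bullet> S_refl b = a \<bullet> b"
  by (simp add: vec3_simps)

lemma S_refl_frame: "x0 R (- \<eta>) = S_refl (x0 R \<eta>)" "E2 (- \<eta>) = - S_refl (E2 \<eta>)" "E1 (- \<eta>) = S_refl (E1 \<eta>)"
  "S_refl e3 = e3"
  by (simp_all add: vec3_simps)

lemma Y_rev_refl:
  assumes "u \<in> Y_rev"
  shows "h2_fun u (- \<eta>) = S_refl (h2_fun u \<eta>)" "D1 (h2_fun u) (- \<eta>) = - S_refl (D1 (h2_fun u) \<eta>)"
    "D1 (h2_fun u) differentiable at \<eta> \<Longrightarrow> D2 (h2_fun u) (- \<eta>) = S_refl (D2 (h2_fun u) \<eta>)"
proof -
  let ?u = "h2_fun u"
  have sym: "S_refl (?u (- \<eta>)) = ?u \<eta>" for \<eta> using assms by (simp add: Y_rev_def)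
  then show u: "?u (- \<eta>) = S_refl (?u \<eta>)" for \<eta> by (metis S_refl_linear(4))
  have neg: "((\<lambda>x. S_refl (f (- x))) has_vector_derivative - S_refl d) (at (- \<eta>))"
    if "(f has_vector_derivative d) (at \<eta>)" for f d \<eta>
  proof -
    have "((f \<circ> uminus) has_vector_derivative (- 1) *\<^sub>R d) (at (- \<eta>))"
      using that by (intro vector_diff_chain_at) (auto intro!: derivative_eq_intros)
    from bounded_linear.has_vector_derivative[OF bounded_linear_S_refl this]
    show ?thesis by (simp add: o_def S_refl_linear)
  qed
  show D: "D1 ?u (- \<eta>) = - S_refl (D1 ?u \<eta>)" for \<eta>
    using D1_eqI[OF neg[OF H2_vector_derivative[OF H2_h2_fun[of u]]], of \<eta>] unfolding sym by simp
  assume "D1 ?u differentiable at \<eta>"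
  then have "(D1 ?u has_vector_derivative D2 ?u \<eta>) (at \<eta>)" by (simp add: D2_def D1_works)
  from has_vector_derivative_minus[OF neg[OF this]]
  have "((\<lambda>x. - S_refl (D1 ?u (- x))) has_vector_derivative S_refl (D2 ?u \<eta>)) (at (- \<eta>))" by simp
  moreover have "(\<lambda>x. - S_refl (D1 ?u (- x))) = D1 ?u" by (auto simp: D S_refl_linear)
  ultimately show "D2 ?u (- \<eta>) = S_refl (D2 ?u \<eta>)" by (simp add: D2_def D1_eqI)
qed

lemma Y_revI: "(\<And>\<eta>. h2_fun u (- \<eta>) = S_refl (h2_fun u \<eta>)) \<Longrightarrow> u \<in> Y_rev"
  by (simp add: Y_rev_def S_refl_linear)

text \<open>The triple product moves \<open>u''\<close> to the front, so each component is an inner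
  product of the square integrable \<open>u''\<close> with a continuous function, plus a continuous
  remainder. The parities follow from \<open>F (- \<eta>) = - S (F \<eta>)\<close>.\<close>

theorem G_rev_in_Z_rev:
  assumes "u \<in> Y_rev"
  shows "G_rev R lam u \<in> Z_rev"
proof -
  let ?u = "h2_fun u"
  have H: "H2 ?u" by (rule H2_h2_fun)
  have per: "periodic ?u" "periodic (D1 ?u)" using H periodic_D1 by (auto simp: H2_def)
  note c = H2_continuous[OF H] H2_D1_continuous[OF H] continuous_x0
  have ae: "AE \<eta> in lebesgue. D1 ?u differentiable at \<eta>" using H by (simp add: H2_def)
  have L2F: "L2 (\<lambda>\<eta>. F_op R lam u \<eta> \<bullet> W \<eta>)" if W: "periodic W" "continuous_on UNIV W" for W
  proof -
    let ?r = "\<lambda>\<eta>. (cross3 (?u \<eta>) (- x0 R \<eta>) - lam *\<^sub>R cross3 e3 (?u \<eta>) + lam *\<^sub>R D1 ?u \<eta>) \<bullet> W \<eta>"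
    have "F_op R lam u \<eta> \<bullet> W \<eta> = D2 ?u \<eta> \<bullet> cross3 (W \<eta>) (x0 R \<eta> + ?u \<eta>) + ?r \<eta>" for \<eta>
      unfolding F_op_def Let_def D2_x0 by (simp add: inner3 cross3_nth algebra_simps)
    moreover have "L2 (\<lambda>\<eta>. D2 ?u \<eta> \<bullet> cross3 (W \<eta>) (x0 R \<eta> + ?u \<eta>))"
      by (rule L2_bilinear_continuous[OF bounded_bilinear_inner H2_L2(3)[OF H]])
         (use per W periodic_x0 in \<open>auto simp: periodic_def intro!: continuous_on_cross continuous_intros c\<close>)
    moreover have "L2 ?r"
      by (rule L2_continuous)
         (use per W periodic_x0 in \<open>auto simp: periodic_def intro!: continuous_on_cross continuous_intros c\<close>)
    ultimately show ?thesis by (simp add: L2_add)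
  qed
  have "AE \<eta> in lebesgue. F_op R lam u (- \<eta>) = - S_refl (F_op R lam u \<eta>)"
    using ae
  proof (rule AE_mp, intro AE_I2 impI)
    fix \<eta> assume "D1 ?u differentiable at \<eta>"
    note r = Y_rev_refl[OF assms] Y_rev_refl(3)[OF assms this]
    have "cross3 e3 (S_refl v) = - S_refl (cross3 e3 v)" for v
      using S_refl_cross[of e3 v] by (simp add: S_refl_frame)
    then show "F_op R lam u (- \<eta>) = - S_refl (F_op R lam u \<eta>)"
      unfolding F_op_def Let_def D2_x0 r S_refl_frame
      by (simp add: S_refl_cross S_refl_linear)
  qed
  note sym = this
  have par: "AE \<eta> in lebesgue. F_op R lam u (- \<eta>) \<bullet> E2 (- \<eta>) = F_op R lam u \<eta> \<bullet> E2 \<eta>"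
    using sym by eventually_elim (simp add: S_refl_frame S_refl_inner)
  have par2: "AE \<eta> in lebesgue. F_op R lam u (- \<eta>) \<bullet> e3 = - (F_op R lam u \<eta> \<bullet> e3)"
    using sym by eventually_elim (simp add: vec3_simps)
  have "H2 (\<lambda>x. 1 *\<^sub>R (x0 R x \<bullet> ?u x) + (1/2) *\<^sub>R (?u x \<bullet> ?u x))"
    by (rule H2_lincomb(1)[OF H2_bilinear[OF bounded_bilinear_inner H2_x0 H] H2_bilinear[OF bounded_bilinear_inner H H]])
  then have "H2 (C_op R u)"
    by (simp add: C_op_def[abs_def] Let_def power2_norm_eq_inner)
  moreover have "C_op R u (- \<eta>) = C_op R u \<eta>" for \<eta>
    by (simp add: C_op_def Let_def Y_rev_refl[OF assms] S_refl_frame S_refl_inner power2_norm_eq_inner)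
  ultimately show ?thesis
    using par par2 L2F[OF periodic_E2 continuous_E2] L2F[of "\<lambda>_. e3"]
    by (simp add: G_rev_def Z_rev_def periodic_def)
qed

text \<open>Zeros of the operators correspond to solutions \<open>(x, M)\<close>, with \<open>M = x \<times> x' + \<lambda> x\<close>, of the
  polynomial system \<open>R\<^sup>2 x' = M \<times> x\<close>, \<open>M' = \<lambda> e\<^sub>3 \<times> x\<close> on the sphere.\<close>

lemma cross_cross_sphere:
  assumes "norm (x :: real^3) = R" "M \<bullet> x = lam * R\<^sup>2"
  shows "cross3 x (cross3 M x) = R\<^sup>2 *\<^sub>R (M - lam *\<^sub>R x)"
proof -
  have "cross3 x (cross3 M x) = (x \<bullet> x) *\<^sub>R M - (M \<bullet> x) *\<^sub>R x"
    by (simp add: vec3_eq cross3_nth inner3 algebra_simps)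
  then show ?thesis
    using assms by (simp add: power2_norm_eq_inner[symmetric] algebra_simps)
qed

text \<open>The right side of \<open>R^2 x' = M \<times> x\<close> is differentiable, so
  \<open>x\<close> is twice differentiable everywhere. On the sphere
  \<open>x \<times> x' = M - \<lambda> x\<close>, and differentiating this is the claim.\<close>

lemma system_imp_zero:
  fixes w :: "(real^3) h2"
  assumes "R > 0" and x: "x = (\<lambda>\<eta>. x0 R \<eta> + h2_fun w \<eta>)"
    and x': "\<And>\<eta>. (x has_vector_derivative (1 / R\<^sup>2) *\<^sub>R cross3 (M \<eta>) (x \<eta>)) (at \<eta>)"
    and M': "\<And>\<eta>. (M has_vector_derivative lam *\<^sub>R cross3 e3 (x \<eta>)) (at \<eta>)"
    and nx: "\<And>\<eta>. norm (x \<eta>) = R" and Mx: "\<And>\<eta>. M \<eta> \<bullet> x \<eta> = lam * R\<^sup>2"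
  shows "G_zero R lam w" "cross3 (x \<eta>) (D2 x \<eta>) - lam *\<^sub>R cross3 e3 (x \<eta>) + lam *\<^sub>R D1 x \<eta> = 0"
proof -
  interpret cross: bounded_bilinear cross3 by (rule bounded_bilinear_cross3)
  have D1: "D1 x = (\<lambda>\<eta>. (1 / R\<^sup>2) *\<^sub>R cross3 (M \<eta>) (x \<eta>))" by (rule ext) (rule D1_eqI[OF x'])
  have dd: "D1 x differentiable at \<eta>" for \<eta>
    unfolding D1
    by (intro derivative_intros differentiableI_vector[OF cross.has_vector_derivative[OF M' x']] )
  have x'': "(D1 x has_vector_derivative D2 x \<eta>) (at \<eta>)" for \<eta>
    unfolding D2_def by (rule D1_works[OF dd])
  have x1: "(x has_vector_derivative D1 x \<eta>) (at \<eta>)" for \<eta> using x' by (simp add: D1)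
  have eq: "cross3 (x \<eta>) (D1 x \<eta>) = M \<eta> - lam *\<^sub>R x \<eta>" for \<eta>
    using cross_cross_sphere[OF nx Mx] \<open>R > 0\<close> by (simp add: D1 cross.scaleR_right)
  have "((\<lambda>\<eta>. cross3 (x \<eta>) (D1 x \<eta>)) has_vector_derivative (cross3 (x \<eta>) (D2 x \<eta>) + cross3 (D1 x \<eta>) (D1 x \<eta>))) (at \<eta>)" for \<eta>
    by (rule cross.has_vector_derivative[OF x1 x''])
  moreover have "((\<lambda>\<eta>. M \<eta> - lam *\<^sub>R x \<eta>) has_vector_derivative (lam *\<^sub>R cross3 e3 (x \<eta>) - lam *\<^sub>R D1 x \<eta>)) (at \<eta>)" for \<eta>
    by (intro has_vector_derivative_diff M' bounded_linear.has_vector_derivative[OF bounded_linear_scaleR_right] x1)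
  ultimately have "cross3 (x \<eta>) (D2 x \<eta>) + cross3 (D1 x \<eta>) (D1 x \<eta>) = lam *\<^sub>R cross3 e3 (x \<eta>) - lam *\<^sub>R D1 x \<eta>" for \<eta>
    unfolding eq by (rule vector_derivative_unique_at)
  then show z: "cross3 (x \<eta>) (D2 x \<eta>) - lam *\<^sub>R cross3 e3 (x \<eta>) + lam *\<^sub>R D1 x \<eta> = 0" for \<eta>
    by simp
  have "D1 (h2_fun w) differentiable at \<eta>" for \<eta>
  proof -
    have "D1 (h2_fun w) = (\<lambda>\<eta>. D1 x \<eta> - R *\<^sub>R E2 \<eta>)" by (auto simp: x D1_x_of)
    then show ?thesis
      using has_vector_derivative_diff[OF x'' x0_derivs(2)] by (auto intro: differentiableI_vector)
  qed
  then have "F_op R lam w \<eta> = 0" for \<eta> using F_op_eq(2)[OF x] z by simp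
  moreover have "C_op R w \<eta> = 0" for \<eta> using nx[of \<eta>] by (simp add: C_op_eq x)
  ultimately show "G_zero R lam w" by (simp add: G_zero_def G_op_def)
qed

lemma G_zero_imp_G_rev_zero: "G_zero R lam w \<Longrightarrow> G_rev_zero R lam w"
  by (auto simp: G_zero_def G_rev_zero_def G_op_def G_rev_def elim!: AE_mp)

text \<open>A priori \<open>M\<close> contains only the continuous \<open>x'\<close>. Integration by
  parts shows that \<open>M\<close> is the integral of \<open>\<lambda> e3 \<times> x\<close>, which
  is continuous, so \<open>M\<close> is differentiable at every point and exceptional null sets
  disappear.\<close>

lemma zero_imp_system:
  fixes w :: "(real^3) h2"
  assumes "R > 0" and x: "x = (\<lambda>\<eta>. x0 R \<eta> + h2_fun w \<eta>)" and zero: "G_rev_zero R lam w"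
    and small: "\<And>\<eta>. norm (h2_fun w \<eta>) < R"
    and M: "M = (\<lambda>\<eta>. cross3 (x \<eta>) (D1 x \<eta>) + lam *\<^sub>R x \<eta>)"
  shows "(x has_vector_derivative (1 / R\<^sup>2) *\<^sub>R cross3 (M \<eta>) (x \<eta>)) (at \<eta>)"
    "(M has_vector_derivative lam *\<^sub>R cross3 e3 (x \<eta>)) (at \<eta>)"
    "norm (x \<eta>) = R" "M \<eta> \<bullet> x \<eta> = lam * R\<^sup>2"
proof -
  interpret cross: bounded_bilinear cross3 by (rule bounded_bilinear_cross3)
  let ?u = "h2_fun w"
  have H: "H2 ?u" by (rule H2_h2_fun)
  have x1: "(x has_vector_derivative D1 x \<eta>) (at \<eta>)" for \<eta>
    using D1_x_of(2)[of R w] unfolding x D1_x_of(1) .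
  have Hx: "H2 x"
    unfolding x using H2_lincomb(1)[OF H2_x0 H, of 1 R 1] by simp
  have C0: "C_op R w \<eta> = 0" for \<eta> using zero by (simp add: G_rev_zero_def G_rev_def)
  have nx2: "(norm (x \<eta>))\<^sup>2 = R\<^sup>2" for \<eta> using C0[of \<eta>] by (simp add: C_op_eq x)
  then show nx: "norm (x \<eta>) = R" for \<eta> using \<open>R > 0\<close> by simp
  have xx: "x \<eta> \<bullet> x \<eta> = R\<^sup>2" for \<eta> using nx2 by (simp add: power2_norm_eq_inner)
  have xx': "x \<eta> \<bullet> D1 x \<eta> = 0" for \<eta>
  proof -
    have "((\<lambda>\<eta>. x \<eta> \<bullet> x \<eta>) has_vector_derivative (x \<eta> \<bullet> D1 x \<eta> + D1 x \<eta> \<bullet> x \<eta>)) (at \<eta>)"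
      by (rule bounded_bilinear.has_vector_derivative[OF bounded_bilinear_inner x1 x1])
    then have "((\<lambda>\<eta>. R\<^sup>2) has_vector_derivative (x \<eta> \<bullet> D1 x \<eta> + D1 x \<eta> \<bullet> x \<eta>)) (at \<eta>)" by (simp add: xx)
    from vector_derivative_unique_at[OF this has_vector_derivative_const]
    show ?thesis by (simp add: inner_commute)
  qed
  have M_cross: "cross3 (M \<eta>) (x \<eta>) = R\<^sup>2 *\<^sub>R D1 x \<eta>" for \<eta>
  proof -
    have "cross3 (M \<eta>) (x \<eta>) = (x \<eta> \<bullet> x \<eta>) *\<^sub>R D1 x \<eta> - (x \<eta> \<bullet> D1 x \<eta>) *\<^sub>R x \<eta>"
      unfolding M by (simp add: vec3_eq cross3_nth inner3 algebra_simps)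
    then show ?thesis by (simp add: xx xx')
  qed
  show "(x has_vector_derivative (1 / R\<^sup>2) *\<^sub>R cross3 (M \<eta>) (x \<eta>)) (at \<eta>)"
    using x1 \<open>R > 0\<close> by (simp add: M_cross)
  show "M \<eta> \<bullet> x \<eta> = lam * R\<^sup>2"
    unfolding M by (simp add: inner_add_left xx dot_cross_self)
  have E1pos: "E1 \<eta> \<bullet> x \<eta> > 0" for \<eta>
  proof -
    have "norm (E1 \<eta>) = 1" by (simp add: norm_eq_sqrt_inner vec3_simps sin_cos_squared_add3 add.commute)
    moreover have "E1 \<eta> \<bullet> x0 R \<eta> = R"
    proof -
      have "E1 \<eta> \<bullet> x0 R \<eta> = cos \<eta> * (R * cos \<eta>) + sin \<eta> * (R * sin \<eta>)" by (simp add: vec3_simps)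
      also have "\<dots> = R" using sin_cos_squared_add3[of \<eta>] by algebra
      finally show ?thesis .
    qed
    ultimately show ?thesis
      using Cauchy_Schwarz_ineq2[of "E1 \<eta>" "?u \<eta>"] small[of \<eta>] by (simp add: x inner_add_right)
  qed
  have "AE \<eta> in lebesgue. D1 ?u differentiable at \<eta>" using H by (simp add: H2_def)
  moreover have "AE \<eta> in lebesgue. F_op R lam w \<eta> \<bullet> E2 \<eta> = 0" "AE \<eta> in lebesgue. F_op R lam w \<eta> \<bullet> e3 = 0"
    using zero by (auto simp: G_rev_zero_def G_rev_def)
  ultimately have "AE \<eta> in lebesgue. cross3 (x \<eta>) (D2 x \<eta>) + lam *\<^sub>R D1 x \<eta> = lam *\<^sub>R cross3 e3 (x \<eta>)"
  proof eventually_elim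
    case (elim \<eta>)
    let ?F = "F_op R lam w \<eta>"
    have F: "?F = cross3 (x \<eta>) (D2 x \<eta>) - lam *\<^sub>R cross3 e3 (x \<eta>) + lam *\<^sub>R D1 x \<eta>"
      by (rule F_op_eq(2)[OF x elim(1)])
    have "?F \<bullet> x \<eta> = 0"
      unfolding F using xx'[of \<eta>] by (simp add: inner_add_left inner_diff_left dot_cross_self inner_commute[of "D1 x \<eta>"])
    moreover have dec: "v = (v \<bullet> E1 \<eta>) *\<^sub>R E1 \<eta> + (v \<bullet> E2 \<eta>) *\<^sub>R E2 \<eta> + (v \<bullet> e3) *\<^sub>R e3" for v
    proof -
      have cc: "cos \<eta> * (cos \<eta> * r) = r - sin \<eta> * (sin \<eta> * r)" for r
        using sin_cos_squared_add3[of \<eta>] by algebra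
      show ?thesis by (simp add: vec3_simps algebra_simps cc)
    qed
    have "?F = (?F \<bullet> E1 \<eta>) *\<^sub>R E1 \<eta>" using dec[of ?F] elim(2,3) by simp
    ultimately have "(?F \<bullet> E1 \<eta>) * (E1 \<eta> \<bullet> x \<eta>) = 0" by (metis inner_scaleR_left)
    then have "?F \<bullet> E1 \<eta> = 0" using E1pos[of \<eta>] by simp
    then have "?F = 0" using \<open>?F = (?F \<bullet> E1 \<eta>) *\<^sub>R E1 \<eta>\<close> by simp
    then show ?case unfolding F by (simp add: algebra_simps)
  qed
  note ae = this
  have int: "((\<lambda>\<eta>. lam *\<^sub>R cross3 e3 (x \<eta>)) has_integral (M b - M a)) {a..b}" if "a \<le> b" for a b
  proof (rule AE_has_integral[OF _ ae])
    have h1: "((\<lambda>\<eta>. cross3 (x \<eta>) (D2 x \<eta>) + cross3 (D1 x \<eta>) (D1 x \<eta>)) has_integral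
        (cross3 (x b) (D1 x b) - cross3 (x a) (D1 x a))) {a..b}"
      using H2_D1_bilinear_integral[OF cross.flip Hx that x1 H2_D1_continuous[OF Hx]] .
    have "((\<lambda>\<eta>. lam *\<^sub>R x \<eta>) has_vector_derivative lam *\<^sub>R D1 x \<eta>) (at \<eta>)" for \<eta>
      by (rule bounded_linear.has_vector_derivative[OF bounded_linear_scaleR_right x1])
    then have h2: "((\<lambda>\<eta>. lam *\<^sub>R D1 x \<eta>) has_integral (lam *\<^sub>R x b - lam *\<^sub>R x a)) {a..b}"
      by (rule fundamental_theorem_of_calculus[OF that has_vector_derivative_at_within])
    show "((\<lambda>\<eta>. cross3 (x \<eta>) (D2 x \<eta>) + lam *\<^sub>R D1 x \<eta>) has_integral (M b - M a)) {a..b}"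
      using has_integral_add[OF h1 h2] by (simp add: M algebra_simps)
  qed
  show "(M has_vector_derivative lam *\<^sub>R cross3 e3 (x \<eta>)) (at \<eta>)"
  proof -
    have xc: "continuous_on S x" for S using continuous_on_subset[OF H2_continuous[OF Hx]] by auto
    let ?f = "\<lambda>\<eta>. lam *\<^sub>R cross3 e3 (x \<eta>)"
    have fc: "continuous_on {\<eta> - 1..\<eta> + 1} ?f" by (intro continuous_on_scaleR continuous_on_const continuous_on_cross xc)
    have "((\<lambda>u. integral {\<eta> - 1..u} ?f) has_vector_derivative ?f \<eta>) (at \<eta> within {\<eta> - 1..\<eta> + 1})"
      by (rule integral_has_vector_derivative[OF fc]) simp
    then have "((\<lambda>u. integral {\<eta> - 1..u} ?f) has_vector_derivative ?f \<eta>) (at \<eta> within {\<eta> - 1<..<\<eta> + 1})"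
      by (rule has_vector_derivative_within_subset) auto
    then have "((\<lambda>u. integral {\<eta> - 1..u} ?f) has_vector_derivative ?f \<eta>) (at \<eta>)"
      by (subst (asm) at_within_open) auto
    from has_vector_derivative_add[OF this has_vector_derivative_const[of "M (\<eta> - 1)"]]
    have "((\<lambda>u. integral {\<eta> - 1..u} ?f + M (\<eta> - 1)) has_vector_derivative ?f \<eta>) (at \<eta>)" by simp
    then show ?thesis
    proof (rule has_vector_derivative_transform_within_open)
      show "integral {\<eta> - 1..u} (\<lambda>\<eta>. lam *\<^sub>R cross3 e3 (x \<eta>)) + M (\<eta> - 1) = M u" if "u \<in> {\<eta> - 1<..<\<eta> + 1}" for u
        using integral_unique[OF int[of "\<eta> - 1" u]] that by simp
    qed auto
  qed
qed

section \<open>Moving frame coordinates\<close>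

lemma norm_cross_le: "norm (cross3 v w) \<le> norm v * norm w"
proof (rule power2_le_imp_le)
  show "(norm (cross3 v w))\<^sup>2 \<le> (norm v * norm w)\<^sup>2"
    using norm_cross_dot[of v w] zero_le_power2[of "v \<bullet> w"] by linarith
qed simp

context mode
begin

definition frame :: "state \<Rightarrow> real \<Rightarrow> real^3" where
  "frame z \<eta> = vector [ev (za z) \<eta> * cos \<eta> - ev (zb z) \<eta> * sin \<eta>,
     ev (za z) \<eta> * sin \<eta> + ev (zb z) \<eta> * cos \<eta>, ev (zc z) \<eta>]"

definition momentum :: "real \<Rightarrow> state \<Rightarrow> real \<Rightarrow> real^3" where
  "momentum \<mu> z \<eta> = vector [((kap + \<mu>) * R + ev (zp z) \<eta>) * cos \<eta> - ev (zq z) \<eta> * sin \<eta>,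
     ((kap + \<mu>) * R + ev (zp z) \<eta>) * sin \<eta> + ev (zq z) \<eta> * cos \<eta>, R\<^sup>2 + zn z]"

text \<open>The system for \<open>(x, M)\<close> in rotating components. The vertical component of
  \<open>M'\<close> is zero, so \<open>zn\<close> is a number. The two final conditions are the
  sphere condition and the value of \<open>M \<cdot> x\<close> at \<eta> = 0.\<close>

definition frame_sys :: "real \<Rightarrow> state \<Rightarrow> bool" where
  "frame_sys \<mu> z \<longleftrightarrow>
     (\<forall>\<eta>. (ev (za z) has_real_derivative (ev (zq z) \<eta> * ev (zc z) \<eta> - zn z * ev (zb z) \<eta>) / R\<^sup>2) (at \<eta>)) \<and>
     (\<forall>\<eta>. (ev (zb z) has_real_derivative (zn z * (R + ev (za z) \<eta>) - ((kap + \<mu>) * R + ev (zp z) \<eta>) * ev (zc z) \<eta>) / R\<^sup>2) (at \<eta>)) \<and>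
     (\<forall>\<eta>. (ev (zc z) has_real_derivative (((kap + \<mu>) * R + ev (zp z) \<eta>) * ev (zb z) \<eta> - ev (zq z) \<eta> * (R + ev (za z) \<eta>)) / R\<^sup>2) (at \<eta>)) \<and>
     (\<forall>\<eta>. (ev (zp z) has_real_derivative ev (zq z) \<eta> - (kap + \<mu>) * ev (zb z) \<eta>) (at \<eta>)) \<and>
     (\<forall>\<eta>. (ev (zq z) has_real_derivative (kap + \<mu>) * ev (za z) \<eta> - ev (zp z) \<eta>) (at \<eta>)) \<and>
     R * ev (za z) 0 = - (ev (za z) 0 * ev (za z) 0 + ev (zc z) 0 * ev (zc z) 0) / 2 \<and>
     (kap + \<mu>) * R * ev (za z) 0 + R * ev (zp z) 0 + R\<^sup>2 * ev (zc z) 0 + ev (zp z) 0 * ev (za z) 0 + zn z * ev (zc z) 0 = 0"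

lemma nonlin_sol_derivs:
  assumes "d = dP \<mu> z + dQ z z"
  shows "ev (d1 d) \<eta> = (ev (zq z) \<eta> * ev (zc z) \<eta> - zn z * ev (zb z) \<eta>) / R\<^sup>2"
    "ev ((1/R) *\<^sub>R (zn z *\<^sub>R 1 - kap *\<^sub>R zc z) + (0 * kp / R) *\<^sub>R cosp k + d3 d) \<eta>
      = (zn z * (R + ev (za z) \<eta>) - ((kap + \<mu>) * R + ev (zp z) \<eta>) * ev (zc z) \<eta>) / R\<^sup>2"
    "ev ((1/R) *\<^sub>R zy z + (0 / R) *\<^sub>R sinp k + d4 d) \<eta>
      = (((kap + \<mu>) * R + ev (zp z) \<eta>) * ev (zb z) \<eta> - ev (zq z) \<eta> * (R + ev (za z) \<eta>)) / R\<^sup>2"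
    "ev (d2 d) \<eta> - R * ((((kap + \<mu>) * R + ev (zp z) \<eta>) * ev (zb z) \<eta> - ev (zq z) \<eta> * (R + ev (za z) \<eta>)) / R\<^sup>2)
      = ev (zq z) \<eta> - (kap + \<mu>) * ev (zb z) \<eta>"
    "kap * ((zn z * (R + ev (za z) \<eta>) - ((kap + \<mu>) * R + ev (zp z) \<eta>) * ev (zc z) \<eta>) / R\<^sup>2) -
      ev (- ((real k)\<^sup>2 * R) *\<^sub>R zc z + (kap * zn z / R) *\<^sub>R 1 - kap *\<^sub>R za z + zs z
        + (0 * real k) *\<^sub>R cosp k + kap *\<^sub>R d3 d - d5 d) \<eta>
      = (kap + \<mu>) * ev (za z) \<eta> - ev (zp z) \<eta>"
    "R * ev (za z) 0 = d6 d \<longleftrightarrow>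
      R * ev (za z) 0 = - (ev (za z) 0 * ev (za z) 0 + ev (zc z) 0 * ev (zc z) 0) / 2"
    "kap * ev (za z) 0 + ev (zs z) 0 = d7 d \<longleftrightarrow>
     (kap + \<mu>) * R * ev (za z) 0 + R * ev (zp z) 0 + R\<^sup>2 * ev (zc z) 0 + ev (zp z) 0 * ev (za z) 0 + zn z * ev (zc z) 0 = 0"
proof -
  have Rn: "R \<noteq> 0" using R by simp
  have S: "ev (zs z) x = ev (zp z) x + R * ev (zc z) x" and Y: "ev (zy z) x = kap * ev (zb z) x - ev (zq z) x" for x
    by (simp_all add: zp_def zq_def)
  show "ev (d1 d) \<eta> = (ev (zq z) \<eta> * ev (zc z) \<eta> - zn z * ev (zb z) \<eta>) / R\<^sup>2"
    by (simp add: assms dP_def dQ_def)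
  show "ev ((1/R) *\<^sub>R (zn z *\<^sub>R 1 - kap *\<^sub>R zc z) + (0 * kp / R) *\<^sub>R cosp k + d3 d) \<eta>
      = (zn z * (R + ev (za z) \<eta>) - ((kap + \<mu>) * R + ev (zp z) \<eta>) * ev (zc z) \<eta>) / R\<^sup>2"
    using Rn by (simp add: assms dP_def dQ_def field_simps power2_eq_square)
  show "ev ((1/R) *\<^sub>R zy z + (0 / R) *\<^sub>R sinp k + d4 d) \<eta>
      = (((kap + \<mu>) * R + ev (zp z) \<eta>) * ev (zb z) \<eta> - ev (zq z) \<eta> * (R + ev (za z) \<eta>)) / R\<^sup>2"
    using Rn by (simp add: assms dP_def dQ_def Y field_simps power2_eq_square)
  show "ev (d2 d) \<eta> - R * ((((kap + \<mu>) * R + ev (zp z) \<eta>) * ev (zb z) \<eta> - ev (zq z) \<eta> * (R + ev (za z) \<eta>)) / R\<^sup>2)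
      = ev (zq z) \<eta> - (kap + \<mu>) * ev (zb z) \<eta>"
    using Rn by (simp add: assms dP_def dQ_def field_simps power2_eq_square)
  \<comment> \<open>The relation \<open>kap^2 + R^2 = (k R)^2\<close> reconciles the coefficient
    \<open>k^2 R\<close> of the oscillator with the contributions of \<open>b'\<close> and
    \<open>s\<close>.\<close>
  have kk: "kap * (kap * r) = R * (R * (real k * (real k * r))) - R * (R * r)" for r
  proof -
    have "kap * (kap * r) = (R\<^sup>2 * ((real k)\<^sup>2 - 1)) * r" by (simp add: kap_sq flip: mult.assoc)
    then show ?thesis by (simp add: power2_eq_square algebra_simps)
  qed
  show "kap * ((zn z * (R + ev (za z) \<eta>) - ((kap + \<mu>) * R + ev (zp z) \<eta>) * ev (zc z) \<eta>) / R\<^sup>2) -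
      ev (- ((real k)\<^sup>2 * R) *\<^sub>R zc z + (kap * zn z / R) *\<^sub>R 1 - kap *\<^sub>R za z + zs z
        + (0 * real k) *\<^sub>R cosp k + kap *\<^sub>R d3 d - d5 d) \<eta>
      = (kap + \<mu>) * ev (za z) \<eta> - ev (zp z) \<eta>"
    using Rn by (simp add: assms dP_def dQ_def S field_simps power2_eq_square kk)
  show "R * ev (za z) 0 = d6 d \<longleftrightarrow>
      R * ev (za z) 0 = - (ev (za z) 0 * ev (za z) 0 + ev (zc z) 0 * ev (zc z) 0) / 2"
    by (auto simp: assms dP_def dQ_def field_simps)
  show "kap * ev (za z) 0 + ev (zs z) 0 = d7 d \<longleftrightarrow>
     (kap + \<mu>) * R * ev (za z) 0 + R * ev (zp z) 0 + R\<^sup>2 * ev (zc z) 0 + ev (zp z) 0 * ev (za z) 0 + zn z * ev (zc z) 0 = 0"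
    using Rn by (simp add: assms dP_def dQ_def S field_simps power2_eq_square)
      (simp add: eq_neg_iff_add_eq_0 add_ac)
qed

lemma nonlin_sol_iff_frame_sys: "nonlin_sol \<mu> z \<longleftrightarrow> frame_sys \<mu> z"
proof -
  define d where "d = dP \<mu> z + dQ z z"
  note nd = nonlin_sol_derivs[OF d_def]
  have p: "ev (zp z) = (\<lambda>x. ev (zs z) x - R * ev (zc z) x)" "ev (zq z) = (\<lambda>x. kap * ev (zb z) x - ev (zy z) x)"
    and s: "ev (zs z) = (\<lambda>x. ev (zp z) x + R * ev (zc z) x)" "ev (zy z) = (\<lambda>x. kap * ev (zb z) x - ev (zq z) x)"
    by (auto simp: zp_def zq_def)
  show ?thesis
  proof
    assume "nonlin_sol \<mu> z"
    then have L: "lin_sol 0 z d" by (simp add: nonlin_sol_def d_def)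
    note l = L[unfolded lin_sol_def pderiv_per_def nd(1,2,3,6,7)]
    have "(ev (zp z) has_real_derivative ev (zq z) \<eta> - (kap + \<mu>) * ev (zb z) \<eta>) (at \<eta>)" for \<eta>
    proof (subst p(1), rule DERIV_cong[OF _ nd(4)])
      show "((\<lambda>x. ev (zs z) x - R * ev (zc z) x) has_real_derivative ev (d2 d) \<eta> -
        R * ((((kap + \<mu>) * R + ev (zp z) \<eta>) * ev (zb z) \<eta> - ev (zq z) \<eta> * (R + ev (za z) \<eta>)) / R\<^sup>2)) (at \<eta>)"
        using l by (intro DERIV_diff DERIV_cmult) auto
    qed
    moreover have "(ev (zq z) has_real_derivative (kap + \<mu>) * ev (za z) \<eta> - ev (zp z) \<eta>) (at \<eta>)" for \<eta>
    proof (subst p(2), rule DERIV_cong[OF _ nd(5)])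
      show "((\<lambda>x. kap * ev (zb z) x - ev (zy z) x) has_real_derivative
        kap * ((zn z * (R + ev (za z) \<eta>) - ((kap + \<mu>) * R + ev (zp z) \<eta>) * ev (zc z) \<eta>) / R\<^sup>2) -
        ev (- ((real k)\<^sup>2 * R) *\<^sub>R zc z + (kap * zn z / R) *\<^sub>R 1 - kap *\<^sub>R za z + zs z
        + (0 * real k) *\<^sub>R cosp k + kap *\<^sub>R d3 d - d5 d) \<eta>) (at \<eta>)"
        using l by (intro DERIV_diff DERIV_cmult) blast+
    qed
    ultimately show "frame_sys \<mu> z" using l unfolding frame_sys_def by blast
  next
    assume f: "frame_sys \<mu> z"
    have "(ev (zs z) has_real_derivative ev (d2 d) \<eta>) (at \<eta>)" for \<eta>
    proof -
      have "((\<lambda>x. ev (zp z) x + R * ev (zc z) x) has_real_derivative (ev (zq z) \<eta> - (kap + \<mu>) * ev (zb z) \<eta>) +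
        R * ((((kap + \<mu>) * R + ev (zp z) \<eta>) * ev (zb z) \<eta> - ev (zq z) \<eta> * (R + ev (za z) \<eta>)) / R\<^sup>2)) (at \<eta>)"
        using f unfolding frame_sys_def by (intro DERIV_add DERIV_cmult) auto
      then show ?thesis
        unfolding nd(4)[symmetric] s(1)[symmetric] by simp
    qed
    moreover have "(ev (zy z) has_real_derivative ev (- ((real k)\<^sup>2 * R) *\<^sub>R zc z + (kap * zn z / R) *\<^sub>R 1 - kap *\<^sub>R za z + zs z
        + (0 * real k) *\<^sub>R cosp k + kap *\<^sub>R d3 d - d5 d) \<eta>) (at \<eta>)" (is "(_ has_real_derivative ?y \<eta>) _") for \<eta>
    proof -
      let ?b = "kap * ((zn z * (R + ev (za z) \<eta>) - ((kap + \<mu>) * R + ev (zp z) \<eta>) * ev (zc z) \<eta>) / R\<^sup>2)"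
      have "((\<lambda>x. kap * ev (zb z) x - ev (zq z) x) has_real_derivative
        ?b - ((kap + \<mu>) * ev (za z) \<eta> - ev (zp z) \<eta>)) (at \<eta>)"
        using f unfolding frame_sys_def by (intro DERIV_diff DERIV_cmult) auto
      moreover have "?b - ((kap + \<mu>) * ev (za z) \<eta> - ev (zp z) \<eta>) = ?y \<eta>"
        unfolding nd(5)[symmetric] by simp
      ultimately show ?thesis unfolding s(2)[symmetric] by (rule DERIV_cong)
    qed
    ultimately have "lin_sol 0 z d"
      using f unfolding lin_sol_def pderiv_per_def nd(1,2,3,6,7) frame_sys_def by blast
    then show "nonlin_sol \<mu> z" by (simp add: nonlin_sol_def d_def)
  qed
qed

text \<open>The conditions at \<eta> = 0 spread to all \<eta>: \<open>x'\<close> is orthogonal to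
  both \<open>x\<close> and \<open>M\<close>, and \<open>M'\<close> is orthogonal to
  \<open>x\<close>, so \<open>x \<cdot> x\<close> and \<open>M \<cdot> x\<close> are
  constant.\<close>

lemma frame_sys_imp_system:
  assumes f: "frame_sys \<mu> z" and rev: "rev_state z"
    and x: "x = (\<lambda>\<eta>. x0 R \<eta> + frame z \<eta>)" and M: "M = momentum \<mu> z"
  shows "(x has_vector_derivative (1 / R\<^sup>2) *\<^sub>R cross3 (M \<eta>) (x \<eta>)) (at \<eta>)"
    "(M has_vector_derivative (kap + \<mu>) *\<^sub>R cross3 e3 (x \<eta>)) (at \<eta>)"
    "norm (x \<eta>) = R" "M \<eta> \<bullet> x \<eta> = (kap + \<mu>) * R\<^sup>2"
proof -
  have Rn: "R \<noteq> 0" using R by simp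
  note f' = f[unfolded frame_sys_def]
  have da: "(ev (za z) has_real_derivative (ev (zq z) \<eta> * ev (zc z) \<eta> - zn z * ev (zb z) \<eta>) / R\<^sup>2) (at \<eta>)"
    and db: "(ev (zb z) has_real_derivative (zn z * (R + ev (za z) \<eta>) - ((kap + \<mu>) * R + ev (zp z) \<eta>) * ev (zc z) \<eta>) / R\<^sup>2) (at \<eta>)"
    and dc: "(ev (zc z) has_real_derivative (((kap + \<mu>) * R + ev (zp z) \<eta>) * ev (zb z) \<eta> - ev (zq z) \<eta> * (R + ev (za z) \<eta>)) / R\<^sup>2) (at \<eta>)"
    and dp: "(ev (zp z) has_real_derivative ev (zq z) \<eta> - (kap + \<mu>) * ev (zb z) \<eta>) (at \<eta>)"
    and dq: "(ev (zq z) has_real_derivative (kap + \<mu>) * ev (za z) \<eta> - ev (zp z) \<eta>) (at \<eta>)" for \<eta>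
    using f' by auto
  show x': "(x has_vector_derivative (1 / R\<^sup>2) *\<^sub>R cross3 (M \<eta>) (x \<eta>)) (at \<eta>)" for \<eta>
  proof -
    let ?a = "ev (za z) \<eta>" and ?b = "ev (zb z) \<eta>" and ?c = "ev (zc z) \<eta>" and ?q = "ev (zq z) \<eta>"
    let ?m = "(kap + \<mu>) * R + ev (zp z) \<eta>"
    let ?da = "(?q * ?c - zn z * ?b) / R\<^sup>2" and ?db = "(zn z * (R + ?a) - ?m * ?c) / R\<^sup>2"
      and ?dc = "(?m * ?b - ?q * (R + ?a)) / R\<^sup>2"
    have xv: "x = (\<lambda>\<eta>. vector [(R + ev (za z) \<eta>) * cos \<eta> - ev (zb z) \<eta> * sin \<eta>,
       (R + ev (za z) \<eta>) * sin \<eta> + ev (zb z) \<eta> * cos \<eta>, ev (zc z) \<eta>])"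
      by (auto simp: x frame_def vec3_simps algebra_simps)
    have "(x has_vector_derivative vector [?da * cos \<eta> - (R + ?a) * sin \<eta> - (?db * sin \<eta> + ?b * cos \<eta>),
       ?da * sin \<eta> + (R + ?a) * cos \<eta> + (?db * cos \<eta> - ?b * sin \<eta>), ?dc]) (at \<eta>)"
      unfolding xv
      by (rule has_vector_derivative_vector3) (auto intro!: derivative_eq_intros da db dc)
    moreover have "vector [?da * cos \<eta> - (R + ?a) * sin \<eta> - (?db * sin \<eta> + ?b * cos \<eta>),
       ?da * sin \<eta> + (R + ?a) * cos \<eta> + (?db * cos \<eta> - ?b * sin \<eta>), ?dc] = (1 / R\<^sup>2) *\<^sub>R cross3 (M \<eta>) (x \<eta>)"
    proof -
      have "(?m * cos \<eta> - ?q * sin \<eta>) * ((R + ?a) * sin \<eta> + ?b * cos \<eta>) - (?m * sin \<eta> + ?q * cos \<eta>) * ((R + ?a) * cos \<eta> - ?b * sin \<eta>)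
          = ?m * ?b - ?q * (R + ?a)"
        using sin_cos_squared_add3[of \<eta>] by algebra
      then show ?thesis
        using Rn by (simp add: xv M momentum_def vec3_simps) (simp add: field_simps power2_eq_square)
    qed
    ultimately show ?thesis by simp
  qed
  show M': "(M has_vector_derivative (kap + \<mu>) *\<^sub>R cross3 e3 (x \<eta>)) (at \<eta>)" for \<eta>
  proof -
    let ?a = "ev (za z) \<eta>" and ?b = "ev (zb z) \<eta>" and ?q = "ev (zq z) \<eta>" and ?p = "ev (zp z) \<eta>"
    have "(M has_vector_derivative vector [(?q - (kap + \<mu>) * ?b) * cos \<eta> - ((kap + \<mu>) * R + ?p) * sin \<eta> - (((kap + \<mu>) * ?a - ?p) * sin \<eta> + ?q * cos \<eta>),
       (?q - (kap + \<mu>) * ?b) * sin \<eta> + ((kap + \<mu>) * R + ?p) * cos \<eta> + (((kap + \<mu>) * ?a - ?p) * cos \<eta> - ?q * sin \<eta>), 0]) (at \<eta>)"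
      unfolding M momentum_def[abs_def]
      by (rule has_vector_derivative_vector3) (auto intro!: derivative_eq_intros dp dq)
    then show ?thesis
      by (rule has_vector_derivative_eq_rhs) (simp add: x frame_def vec3_simps algebra_simps)
  qed
  have const: "g \<eta> = g 0" if "\<And>\<eta>. (g has_real_derivative 0) (at \<eta>)" for g :: "real \<Rightarrow> real" and \<eta>
    using DERIV_isconst_all[of g \<eta> 0] that by blast
  have dx: "((\<lambda>\<eta>. x \<eta> \<bullet> x \<eta>) has_real_derivative 0) (at \<eta>)" for \<eta>
    using bounded_bilinear.has_vector_derivative[OF bounded_bilinear_inner x' x', of \<eta>]
    by (simp add: has_real_derivative_iff_has_vector_derivative dot_cross_self)
  have dMx: "((\<lambda>\<eta>. M \<eta> \<bullet> x \<eta>) has_real_derivative 0) (at \<eta>)" for \<eta>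
    using bounded_bilinear.has_vector_derivative[OF bounded_bilinear_inner M' x', of \<eta>]
    by (simp add: has_real_derivative_iff_has_vector_derivative dot_cross_self)
  have b0: "ev (zb z) 0 = 0" using rev by (auto simp: rev_state_def odd_per_def dest: spec[of _ 0])
  have "x 0 \<bullet> x 0 = R\<^sup>2"
    using f' by (simp add: x frame_def vec3_simps b0 algebra_simps power2_eq_square)
  then have "x \<eta> \<bullet> x \<eta> = R\<^sup>2" using const[OF dx] by metis
  then show "norm (x \<eta>) = R" using R by (simp add: norm_eq_sqrt_inner)
  have "M 0 \<bullet> x 0 = (kap + \<mu>) * R\<^sup>2"
  proof -
    have "M 0 \<bullet> x 0 = (kap + \<mu>) * R\<^sup>2 + ((kap + \<mu>) * R * ev (za z) 0 + R * ev (zp z) 0 + R\<^sup>2 * ev (zc z) 0 + ev (zp z) 0 * ev (za z) 0 + zn z * ev (zc z) 0)"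
      by (simp add: x M frame_def momentum_def vec3_simps b0 algebra_simps power2_eq_square)
    then show ?thesis using f' by simp
  qed
  then show "M \<eta> \<bullet> x \<eta> = (kap + \<mu>) * R\<^sup>2" using const[OF dMx] by metis
qed

text \<open>The linear bound on \<open>norm z\<close> transfers smallness in \<open>H2\<close> to
  the coordinates in which the uniqueness part of \<open>rev_branch\<close> is stated.\<close>

lemma system_imp_frame_sys:
  fixes w :: "(real^3) h2"
  assumes x: "x = (\<lambda>\<eta>. x0 R \<eta> + h2_fun w \<eta>)" and "w \<in> Y_rev"
    and M: "M = (\<lambda>\<eta>. cross3 (x \<eta>) (D1 x \<eta>) + (kap + \<mu>) *\<^sub>R x \<eta>)"
    and x': "\<And>\<eta>. (x has_vector_derivative (1 / R\<^sup>2) *\<^sub>R cross3 (M \<eta>) (x \<eta>)) (at \<eta>)"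
    and M': "\<And>\<eta>. (M has_vector_derivative (kap + \<mu>) *\<^sub>R cross3 e3 (x \<eta>)) (at \<eta>)"
    and nx: "\<And>\<eta>. norm (x \<eta>) = R" and Mx: "\<And>\<eta>. M \<eta> \<bullet> x \<eta> = (kap + \<mu>) * R\<^sup>2"
    and N: "norm w \<le> N" "N \<le> 1" "\<bar>\<mu>\<bar> \<le> kap"
  shows "\<exists>z. rev_state z \<and> frame_sys \<mu> z \<and> frame z = h2_fun w \<and>
    norm z \<le> 6 * (20 * R + 100 + 20 * kap + 10 * R + 10 * kap + 10) * N"
proof -
  interpret cross: bounded_bilinear cross3 by (rule bounded_bilinear_cross3)
  let ?u = "h2_fun w" and ?l = "kap + \<mu>"
  have Rn: "R \<noteq> 0" using R by simp
  have H: "H2 ?u" by (rule H2_h2_fun)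
  have per: "periodic ?u" "periodic (D1 ?u)" using H periodic_D1 by (auto simp: H2_def)
  have D1x: "D1 x \<eta> = R *\<^sub>R E2 \<eta> + D1 ?u \<eta>" for \<eta> unfolding x by (rule D1_x_of)
  have xper: "periodic x" "periodic M"
    using per periodic_x0 periodic_E2 by (simp_all add: M D1x periodic_def) (simp_all add: x)
  have xc: "continuous_on UNIV x" "continuous_on UNIV M"
    using has_vector_derivative_continuous[OF x'] has_vector_derivative_continuous[OF M']
    by (simp_all add: continuous_at_imp_continuous_on)
  have e: "E1 = x0 1" by (auto simp: vec3_simps)
  have E: "periodic E1" "periodic E2" "continuous_on UNIV E1" "continuous_on UNIV E2"
    "\<And>\<eta>. (E1 has_vector_derivative E2 \<eta>) (at \<eta>)" "\<And>\<eta>. (E2 has_vector_derivative - E1 \<eta>) (at \<eta>)"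
    using x0_derivs[of 1] by (simp_all add: e periodic_x0 periodic_E2 continuous_x0 continuous_E2)
  have dec: "v = (v \<bullet> E1 \<eta>) *\<^sub>R E1 \<eta> + (v \<bullet> E2 \<eta>) *\<^sub>R E2 \<eta> + (v \<bullet> e3) *\<^sub>R e3" for v \<eta>
  proof -
    have cc: "cos \<eta> * (cos \<eta> * r) = r - sin \<eta> * (sin \<eta> * r)" for r
      using sin_cos_squared_add3[of \<eta>] by algebra
    show ?thesis by (simp add: vec3_simps algebra_simps cc)
  qed
  have ortho: "E1 \<eta> \<bullet> E1 \<eta> = 1" "E2 \<eta> \<bullet> E2 \<eta> = 1" "e3 \<bullet> e3 = 1" "E1 \<eta> \<bullet> E2 \<eta> = 0" "E2 \<eta> \<bullet> E1 \<eta> = 0"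
    "E1 \<eta> \<bullet> e3 = 0" "E2 \<eta> \<bullet> e3 = 0" "e3 \<bullet> E1 \<eta> = 0" "e3 \<bullet> E2 \<eta> = 0" for \<eta>
    using sin_cos_squared_add3[of \<eta>] by (simp_all add: vec3_simps add.commute)
  have crossE: "cross3 (E1 \<eta>) (E2 \<eta>) = e3" "cross3 (E2 \<eta>) e3 = E1 \<eta>" "cross3 e3 (E1 \<eta>) = E2 \<eta>"
    "cross3 (E2 \<eta>) (E1 \<eta>) = - e3" "cross3 e3 (E2 \<eta>) = - E1 \<eta>" "cross3 (E1 \<eta>) e3 = - E2 \<eta>" for \<eta>
    by (simp_all add: vec3_simps add.commute) (use sin_cos_squared_add3[of \<eta>] in linarith)
  have x0E: "x0 R \<eta> = R *\<^sub>R E1 \<eta>" for \<eta> by (simp add: vec3_simps)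
  define A where "A \<eta> = ?u \<eta> \<bullet> E1 \<eta>" for \<eta>
  define B where "B \<eta> = ?u \<eta> \<bullet> E2 \<eta>" for \<eta>
  define C where "C \<eta> = ?u \<eta> \<bullet> e3" for \<eta>
  define P where "P \<eta> = M \<eta> \<bullet> E1 \<eta> - ?l * R" for \<eta>
  define Q where "Q \<eta> = M \<eta> \<bullet> E2 \<eta>" for \<eta>
  define n where "n = M 0 \<bullet> e3 - R\<^sup>2"
  have uc: "continuous_on UNIV ?u" by (rule H2_continuous[OF H])
  have mk: "ev (mkper A) = A" "ev (mkper B) = B" "ev (mkper C) = C" "ev (mkper P) = P" "ev (mkper Q) = Q"
    unfolding A_def[abs_def] B_def[abs_def] C_def[abs_def] P_def[abs_def] Q_def[abs_def]
    using per(1) xper(2) E(1,2)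
    by (auto simp: periodic_def intro!: ev_mkper continuous_on_inner continuous_on_diff continuous_on_const uc xc E(3,4))
  define z where "z = (n, mkper A, mkper P + R *\<^sub>R mkper C, mkper B, mkper C, kap *\<^sub>R mkper B - mkper Q)"
  have zz: "zn z = n" "ev (za z) = A" "ev (zb z) = B" "ev (zc z) = C" "ev (zp z) = P" "ev (zq z) = Q"
    by (auto simp: z_def zp_def zq_def mk)
  have M3: "M \<eta> \<bullet> e3 = R\<^sup>2 + n" for \<eta>
  proof -
    have "((\<lambda>\<eta>. M \<eta> \<bullet> e3) has_real_derivative 0) (at \<eta>)" for \<eta>
      using bounded_linear.has_vector_derivative[OF bounded_linear_inner_left M', of e3 \<eta>]
      by (simp add: has_real_derivative_iff_has_vector_derivative dot_cross_self inner_commute)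
    then have "M \<eta> \<bullet> e3 = M 0 \<bullet> e3" using DERIV_isconst_all[of "\<lambda>\<eta>. M \<eta> \<bullet> e3" \<eta> 0] by blast
    then show ?thesis by (simp add: n_def)
  qed
  have xdec: "x \<eta> = (R + A \<eta>) *\<^sub>R E1 \<eta> + B \<eta> *\<^sub>R E2 \<eta> + C \<eta> *\<^sub>R e3" for \<eta>
    unfolding x x0E A_def B_def C_def by (subst (1) dec[of "?u \<eta>" \<eta>]) (simp add: scaleR_add_left)
  have Mdec: "M \<eta> = (?l * R + P \<eta>) *\<^sub>R E1 \<eta> + Q \<eta> *\<^sub>R E2 \<eta> + (R\<^sup>2 + n) *\<^sub>R e3" for \<eta>
    unfolding P_def Q_def M3[of \<eta>, symmetric] by (subst (1) dec[of "M \<eta>" \<eta>]) simp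
  have MxE: "cross3 (M \<eta>) (x \<eta>) = (Q \<eta> * C \<eta> - (R\<^sup>2 + n) * B \<eta>) *\<^sub>R E1 \<eta>
      + ((R\<^sup>2 + n) * (R + A \<eta>) - (?l * R + P \<eta>) * C \<eta>) *\<^sub>R E2 \<eta>
      + ((?l * R + P \<eta>) * B \<eta> - Q \<eta> * (R + A \<eta>)) *\<^sub>R e3" for \<eta>
    unfolding Mdec[of \<eta>] xdec[of \<eta>]
    by (simp add: cross.add_left cross.add_right cross.scaleR_left cross.scaleR_right crossE algebra_simps)
  have exE: "cross3 e3 (x \<eta>) = (R + A \<eta>) *\<^sub>R E2 \<eta> - B \<eta> *\<^sub>R E1 \<eta>" for \<eta>
    unfolding xdec[of \<eta>] by (simp add: cross.add_right cross.scaleR_right crossE algebra_simps)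
  have u': "(?u has_vector_derivative ((1 / R\<^sup>2) *\<^sub>R cross3 (M \<eta>) (x \<eta>) - R *\<^sub>R E2 \<eta>)) (at \<eta>)" for \<eta>
    using has_vector_derivative_diff[OF x'[of \<eta>] x0_derivs(1)[of R \<eta>]] by (subst (asm) (1) x) simp
  have ip: "((\<lambda>\<eta>. f \<eta> \<bullet> g \<eta>) has_real_derivative (f \<eta> \<bullet> g' + f' \<bullet> g \<eta>)) (at \<eta>)"
    if "(f has_vector_derivative f') (at \<eta>)" "(g has_vector_derivative g') (at \<eta>)" for f g :: "real \<Rightarrow> real^3" and f' g' \<eta>
    using bounded_bilinear.has_vector_derivative[OF bounded_bilinear_inner that]
    by (simp add: has_real_derivative_iff_has_vector_derivative)
  have dA: "(A has_real_derivative (Q \<eta> * C \<eta> - n * B \<eta>) / R\<^sup>2) (at \<eta>)" for \<eta>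
    unfolding A_def[abs_def]
    by (rule DERIV_cong[OF ip[OF u' E(5)]])
       (use Rn in \<open>simp add: MxE inner_add_left inner_diff_left ortho B_def[symmetric] field_simps\<close>)
  have dB: "(B has_real_derivative (n * (R + A \<eta>) - (?l * R + P \<eta>) * C \<eta>) / R\<^sup>2) (at \<eta>)" for \<eta>
    unfolding B_def[abs_def]
    by (rule DERIV_cong[OF ip[OF u' E(6)]])
       (use Rn in \<open>simp add: MxE inner_add_left inner_diff_left ortho A_def[symmetric] field_simps power2_eq_square\<close>)
  have dC: "(C has_real_derivative ((?l * R + P \<eta>) * B \<eta> - Q \<eta> * (R + A \<eta>)) / R\<^sup>2) (at \<eta>)" for \<eta>
    unfolding C_def[abs_def]
    by (rule DERIV_cong[OF ip[OF u' has_vector_derivative_const]])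
       (use Rn in \<open>simp add: MxE inner_add_left inner_diff_left ortho field_simps\<close>)
  have dP: "(P has_real_derivative Q \<eta> - ?l * B \<eta>) (at \<eta>)" for \<eta>
    unfolding P_def[abs_def]
    by (rule DERIV_cong[OF DERIV_diff[OF ip[OF M' E(5)] DERIV_const]])
       (simp add: exE inner_diff_left ortho Q_def)
  have dQ: "(Q has_real_derivative ?l * A \<eta> - P \<eta>) (at \<eta>)" for \<eta>
    unfolding Q_def[abs_def]
    by (rule DERIV_cong[OF ip[OF M' E(6)]])
       (simp add: exE inner_diff_left ortho P_def algebra_simps)
  note r = Y_rev_refl(1,2)[OF \<open>w \<in> Y_rev\<close>]
  have xr: "x (- \<eta>) = S_refl (x \<eta>)" for \<eta> by (simp add: x r S_refl_frame S_refl_linear)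
  have Mr: "M (- \<eta>) = S_refl (M \<eta>)" for \<eta>
  proof -
    have "D1 x (- \<eta>) = - S_refl (D1 x \<eta>)" by (simp add: D1x r S_refl_frame S_refl_linear)
    then show ?thesis by (simp add: M xr S_refl_cross S_refl_linear)
  qed
  have Se3: "S_refl v \<bullet> e3 = v \<bullet> e3" for v by (simp add: vec3_simps)
  have par: "A (- \<eta>) = A \<eta>" "B (- \<eta>) = - B \<eta>" "C (- \<eta>) = C \<eta>" "P (- \<eta>) = P \<eta>" "Q (- \<eta>) = - Q \<eta>" for \<eta>
    by (simp_all add: A_def B_def C_def P_def Q_def r Mr S_refl_frame S_refl_inner Se3)
  have rev: "rev_state z"
    by (simp add: rev_state_def z_def even_per_def odd_per_def mk par)
  have b0: "B 0 = 0" using par(2)[of 0] by simp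
  have q0: "Q 0 = 0" using par(5)[of 0] by simp
  have x00: "x 0 \<bullet> x 0 = (R + A 0) * (R + A 0) + C 0 * C 0"
    unfolding xdec[of 0] by (simp add: b0 inner_add_left inner_add_right ortho)
  have "x 0 \<bullet> x 0 = R * R" using nx[of 0] by (simp add: norm_eq_sqrt_inner) (metis inner_ge_zero real_sqrt_pow2 power2_eq_square)
  then have i1: "R * A 0 = - (A 0 * A 0 + C 0 * C 0) / 2"
    using x00 by (simp add: algebra_simps)
  have i2: "?l * R * A 0 + R * P 0 + R\<^sup>2 * C 0 + P 0 * A 0 + n * C 0 = 0"
  proof -
    have "M 0 \<bullet> x 0 = (?l * R + P 0) * (R + A 0) + (R\<^sup>2 + n) * C 0"
      unfolding xdec[of 0] Mdec[of 0] by (simp add: b0 q0 inner_add_left inner_add_right ortho)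
    then show ?thesis using Mx[of 0] by (simp add: power2_eq_square algebra_simps)
  qed
  have sys: "frame_sys \<mu> z"
    unfolding frame_sys_def zz using dA dB dC dP dQ i1 i2 by blast
  have fr: "frame z = ?u"
  proof
    fix \<eta>
    have "frame z \<eta> = A \<eta> *\<^sub>R E1 \<eta> + B \<eta> *\<^sub>R E2 \<eta> + C \<eta> *\<^sub>R e3"
      by (simp add: frame_def zz vec3_simps)
    then show "frame z \<eta> = ?u \<eta>" unfolding A_def B_def C_def dec[of "?u \<eta>" \<eta>, symmetric] .
  qed
  have N0: "N \<ge> 0" using N(1) norm_ge_zero order_trans by blast
  have un: "norm (?u \<eta>) \<le> 10 * N" "norm (D1 ?u \<eta>) \<le> 10 * N" for \<eta>
    using h2_sup_le[of w \<eta>] N(1) by auto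
  have nE: "norm (E1 \<eta>) = 1" "norm (E2 \<eta>) = 1" "norm e3 = 1" for \<eta>
    by (simp_all add: norm_eq_sqrt_inner ortho)
  \<comment> \<open>Below, \<open>m\<close> is \<open>M\<close> minus its value at
    \<open>u = 0\<close>. With the sup bound \<open>10 * N\<close> for \<open>u\<close> and
    \<open>u'\<close>, the terms of \<open>K0\<close> come from the two products of
    \<open>u'\<close> and \<open>u\<close> with the basic circle, from \<open>u \<times> u'\<close>
    using \<open>N \<le> 1\<close>, and from \<open>\<lambda> u\<close> using
    \<open>\<bar>\<lambda>\<bar> \<le> 2 * kap\<close>.\<close>
  define K0 where "K0 = 20 * R + 100 + 20 * kap"
  define m where "m \<eta> = M \<eta> - ?l *\<^sub>R x0 R \<eta> - R\<^sup>2 *\<^sub>R e3" for \<eta>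
  have mK: "norm (m \<eta>) \<le> K0 * N" for \<eta>
  proof -
    note nc = norm_cross_le
    have "m \<eta> = R *\<^sub>R cross3 (E1 \<eta>) (D1 ?u \<eta>) + R *\<^sub>R cross3 (?u \<eta>) (E2 \<eta>) + cross3 (?u \<eta>) (D1 ?u \<eta>) + ?l *\<^sub>R ?u \<eta>"
      unfolding m_def M D1x
      by (simp add: x x0E cross.add_left cross.add_right cross.scaleR_left cross.scaleR_right crossE power2_eq_square algebra_simps)
    also have "norm \<dots> \<le> R * (10 * N) + R * (10 * N) + 10 * N * 10 + 2 * kap * (10 * N)"
    proof (intro norm_triangle_le add_mono)
      show "norm (R *\<^sub>R cross3 (E1 \<eta>) (D1 ?u \<eta>)) \<le> R * (10 * N)"
        using R order_trans[OF nc[of "E1 \<eta>" "D1 ?u \<eta>"]] un(2)[of \<eta>] by (simp add: nE)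
      show "norm (R *\<^sub>R cross3 (?u \<eta>) (E2 \<eta>)) \<le> R * (10 * N)"
        using R order_trans[OF nc[of "?u \<eta>" "E2 \<eta>"]] un(1)[of \<eta>] by (simp add: nE)
      show "norm (cross3 (?u \<eta>) (D1 ?u \<eta>)) \<le> 10 * N * 10"
        by (rule order_trans[OF nc mult_mono]) (use un[of \<eta>] N N0 in auto)
      show "norm (?l *\<^sub>R ?u \<eta>) \<le> 2 * kap * (10 * N)"
        unfolding norm_scaleR by (rule mult_mono) (use un[of \<eta>] N kap_pos in auto)
    qed
    finally show ?thesis by (simp add: K0_def algebra_simps)
  qed
  have K0: "K0 > 0" using R kap_pos by (simp add: K0_def add_pos_pos)
  have ipb: "\<bar>v \<bullet> e\<bar> \<le> c" if "norm v \<le> c" "norm e = 1" for v e :: "real^3" and c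
    using Cauchy_Schwarz_ineq2[of v e] that by simp
  have Pm: "P \<eta> = m \<eta> \<bullet> E1 \<eta>" "Q \<eta> = m \<eta> \<bullet> E2 \<eta>" "n = m 0 \<bullet> e3" for \<eta>
    by (simp_all add: P_def Q_def n_def m_def x0E inner_diff_left ortho)
  \<comment> \<open>A common bound for all components of \<open>z\<close>; there are six of them,
    hence the factor 6 in the conclusion.\<close>
  define T where "T = K0 + 10 * R + 10 * kap + 10"
  have T: "K0 \<le> T" "10 \<le> T" "K0 + R * 10 \<le> T" "kap * 10 + K0 \<le> T"
    using K0 R kap_pos by (auto simp: T_def)
  have bnds: "\<bar>A \<eta>\<bar> \<le> 10 * N" "\<bar>B \<eta>\<bar> \<le> 10 * N" "\<bar>C \<eta>\<bar> \<le> 10 * N" "\<bar>P \<eta>\<bar> \<le> K0 * N" "\<bar>Q \<eta>\<bar> \<le> K0 * N" for \<eta>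
    unfolding A_def B_def C_def Pm by (intro ipb un mK nE)+
  have nn: "norm n \<le> T * N"
    using order_trans[OF ipb[OF mK nE(3), of 0] mult_right_mono[OF T(1) N0]] by (simp add: Pm)
  have nABC: "norm (mkper A) \<le> T * N" "norm (mkper B) \<le> T * N" "norm (mkper C) \<le> T * N"
    using order_trans[OF bnds(1) mult_right_mono[OF T(2) N0]] order_trans[OF bnds(2) mult_right_mono[OF T(2) N0]]
      order_trans[OF bnds(3) mult_right_mono[OF T(2) N0]]
    by (auto intro!: norm_per_le simp: mk)
  have nP: "norm (mkper P + R *\<^sub>R mkper C) \<le> T * N"
  proof (rule norm_per_le)
    fix \<eta>
    have "\<bar>P \<eta> + R * C \<eta>\<bar> \<le> K0 * N + R * (10 * N)"
      using bnds(3,4)[of \<eta>] R by (intro order_trans[OF abs_triangle_ineq] add_mono) (auto simp: abs_mult)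
    also have "\<dots> = (K0 + R * 10) * N" by (simp add: algebra_simps)
    also have "\<dots> \<le> T * N" by (rule mult_right_mono[OF T(3) N0])
    finally show "\<bar>ev (mkper P + R *\<^sub>R mkper C) \<eta>\<bar> \<le> T * N" by (simp add: mk)
  qed
  have nQ: "norm (kap *\<^sub>R mkper B - mkper Q) \<le> T * N"
  proof (rule norm_per_le)
    fix \<eta>
    have "\<bar>kap * B \<eta> - Q \<eta>\<bar> \<le> kap * (10 * N) + K0 * N"
      using bnds(2,5)[of \<eta>] kap_pos by (intro order_trans[OF abs_triangle_ineq4] add_mono) (auto simp: abs_mult)
    also have "\<dots> = (kap * 10 + K0) * N" by (simp add: algebra_simps)
    also have "\<dots> \<le> T * N" by (rule mult_right_mono[OF T(4) N0])
    finally show "\<bar>ev (kap *\<^sub>R mkper B - mkper Q) \<eta>\<bar> \<le> T * N" by (simp add: mk)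
  qed
  have tup: "norm (a, b, c, d, e, f) \<le> norm a + norm b + norm c + norm d + norm e + norm f"
    for a :: real and b c d e f :: per
    using norm_Pair_le[of a "(b, c, d, e, f)"] norm_Pair_le[of b "(c, d, e, f)"] norm_Pair_le[of c "(d, e, f)"]
      norm_Pair_le[of d "(e, f)"] norm_Pair_le[of e f] by linarith
  have "norm z \<le> 6 * (T * N)"
    using tup[of n "mkper A" "mkper P + R *\<^sub>R mkper C" "mkper B" "mkper C" "kap *\<^sub>R mkper B - mkper Q"] nn nABC nP nQ
    unfolding z_def by linarith
  then have "norm z \<le> 6 * (20 * R + 100 + 20 * kap + 10 * R + 10 * kap + 10) * N"
    by (simp add: T_def K0_def algebra_simps)
  then show ?thesis using rev sys fr by blast
qed

end

section \<open>From frame coordinates to \<open>H\<^sup>2\<close>\<close>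

text \<open>Three squares over a period of length \<open>2 * pi\<close> give
  \<open>6 * pi * b^2\<close>, and \<open>6 * pi < 25\<close>.\<close>

lemma norm_h2_le:
  fixes u :: "'a::euclidean_space h2"
  assumes "\<And>x. norm (h2_fun u x) \<le> b" "\<And>x. norm (D1 (h2_fun u) x) \<le> b" "\<And>x. norm (D2 (h2_fun u) x) \<le> b"
  shows "norm u \<le> 5 * b"
proof -
  let ?u = "h2_fun u"
  let ?g = "\<lambda>x. ?u x \<bullet> ?u x + D1 ?u x \<bullet> D1 ?u x + D2 ?u x \<bullet> D2 ?u x"
  have H: "H2 ?u" by (rule H2_h2_fun)
  have b: "b \<ge> 0" using order_trans[OF norm_ge_zero assms(1)] .
  have "(norm u)\<^sup>2 = u \<bullet> u" by (simp add: power2_norm_eq_inner)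
  also have "\<dots> = integral {0..2*pi} ?g"
    unfolding inner_h2.rep_eq using set_lebesgue_integral_eq_integral(2)[OF inner_h2_integrable[OF H H]] by simp
  also have "\<dots> \<le> integral {0..2*pi} (\<lambda>x. 3 * b\<^sup>2)"
  proof (rule integral_le)
    show "?g integrable_on {0..2*pi}"
      using set_lebesgue_integral_eq_integral(1)[OF inner_h2_integrable[OF H H]] .
    show "?g x \<le> 3 * b\<^sup>2" for x
      using power_mono[OF assms(1)[of x], of 2] power_mono[OF assms(2)[of x], of 2] power_mono[OF assms(3)[of x], of 2]
      by (simp add: power2_norm_eq_inner)
  qed (rule integrable_const_ivl)
  also have "\<dots> = 6 * pi * b\<^sup>2" by simp
  also have "\<dots> \<le> 25 * b\<^sup>2" using pi_less_4 by (intro mult_right_mono) auto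
  finally have "(norm u)\<^sup>2 \<le> (5 * b)\<^sup>2" by (simp add: power_mult_distrib)
  then show ?thesis by (rule power2_le_imp_le) (use b in simp)
qed

definition vec3p :: "per \<Rightarrow> per \<Rightarrow> per \<Rightarrow> real \<Rightarrow> real^3" where
  "vec3p f g h \<eta> = vector [ev f \<eta>, ev g \<eta>, ev h \<eta>]"

lemma vec3p_deriv:
  assumes "pderiv_per f f'" "pderiv_per g g'" "pderiv_per h h'"
  shows "(vec3p f g h has_vector_derivative vec3p f' g' h' \<eta>) (at \<eta>)"
  unfolding vec3p_def[abs_def]
  by (rule has_vector_derivative_vector3) (use assms in \<open>auto simp: pderiv_per_def\<close>)

lemma C2_vec3p:
  assumes "pderiv_per f f'" "pderiv_per g g'" "pderiv_per h h'"
    "pderiv_per f' f''" "pderiv_per g' g''" "pderiv_per h' h''"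
  shows "H2 (vec3p f g h)" "D1 (vec3p f g h) = vec3p f' g' h'" "D2 (vec3p f g h) = vec3p f'' g'' h''"
proof -
  note d = vec3p_deriv[OF assms(1-3)] vec3p_deriv[OF assms(4-6)]
  have e: "vec3p f'' g'' h'' = (\<lambda>\<eta>. ev f'' \<eta> *\<^sub>R (vector [1, 0, 0] :: real^3) + ev g'' \<eta> *\<^sub>R vector [0, 1, 0] + ev h'' \<eta> *\<^sub>R vector [0, 0, 1])"
    by (auto simp: vec3p_def vec3_simps)
  have "continuous_on UNIV (vec3p f'' g'' h'')"
    unfolding e by (intro continuous_intros)
  moreover have "periodic (vec3p f g h)"
    using periodic_ev[of f] periodic_ev[of g] periodic_ev[of h] by (simp add: periodic_def vec3p_def)
  ultimately show "H2 (vec3p f g h)" using d by (intro H2_C2[where f' = "vec3p f' g' h'" and f'' = "vec3p f'' g'' h''"])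
  show 1: "D1 (vec3p f g h) = vec3p f' g' h'" by (rule ext, rule D1_eqI[OF d(1)])
  show "D2 (vec3p f g h) = vec3p f'' g'' h''" unfolding D2_def 1 by (rule ext, rule D1_eqI[OF d(2)])
qed

lemma norm_vec3p_le: "norm (vec3p f g h \<eta>) \<le> norm f + norm g + norm h"
proof -
  have "norm (vec3p f g h \<eta>) \<le> \<bar>ev f \<eta>\<bar> + \<bar>ev g \<eta>\<bar> + \<bar>ev h \<eta>\<bar>"
    using norm_le_l1_cart[of "vec3p f g h \<eta>"] by (simp add: vec3p_def sum_3)
  then show ?thesis using abs_ev_le[of f \<eta>] abs_ev_le[of g \<eta>] abs_ev_le[of h \<eta>] by linarith
qed

text \<open>A \<open>C\<^sup>2\<close> function is recovered continuously from its mean and its second derivative.\<close>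

definition prim2 :: "real \<times> per \<Rightarrow> per" where
  "prim2 q = fst q *\<^sub>R 1 + J (J (snd q))"

lemma bounded_linear_prim2: "bounded_linear prim2"
  unfolding prim2_def[abs_def]
  by (intro per_linear_intros bounded_linear_fst bounded_linear_snd)

lemma pderiv_prim2: "pderiv_per (prim2 q) (J (snd q))"
  unfolding prim2_def
  by (rule pderiv_per_rhs, (rule pderiv_per_intros pderiv_J)+) simp

lemma prim2_eq:
  assumes "pderiv_per f f'" "pderiv_per f' f''"
  shows "prim2 (mean f, f'') = f"
  using J_pderiv[OF assms(1)] J_pderiv[OF assms(2)] mean_pderiv[OF assms(1)] by (simp add: prim2_def)

text \<open>Defined for every choice of means and second derivatives, so that it is a bounded linear
  map into \<open>H2\<close> and preserves smoothness of curves.\<close>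

definition lift3 :: "(real \<times> per) \<times> (real \<times> per) \<times> (real \<times> per) \<Rightarrow> (real^3) h2" where
  "lift3 p = Abs_h2 (vec3p (prim2 (fst p)) (prim2 (fst (snd p))) (prim2 (snd (snd p))))"

lemma h2_fun_lift3:
  "h2_fun (lift3 p) = vec3p (prim2 (fst p)) (prim2 (fst (snd p))) (prim2 (snd (snd p)))"
  unfolding lift3_def by (rule Abs_h2_inverse) (auto intro: C2_vec3p(1) pderiv_prim2 pderiv_J)

lemma vec3p_linear: "vec3p (f + f') (g + g') (h + h') \<eta> = vec3p f g h \<eta> + vec3p f' g' h' \<eta>"
  "vec3p (c *\<^sub>R f) (c *\<^sub>R g) (c *\<^sub>R h) \<eta> = c *\<^sub>R vec3p f g h \<eta>"
  by (simp_all add: vec3p_def vec3_eq)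

lemma norm_fst_snd_le: "norm (fst p) \<le> norm p" "norm (snd p) \<le> norm p"
  by (cases p; simp add: norm_fst_le norm_snd_le)+

lemma bounded_linear_lift3: "bounded_linear lift3"
proof -
  interpret p: bounded_linear prim2 by (rule bounded_linear_prim2)
  obtain K1 where K1: "\<And>q. norm (prim2 q) \<le> norm q * K1" "K1 > 0" using p.pos_bounded by auto
  have "bounded_linear (\<lambda>q :: real \<times> per. J (snd q))" by (intro per_linear_intros bounded_linear_snd)
  then obtain K2 where K2: "\<And>q :: real \<times> per. norm (J (snd q)) \<le> norm q * K2" "K2 > 0"
    using bounded_linear.pos_bounded by blast
  have "bounded_linear (\<lambda>q :: real \<times> per. snd q - mean (snd q) *\<^sub>R 1)" by (intro per_linear_intros bounded_linear_snd)
  then obtain K3 where K3: "\<And>q :: real \<times> per. norm (snd q - mean (snd q) *\<^sub>R 1) \<le> norm q * K3" "K3 > 0"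
    using bounded_linear.pos_bounded by blast
  define K where "K = K1 + K2 + K3"
  have K: "norm (prim2 q) \<le> norm q * K" "norm (J (snd q)) \<le> norm q * K" "norm (snd q - mean (snd q) *\<^sub>R 1) \<le> norm q * K" for q
    using order_trans[OF K1(1)[of q] mult_left_mono[of K1 K "norm q"]] order_trans[OF K2(1)[of q] mult_left_mono[of K2 K "norm q"]]
      order_trans[OF K3(1)[of q] mult_left_mono[of K3 K "norm q"]] K1(2) K2(2) K3(2) by (auto simp: K_def)
  have K0: "K \<ge> 0" using K1 K2 K3 by (simp add: K_def)
  show ?thesis
  proof (rule bounded_linear_intro)
    show "lift3 (p + q) = lift3 p + lift3 q" for p q
      by (rule h2_fun_inject[THEN iffD1], rule ext) (simp add: h2_fun_lift3 plus_h2.rep_eq p.add vec3p_linear)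
    show "lift3 (c *\<^sub>R p) = c *\<^sub>R lift3 p" for c p
      by (rule h2_fun_inject[THEN iffD1], rule ext) (simp add: h2_fun_lift3 scaleR_h2.rep_eq p.scaleR vec3p_linear)
    fix p :: "(real \<times> per) \<times> (real \<times> per) \<times> (real \<times> per)"
    let ?q1 = "fst p" and ?q2 = "fst (snd p)" and ?q3 = "snd (snd p)"
    have q: "norm ?q1 \<le> norm p" "norm ?q2 \<le> norm p" "norm ?q3 \<le> norm p"
      using norm_fst_snd_le[of p] norm_fst_snd_le[of "snd p"] by linarith+
    have b: "norm (vec3p f g h x) \<le> 3 * (norm p * K)"
      if "norm f \<le> norm ?q1 * K" "norm g \<le> norm ?q2 * K" "norm h \<le> norm ?q3 * K" for f g h x
      using norm_vec3p_le[of f g h x] that q[THEN mult_right_mono, OF K0] by linarith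
    note C = C2_vec3p[OF pderiv_prim2[of ?q1] pderiv_prim2[of ?q2] pderiv_prim2[of ?q3] pderiv_J pderiv_J pderiv_J]
    have "norm (lift3 p) \<le> 5 * (3 * (norm p * K))"
      by (rule norm_h2_le; unfold h2_fun_lift3 C(2,3); intro b K)
    then show "norm (lift3 p) \<le> norm p * (15 * K)" by (simp add: mult_ac)
  qed
qed

lemma mean_by_parts:
  assumes "pderiv_per f f'" "pderiv_per g g'"
  shows "mean (f' * g) = - mean (f * g')"
  using mean_pderiv[OF pderiv_per_intros(5)[OF assms]] by simp

text \<open>Integrating the first order terms by parts once and the second order terms twice gives
  \<open>\<integral> u \<cdot> (v - v'' + v'''')\<close>. The smooth factor carries all derivatives,
  so the result is continuous in \<open>u\<close> for the sup norm.\<close>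

lemma inner_h2_vec3p:
  assumes u: "h2_fun u = vec3p f1 f2 f3" and v: "h2_fun v = vec3p g1 g2 g3"
    and f: "pderiv_per f1 f1'" "pderiv_per f2 f2'" "pderiv_per f3 f3'"
      "pderiv_per f1' f1''" "pderiv_per f2' f2''" "pderiv_per f3' f3''"
    and g1: "pderiv_per g1 a1" "pderiv_per a1 b1" "pderiv_per b1 c1" "pderiv_per c1 h1"
    and g2: "pderiv_per g2 a2" "pderiv_per a2 b2" "pderiv_per b2 c2" "pderiv_per c2 h2"
    and g3: "pderiv_per g3 a3" "pderiv_per a3 b3" "pderiv_per b3 c3" "pderiv_per c3 h3"
  shows "u \<bullet> v = 2 * pi * mean (f1 * (g1 - b1 + h1) + f2 * (g2 - b2 + h2) + f3 * (g3 - b3 + h3))"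
proof -
  define X where "X = (f1 * g1 + f2 * g2 + f3 * g3) + (f1' * a1 + f2' * a2 + f3' * a3) + (f1'' * b1 + f2'' * b2 + f3'' * b3)"
  have Hu: "H2 (h2_fun u)" "H2 (h2_fun v)" by (rule H2_h2_fun)+
  note D = C2_vec3p[OF f] C2_vec3p[OF g1(1) g2(1) g3(1) g1(2) g2(2) g3(2)]
  have "u \<bullet> v = integral {0..2*pi} (\<lambda>x. h2_fun u x \<bullet> h2_fun v x + D1 (h2_fun u) x \<bullet> D1 (h2_fun v) x + D2 (h2_fun u) x \<bullet> D2 (h2_fun v) x)"
    unfolding inner_h2.rep_eq using set_lebesgue_integral_eq_integral(2)[OF inner_h2_integrable[OF Hu]] by simp
  also have "\<dots> = integral {0..2*pi} (ev X)"
    unfolding u v D by (rule integral_cong) (simp add: X_def vec3p_def inner3)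
  also have "\<dots> = 2 * pi * mean X" by (simp add: mean_def)
  also have "mean X = mean (f1 * (g1 - b1 + h1) + f2 * (g2 - b2 + h2) + f3 * (g3 - b3 + h3))"
    by (simp add: X_def distrib_left right_diff_distrib
        mean_by_parts[OF f(1) g1(2)] mean_by_parts[OF f(2) g2(2)] mean_by_parts[OF f(3) g3(2)]
        mean_by_parts[OF f(4) g1(3)] mean_by_parts[OF f(5) g2(3)] mean_by_parts[OF f(6) g3(3)]
        mean_by_parts[OF f(1) g1(4)] mean_by_parts[OF f(2) g2(4)] mean_by_parts[OF f(3) g3(4)])
  finally show ?thesis .
qed

section \<open>Derivatives of states and their reconstruction in \<open>H2\<close>\<close>

definition pder_state :: "state \<Rightarrow> state \<Rightarrow> bool" where
  "pder_state z z' \<longleftrightarrow> zn z' = 0 \<and> pderiv_per (za z) (za z') \<and> pderiv_per (zs z) (zs z') \<and>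
     pderiv_per (zb z) (zb z') \<and> pderiv_per (zc z) (zc z') \<and> pderiv_per (zy z) (zy z')"

definition pder_data :: "data \<Rightarrow> data \<Rightarrow> bool" where
  "pder_data d d' \<longleftrightarrow> pderiv_per (d1 d) (d1 d') \<and> pderiv_per (d2 d) (d2 d') \<and>
     pderiv_per (d3 d) (d3 d') \<and> pderiv_per (d4 d) (d4 d') \<and> pderiv_per (d5 d) (d5 d')"

lemma pder_linear:
  "pder_state z z' \<Longrightarrow> pder_state w w' \<Longrightarrow> pder_state (z + w) (z' + w')"
  "pder_data d d' \<Longrightarrow> pder_data e e' \<Longrightarrow> pder_data (d + e) (d' + e')"
  "pder_data d d' \<Longrightarrow> pder_data (t *\<^sub>R d) (t *\<^sub>R d')"
  by (auto simp: pder_state_def pder_data_def intro!: pderiv_per_intros)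

definition cart1 :: "state \<Rightarrow> per" where "cart1 z = cosp 1 * za z - sinp 1 * zb z"
definition cart2 :: "state \<Rightarrow> per" where "cart2 z = sinp 1 * za z + cosp 1 * zb z"

lemma pderiv_cart:
  assumes "pder_state z z'"
  shows "pderiv_per (cart1 z) (cart1 z' - cart2 z)" "pderiv_per (cart2 z) (cart2 z' + cart1 z)"
proof -
  have z: "pderiv_per (za z) (za z')" "pderiv_per (zb z) (zb z')" using assms by (auto simp: pder_state_def)
  show "pderiv_per (cart1 z) (cart1 z' - cart2 z)" "pderiv_per (cart2 z) (cart2 z' + cart1 z)"
    unfolding cart1_def cart2_def
    by (rule pderiv_per_rhs, (rule pderiv_per_intros pderiv_sinp pderiv_cosp z)+, rule per_eqI, simp)+
qed

text \<open>Applied to a state and its first two derivatives. The lower order terms in the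
  horizontal components come from differentiating the rotating frame twice. The formula is linear in
  the triple and makes sense even if the entries are not derivatives of each other.\<close>

definition lift_state :: "state \<times> state \<times> state \<Rightarrow> (real^3) h2" where
  "lift_state q = lift3 (
     (mean (cart1 (fst q)), cart1 (snd (snd q)) - 2 *\<^sub>R cart2 (fst (snd q)) - cart1 (fst q)),
     (mean (cart2 (fst q)), cart2 (snd (snd q)) + 2 *\<^sub>R cart1 (fst (snd q)) - cart2 (fst q)),
     (mean (zc (fst q)), zc (snd (snd q))))"

lemma bounded_linear_lift_state: "bounded_linear lift_state"
proof -
  have c: "bounded_linear cart1" "bounded_linear cart2"
    unfolding cart1_def[abs_def] cart2_def[abs_def] by (intro per_linear_intros)+
  note i = bounded_linear_fst bounded_linear_snd bounded_linear_fst_comp bounded_linear_snd_comp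
    c[THEN bounded_linear_compose]
  show ?thesis
    unfolding lift_state_def[abs_def]
    by (intro bounded_linear_compose[OF bounded_linear_lift3]) (intro i per_linear_intros)
qed

section \<open>The bifurcating curve\<close>

lemma smooth_curve_on_subset: "smooth_curve_on I f \<Longrightarrow> I' \<subseteq> I \<Longrightarrow> smooth_curve_on I' f"
  unfolding smooth_curve_on_def by blast

lemma smooth_curve_on_imp_differentiable:
  assumes "smooth_curve_on I f" "t \<in> I" "open I"
  obtains f' where "(f has_vector_derivative f') (at t)"
  using Cn_on_if_smooth_curve_on[OF assms(1,3), of 1] assms(2) by auto

context mode
begin

lemma frame_vec3p: "frame z = vec3p (cart1 z) (cart2 z) (zc z)"
  by (rule ext) (simp add: frame_def vec3p_def cart1_def cart2_def mult.commute)

lemma frame_linear: "frame (z + w) \<eta> = frame z \<eta> + frame w \<eta>" "frame (t *\<^sub>R z) \<eta> = t *\<^sub>R frame z \<eta>"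
  "frame 0 \<eta> = 0"
  by (simp_all add: frame_def vec3_eq algebra_simps)

lemma frame_V: "frame V = h2_fun (v_k k)"
  by (rule ext) (simp add: frame_def V_def v_k.rep_eq vec3_simps kp_def)

lemma lift_state_frame:
  assumes "pder_state z z'" "pder_state z' z''"
  shows "h2_fun (lift_state (z, z', z'')) = frame z"
proof -
  have c: "pderiv_per (cart1 z' - cart2 z) (cart1 z'' - 2 *\<^sub>R cart2 z' - cart1 z)"
    "pderiv_per (cart2 z' + cart1 z) (cart2 z'' + 2 *\<^sub>R cart1 z' - cart2 z)"
    by (rule pderiv_per_rhs, (rule pderiv_per_intros pderiv_cart[OF assms(1)] pderiv_cart[OF assms(2)])+, simp add: scaleR_2)+
  have z: "pderiv_per (zc z) (zc z')" "pderiv_per (zc z') (zc z'')"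
    using assms by (auto simp: pder_state_def)
  show ?thesis
    unfolding lift_state_def h2_fun_lift3 frame_vec3p fst_conv snd_conv
      prim2_eq[OF pderiv_cart(1)[OF assms(1)] c(1)] prim2_eq[OF pderiv_cart(2)[OF assms(1)] c(2)]
      prim2_eq[OF z] ..
qed

lemma inner_v_k:
  assumes u: "h2_fun u = frame z" and z: "pder_state z z'" "pder_state z' z''"
  shows "u \<bullet> v_k k = 2 * pi * ell z"
proof -
  have c: "pderiv_per (cart1 z' - cart2 z) (cart1 z'' - 2 *\<^sub>R cart2 z' - cart1 z)"
    "pderiv_per (cart2 z' + cart1 z) (cart2 z'' + 2 *\<^sub>R cart1 z' - cart2 z)"
    by (rule pderiv_per_rhs, (rule pderiv_per_intros pderiv_cart[OF z(1)] pderiv_cart[OF z(2)])+, simp add: scaleR_2)+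
  have zc: "pderiv_per (zc z) (zc z')" "pderiv_per (zc z') (zc z'')"
    using z by (auto simp: pder_state_def)
  \<comment> \<open>Differentiation maps the span of \<open>e1\<close>, \<open>e2\<close> to that of
    \<open>h1\<close>, \<open>h2\<close> and back, and these spans contain the two horizontal
    components of \<open>v_k\<close>. Four derivatives thus reduce to arithmetic with
    coefficients.\<close>
  define e1 e2 h1 h2 where "e1 = sinp k * sinp 1" and "e2 = cosp k * cosp 1"
    and "h1 = sinp k * cosp 1" and "h2 = cosp k * sinp 1"
  let ?k = "real k"
  note defs = e1_def e2_def h1_def h2_def
  have e: "pderiv_per e1 (?k *\<^sub>R h2 + h1)" "pderiv_per e2 (- ?k *\<^sub>R h1 - h2)"
    "pderiv_per h1 (?k *\<^sub>R e2 - e1)" "pderiv_per h2 (- ?k *\<^sub>R e1 + e2)"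
    unfolding defs
    by (rule pderiv_per_rhs, (rule pderiv_per_intros pderiv_sinp pderiv_cosp)+, rule per_eqI, simp)+
  let ?A = "?k\<^sup>2 + 1" and ?B = "2 * ?k"
  have lin: "pderiv_per (\<alpha> *\<^sub>R e1 + \<beta> *\<^sub>R e2) ((\<alpha> - \<beta> * ?k) *\<^sub>R h1 + (\<alpha> * ?k - \<beta>) *\<^sub>R h2)"
    "pderiv_per (\<alpha> *\<^sub>R h1 + \<beta> *\<^sub>R h2) ((- \<alpha> - \<beta> * ?k) *\<^sub>R e1 + (\<alpha> * ?k + \<beta>) *\<^sub>R e2)" for \<alpha> \<beta>
    by (rule pderiv_per_rhs, (rule pderiv_per_intros e)+, rule per_eqI, simp add: algebra_simps)+
  let ?al = "4 * ?k ^ 3 + 6 * ?k" and ?be = "?k ^ 4 + 7 * ?k\<^sup>2 + 3" and ?ga = "kp * (1 + ?k\<^sup>2 + ?k ^ 4)"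
  have g1: "cart1 V = (-1) *\<^sub>R e1 + 0 *\<^sub>R e2" and g2: "cart2 V = 1 *\<^sub>R h1 + 0 *\<^sub>R h2" and g3: "zc V = - kp *\<^sub>R cosp k"
    by (rule per_eqI, simp add: cart1_def cart2_def V_def defs)+
  have d3: "pderiv_per (\<gamma> *\<^sub>R cosp k) ((- \<gamma> * ?k) *\<^sub>R sinp k)" "pderiv_per (\<gamma> *\<^sub>R sinp k) ((\<gamma> * ?k) *\<^sub>R cosp k)" for \<gamma>
    by (rule pderiv_per_rhs, (rule pderiv_per_intros pderiv_sinp pderiv_cosp)+, simp)+
  have vv: "h2_fun (v_k k) = vec3p ((-1) *\<^sub>R e1 + 0 *\<^sub>R e2) (1 *\<^sub>R h1 + 0 *\<^sub>R h2) (- kp *\<^sub>R cosp k)"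
    by (simp only: frame_V[symmetric] frame_vec3p g1 g2 g3)
  have p1: "pderiv_per ((-1) *\<^sub>R e1 + 0 *\<^sub>R e2) ((-1) *\<^sub>R h1 + (- ?k) *\<^sub>R h2)"
    "pderiv_per ((-1) *\<^sub>R h1 + (- ?k) *\<^sub>R h2) (?A *\<^sub>R e1 + (- ?B) *\<^sub>R e2)"
    by (rule pderiv_per_rhs[OF lin(1)], simp) (rule pderiv_per_rhs[OF lin(2)], simp add: power2_eq_square)
  have p2: "pderiv_per (1 *\<^sub>R h1 + 0 *\<^sub>R h2) ((-1) *\<^sub>R e1 + ?k *\<^sub>R e2)"
    "pderiv_per ((-1) *\<^sub>R e1 + ?k *\<^sub>R e2) ((- ?A) *\<^sub>R h1 + (- ?B) *\<^sub>R h2)"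
    by (rule pderiv_per_rhs[OF lin(2)], simp) (rule pderiv_per_rhs[OF lin(1)], simp add: power2_eq_square)
  note pw = power2_eq_square power3_eq_cube power4_eq_xxxx
  have W1: "(-1) *\<^sub>R e1 + 0 *\<^sub>R e2 - (?A *\<^sub>R e1 + (- ?B) *\<^sub>R e2)
      + ((- (?A - - ?B * ?k) - (?A * ?k - - ?B) * ?k) *\<^sub>R e1 + ((?A - - ?B * ?k) * ?k + (?A * ?k - - ?B)) *\<^sub>R e2)
      = ?al *\<^sub>R e2 - ?be *\<^sub>R e1"
    by (rule per_eqI) (simp add: pw algebra_simps)
  have W2: "1 *\<^sub>R h1 + 0 *\<^sub>R h2 - ((- ?A) *\<^sub>R h1 + (- ?B) *\<^sub>R h2)
      + (((- (- ?A) - (- ?B) * ?k) - ((- ?A) * ?k + - ?B) * ?k) *\<^sub>R h1 + ((- (- ?A) - (- ?B) * ?k) * ?k - ((- ?A) * ?k + - ?B)) *\<^sub>R h2)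
      = ?al *\<^sub>R h2 + ?be *\<^sub>R h1"
    by (rule per_eqI) (simp add: pw algebra_simps)
  have W3: "- kp *\<^sub>R cosp k - ((- (- kp) * ?k) * ?k) *\<^sub>R cosp k + ((- ((- (- kp) * ?k) * ?k) * ?k) * ?k) *\<^sub>R cosp k = (- ?ga) *\<^sub>R cosp k"
    by (rule per_eqI) (simp add: pw algebra_simps)
  have eq: "u \<bullet> v_k k = 2 * pi * mean (cart1 z * (?al *\<^sub>R e2 - ?be *\<^sub>R e1) + cart2 z * (?al *\<^sub>R h2 + ?be *\<^sub>R h1) + zc z * ((- ?ga) *\<^sub>R cosp k))"
    using inner_h2_vec3p[OF u[unfolded frame_vec3p] vv pderiv_cart[OF z(1)] zc(1) c zc(2)
      p1 lin(1) lin(2) p2 lin(2) lin(1) d3(1) d3(2) d3(1) d3(2)] unfolding W1 W2 W3 .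
  have "cart1 z * (?al *\<^sub>R e2 - ?be *\<^sub>R e1) + cart2 z * (?al *\<^sub>R h2 + ?be *\<^sub>R h1) + zc z * ((- ?ga) *\<^sub>R cosp k)
     = ?al *\<^sub>R (cosp k * za z) + ?be *\<^sub>R (sinp k * zb z) - ?ga *\<^sub>R (cosp k * zc z)"
  proof (rule per_eqI)
    fix x
    let ?S = "sin (?k * x)" and ?C = "cos (?k * x)" and ?s = "sin x" and ?c = "cos x"
    let ?a = "ev (za z) x" and ?b = "ev (zb z) x"
    \<comment> \<open>The fourth order expression in \<open>v_k\<close> has frame components
      \<open>al * ?C\<close> and \<open>be * ?S\<close>; both vectors are rotated by the same angle,
      so their inner product is that of the frame components.\<close>
    have "(?c * ?a - ?s * ?b) * (al * (?C * ?c) - be * (?S * ?s)) + (?s * ?a + ?c * ?b) * (al * (?C * ?s) + be * (?S * ?c))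
      = al * (?C * ?a) + be * (?S * ?b)" for al be
      using sin_cos_squared_add3[of x] by algebra
    then show "ev (cart1 z * (?al *\<^sub>R e2 - ?be *\<^sub>R e1) + cart2 z * (?al *\<^sub>R h2 + ?be *\<^sub>R h1) + zc z * ((- ?ga) *\<^sub>R cosp k)) x
      = ev (?al *\<^sub>R (cosp k * za z) + ?be *\<^sub>R (sinp k * zb z) - ?ga *\<^sub>R (cosp k * zc z)) x"
      by (simp add: cart1_def cart2_def defs mult.commute[of "ev (zc z) x"])
  qed
  with eq show ?thesis by (simp only: ell_def)
qed


text \<open>The differential equations of \<open>lin_sol\<close> read as a formula for the
  derivative of the state. As a bounded linear map it carries smoothness in \<open>t\<close> over to
  that derivative.\<close>

definition rhs :: "real \<times> state \<times> data \<Rightarrow> state" where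
  "rhs q = (0, d1 (snd (snd q)), d2 (snd (snd q)),
     (1/R) *\<^sub>R (zn (fst (snd q)) *\<^sub>R 1 - kap *\<^sub>R zc (fst (snd q))) + ((kp / R) * fst q) *\<^sub>R cosp k + d3 (snd (snd q)),
     (1/R) *\<^sub>R zy (fst (snd q)) + ((1 / R) * fst q) *\<^sub>R sinp k + d4 (snd (snd q)),
     (- ((real k)\<^sup>2 * R)) *\<^sub>R zc (fst (snd q)) + ((kap / R) * zn (fst (snd q))) *\<^sub>R 1 - kap *\<^sub>R za (fst (snd q))
       + zs (fst (snd q)) + (real k * fst q) *\<^sub>R cosp k + kap *\<^sub>R d3 (snd (snd q)) - d5 (snd (snd q)))"

text \<open>The derivative of \<open>rhs\<close> in \<eta> at fixed multiplier, in terms of the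
  derivatives of state and data: the constant terms with \<open>zn\<close> drop out and the modes
  are differentiated.\<close>

definition rhs' :: "real \<times> state \<times> data \<Rightarrow> state" where
  "rhs' q = (0, d1 (snd (snd q)), d2 (snd (snd q)),
     (- (kap / R)) *\<^sub>R zc (fst (snd q)) + ((- (kp * real k / R)) * fst q) *\<^sub>R sinp k + d3 (snd (snd q)),
     (1/R) *\<^sub>R zy (fst (snd q)) + ((real k / R) * fst q) *\<^sub>R cosp k + d4 (snd (snd q)),
     (- ((real k)\<^sup>2 * R)) *\<^sub>R zc (fst (snd q)) - kap *\<^sub>R za (fst (snd q))
       + zs (fst (snd q)) + ((- (real k * real k)) * fst q) *\<^sub>R sinp k + kap *\<^sub>R d3 (snd (snd q)) - d5 (snd (snd q)))"

lemma bounded_linear_rhs: "bounded_linear rhs" "bounded_linear rhs'"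
  unfolding rhs_def[abs_def] rhs'_def[abs_def]
  by (intro per_linear_intros bounded_linear_fst bounded_linear_snd bounded_linear_fst_comp bounded_linear_snd_comp
      bounded_linear_zero)+

lemma pder_rhs: "lin_sol m z d \<Longrightarrow> pder_state z (rhs (m, z, d))"
  by (simp add: lin_sol_def pder_state_def rhs_def mult.commute)

lemma pder_rhs':
  assumes "pder_state z z'" "pder_data d d'"
  shows "pder_state (rhs (m, z, d)) (rhs' (m, z', d'))"
proof -
  have z: "pderiv_per (za z) (za z')" "pderiv_per (zs z) (zs z')" "pderiv_per (zb z) (zb z')"
    "pderiv_per (zc z) (zc z')" "pderiv_per (zy z) (zy z')" and
    d: "pderiv_per (d1 d) (d1 d')" "pderiv_per (d2 d) (d2 d')" "pderiv_per (d3 d) (d3 d')"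
    "pderiv_per (d4 d) (d4 d')" "pderiv_per (d5 d) (d5 d')"
    using assms by (auto simp: pder_state_def pder_data_def)
  show ?thesis
    unfolding pder_state_def rhs_def rhs'_def sel_tuple fst_conv snd_conv
    by (intro conjI refl d; rule pderiv_per_rhs, (rule pderiv_per_intros z d pderiv_sinp pderiv_cosp)+,
        rule per_eqI, simp add: algebra_simps)
qed

lemma pder_dP: "pder_state z z' \<Longrightarrow> pder_data (dP \<mu> z) (dP \<mu> z')"
  by (auto simp: pder_state_def pder_data_def dP_def intro!: pderiv_per_intros)

lemma pder_dQ:
  assumes "pder_state z z'" "pder_state w w'"
  shows "pder_data (dQ z w) (dQ z' w + dQ z w')"
proof -
  have z: "zn z' = 0" "pderiv_per (za z) (za z')" "pderiv_per (zb z) (zb z')" "pderiv_per (zc z) (zc z')"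
    "pderiv_per (zp z) (zp z')" "pderiv_per (zq z) (zq z')"
    using assms(1) by (auto simp: pder_state_def zp_def zq_def intro!: pderiv_per_intros)
  have w: "pderiv_per (za w) (za w')" "pderiv_per (zb w) (zb w')" "pderiv_per (zc w) (zc w')"
    using assms(2) by (auto simp: pder_state_def)
  show ?thesis
    unfolding pder_data_def sel_linear unfolding dQ_def sel_tuple z(1)
    by (intro conjI; rule pderiv_per_rhs, (rule pderiv_per_intros z w)+, rule per_eqI, simp add: algebra_simps add_divide_distrib diff_divide_distrib)
qed

lemma lift_branch:
  assumes I: "open I" and sm: "smooth_curve_on I (\<lambda>t. (\<mu> t, w t))"
    and L: "\<And>t. t \<in> I \<Longrightarrow> lin_sol (\<mu> t) (w t) (dP (\<mu> t) (w t) + t *\<^sub>R dQ (V + w t) (V + w t))"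
  obtains \<Gamma> where "smooth_curve_on I \<Gamma>"
    "\<And>t. t \<in> I \<Longrightarrow> h2_fun (\<Gamma> t) = frame (w t) \<and> \<Gamma> t \<bullet> v_k k = 2 * pi * ell (w t)"
proof -
  \<comment> \<open>Primes below denote derivatives in \<eta>, not in \<open>t\<close>;
    \<open>d'\<close> is the Leibniz rule applied to \<open>d\<close>, with the parameter shift and
    \<open>t\<close> held fixed.\<close>
  define d where "d t = dP (\<mu> t) (w t) + t *\<^sub>R dQ (V + w t) (V + w t)" for t
  define w' where "w' t = rhs (\<mu> t, w t, d t)" for t
  define V' where "V' = rhs (0, V, 0)"
  define d' where "d' t = dP (\<mu> t) (w' t) + t *\<^sub>R (dQ (V' + w' t) (V + w t) + dQ (V + w t) (V' + w' t))" for t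
  define w'' where "w'' t = rhs' (\<mu> t, w' t, d' t)" for t
  have V': "pder_state V V'" unfolding V'_def by (rule pder_rhs[OF lin_sol_V])
  have p1: "pder_state (w t) (w' t)" if "t \<in> I" for t
    unfolding w'_def d_def by (rule pder_rhs[OF L[OF that]])
  have p2: "pder_state (w' t) (w'' t)" if t: "t \<in> I" for t
  proof -
    have "pder_data (d t) (d' t)"
      unfolding d_def d'_def by (intro pder_linear pder_dP pder_dQ p1[OF t] V')
    from pder_rhs'[OF p1[OF t] this] show ?thesis by (simp add: w'_def w''_def)
  qed
  define \<Gamma> where "\<Gamma> t = lift_state (w t, w' t, w'' t)" for t
  have "Cn_on n I \<Gamma>" for n
  proof -
    have c: "Cn_on n I (\<lambda>t. (\<mu> t, w t))" by (rule Cn_on_if_smooth_curve_on[OF sm I])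
    have \<mu>: "Cn_on n I \<mu>" and w: "Cn_on n I w"
      using Cn_on_linear[OF bounded_linear_fst c] Cn_on_linear[OF bounded_linear_snd c] by simp_all
    have Vw: "Cn_on n I (\<lambda>t. V + w t)" by (intro Cn_on_add Cn_on_const w)
    have d: "Cn_on n I d"
      unfolding d_def
      by (intro Cn_on_add Cn_on_bilinear[OF bounded_bilinear_dP \<mu> w]
          Cn_on_bilinear[OF bounded_bilinear_scaleR Cn_on_ident] Cn_on_bilinear[OF bounded_bilinear_dQ Vw Vw])
    have w': "Cn_on n I w'"
      unfolding w'_def by (intro Cn_on_linear[OF bounded_linear_rhs(1)] Cn_on_Pair \<mu> w d)
    have Vw': "Cn_on n I (\<lambda>t. V' + w' t)" by (intro Cn_on_add Cn_on_const w')
    have d': "Cn_on n I d'"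
      unfolding d'_def
      by (intro Cn_on_add Cn_on_bilinear[OF bounded_bilinear_dP \<mu> w']
          Cn_on_bilinear[OF bounded_bilinear_scaleR Cn_on_ident] Cn_on_bilinear[OF bounded_bilinear_dQ Vw' Vw]
          Cn_on_bilinear[OF bounded_bilinear_dQ Vw Vw'])
    have w'': "Cn_on n I w''"
      unfolding w''_def by (intro Cn_on_linear[OF bounded_linear_rhs(2)] Cn_on_Pair \<mu> w' d')
    show ?thesis
      unfolding \<Gamma>_def by (intro Cn_on_linear[OF bounded_linear_lift_state] Cn_on_Pair w w' w'')
  qed
  then have "smooth_curve_on I \<Gamma>" by (rule smooth_curve_on_if_Cn_on[OF I])
  moreover have "h2_fun (\<Gamma> t) = frame (w t) \<and> \<Gamma> t \<bullet> v_k k = 2 * pi * ell (w t)" if "t \<in> I" for t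
    using lift_state_frame[OF p1[OF that] p2[OF that]] inner_v_k[OF _ p1[OF that] p2[OF that]]
    unfolding \<Gamma>_def by blast
  ultimately show thesis by (rule that)
qed

lemma inner_v_k_self: "v_k k \<bullet> v_k k > 0"
proof -
  have 1: "pder_state V (rhs (0, V, 0))" by (rule pder_rhs[OF lin_sol_V])
  have "pder_state (rhs (0, V, 0)) (rhs' (0, rhs (0, V, 0), 0))"
    by (rule pder_rhs'[OF 1]) (simp add: pder_data_def pderiv_per_intros)
  then show ?thesis using inner_v_k[OF frame_V[symmetric] 1] ell_V by simp
qed

lemma frame_refl: "rev_state z \<Longrightarrow> frame z (- \<eta>) = S_refl (frame z \<eta>)"
  by (simp add: frame_def rev_state_def even_per_def odd_per_def vec3_simps)

lemma nonlin_sol_zero: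
  assumes z: "nonlin_sol \<mu> z" "rev_state z" and u: "h2_fun u = frame z"
    and x: "x = (\<lambda>\<eta>. x0 R \<eta> + h2_fun u \<eta>)"
  shows "u \<in> Y_rev" "G_zero R (kap + \<mu>) u" "norm (x \<eta>) = R"
    "cross3 (x \<eta>) (D2 x \<eta>) - (kap + \<mu>) *\<^sub>R cross3 e3 (x \<eta>) + (kap + \<mu>) *\<^sub>R D1 x \<eta> = 0"
proof -
  note s = frame_sys_imp_system[OF z(1)[unfolded nonlin_sol_iff_frame_sys] z(2) x[unfolded u] refl]
  show "u \<in> Y_rev" by (rule Y_revI) (simp add: u frame_refl[OF z(2)])
  show "norm (x \<eta>) = R" by (rule s)
  show "G_zero R (kap + \<mu>) u" "cross3 (x \<eta>) (D2 x \<eta>) - (kap + \<mu>) *\<^sub>R cross3 e3 (x \<eta>) + (kap + \<mu>) *\<^sub>R D1 x \<eta> = 0"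
    by (rule system_imp_zero[OF R x s])+
qed

text \<open>The Sobolev bound turns \<open>10 * norm u < R\<close> into the pointwise smallness that
  makes \<open>x \<cdot> E1\<close> positive. The bounds on \<open>norm u\<close> and
  \<open>\<mu>\<close> enter the linear estimate for \<open>z\<close>.\<close>

lemma zero_nonlin_sol:
  assumes "u \<in> Y_rev" "G_rev_zero R (kap + \<mu>) u" "norm u \<le> 1" "10 * norm u < R" "\<bar>\<mu>\<bar> \<le> kap"
  shows "\<exists>z. rev_state z \<and> nonlin_sol \<mu> z \<and> frame z = h2_fun u \<and>
    norm z \<le> 6 * (20 * R + 100 + 20 * kap + 10 * R + 10 * kap + 10) * norm u"
proof -
  have "norm (h2_fun u \<eta>) < R" for \<eta> using h2_sup_le(1)[of u \<eta>] assms(4) by linarith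
  note s = zero_imp_system[OF R refl assms(2) this refl]
  show ?thesis
    unfolding nonlin_sol_iff_frame_sys
    by (rule system_imp_frame_sys[OF refl assms(1) refl s order_refl assms(3,5)])
qed

theorem bifurcation:
  "bifurcation_point_rev R (kap, 0) \<and>
   (\<exists>\<delta>>0. \<exists>\<Lambda> :: real \<Rightarrow> real. \<exists>\<Gamma> :: real \<Rightarrow> (real^3) h2. \<exists>\<rho>>0.
      smooth_curve_on {-\<delta><..<\<delta>} \<Lambda> \<and> (\<forall>t\<in>{-\<delta><..<\<delta>}. \<Lambda> t > 0) \<and> \<Lambda> 0 = kap \<and>
      smooth_curve_on {-\<delta><..<\<delta>} \<Gamma> \<and> (\<forall>t\<in>{-\<delta><..<\<delta>}. \<Gamma> t \<in> Y_rev_k k) \<and> \<Gamma> 0 = 0 \<and>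
      ((\<lambda>t. t *\<^sub>R (v_k k + \<Gamma> t)) has_vector_derivative v_k k) (at 0) \<and>
      \<rho> \<le> kap \<and>
      (\<forall>lam w. \<bar>lam - kap\<bar> < \<rho> \<longrightarrow> norm w < \<rho> \<longrightarrow> w \<in> Y_rev \<longrightarrow> G_rev_zero R lam w \<longrightarrow>
          w = 0 \<or> (\<exists>t\<in>{-\<delta><..<\<delta>}. lam = \<Lambda> t \<and> w = t *\<^sub>R (v_k k + \<Gamma> t))) \<and>
      (\<forall>t\<in>{-\<delta><..<\<delta>}. t *\<^sub>R (v_k k + \<Gamma> t) \<in> Y_rev \<and> G_zero R (\<Lambda> t) (t *\<^sub>R (v_k k + \<Gamma> t)) \<and>
         (\<forall>x. x = (\<lambda>\<eta>. x0 R \<eta> + h2_fun (t *\<^sub>R (v_k k + \<Gamma> t)) \<eta>) \<longrightarrow>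
            (\<forall>\<eta>. cross3 (x \<eta>) (D2 x \<eta>) - \<Lambda> t *\<^sub>R cross3 e3 (x \<eta>) + \<Lambda> t *\<^sub>R D1 x \<eta> = 0) \<and>
            (\<forall>\<eta>. norm (x \<eta>) = R))))"
proof -
  obtain \<delta>0 \<rho>0 \<mu> w where br: "0 < \<delta>0 \<and> 0 < \<rho>0 \<and> \<mu> 0 = 0 \<and> w 0 = 0 \<and>
    smooth_curve_on {-\<delta>0<..<\<delta>0} (\<lambda>t. (\<mu> t, w t)) \<and>
    (\<forall>t. \<bar>t\<bar> < \<delta>0 \<longrightarrow> rev_state (w t) \<and> ell (w t) = 0 \<and> nonlin_sol (\<mu> t) (t *\<^sub>R (V + w t)) \<and>
      lin_sol (\<mu> t) (w t) (dP (\<mu> t) (w t) + t *\<^sub>R dQ (V + w t) (V + w t))) \<and>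
    (\<forall>\<nu> z. \<bar>\<nu>\<bar> < \<rho>0 \<longrightarrow> norm z < \<rho>0 \<longrightarrow> rev_state z \<longrightarrow> nonlin_sol \<nu> z \<longrightarrow>
       z = 0 \<or> (\<exists>t. \<bar>t\<bar> < \<delta>0 \<and> \<nu> = \<mu> t \<and> z = t *\<^sub>R (V + w t)))"
    using rev_branch by (elim exE) (rule that)
  have b: "\<delta>0 > 0" "\<rho>0 > 0" "\<mu> 0 = 0" "w 0 = 0"
    "smooth_curve_on {-\<delta>0<..<\<delta>0} (\<lambda>t. (\<mu> t, w t))"
    "\<And>t. \<bar>t\<bar> < \<delta>0 \<Longrightarrow> rev_state (w t) \<and> ell (w t) = 0 \<and> nonlin_sol (\<mu> t) (t *\<^sub>R (V + w t))"
    "\<And>t. \<bar>t\<bar> < \<delta>0 \<Longrightarrow> lin_sol (\<mu> t) (w t) (dP (\<mu> t) (w t) + t *\<^sub>R dQ (V + w t) (V + w t))"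
    "\<And>\<nu> z. \<bar>\<nu>\<bar> < \<rho>0 \<Longrightarrow> norm z < \<rho>0 \<Longrightarrow> rev_state z \<Longrightarrow> nonlin_sol \<nu> z \<Longrightarrow>
       z = 0 \<or> (\<exists>t. \<bar>t\<bar> < \<delta>0 \<and> \<nu> = \<mu> t \<and> z = t *\<^sub>R (V + w t))"
    using br by blast+
  let ?J = "{-\<delta>0<..<\<delta>0}"
  have I0: "t \<in> ?J \<longleftrightarrow> \<bar>t\<bar> < \<delta>0" for t by auto
  obtain \<Gamma> where \<Gamma>: "smooth_curve_on ?J \<Gamma>"
    "\<And>t. t \<in> ?J \<Longrightarrow> h2_fun (\<Gamma> t) = frame (w t) \<and> \<Gamma> t \<bullet> v_k k = 2 * pi * ell (w t)"
    by (rule lift_branch[OF _ b(5)]) (use b(7) in \<open>auto simp: abs_less_iff\<close>)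
  have \<mu>C: "Cn_on n ?J \<mu>" for n
    using Cn_on_linear[OF bounded_linear_fst Cn_on_if_smooth_curve_on[OF b(5)]] by simp
  define \<Lambda> where "\<Lambda> t = kap + \<mu> t" for t
  have smL: "smooth_curve_on ?J \<Lambda>"
    unfolding \<Lambda>_def by (rule smooth_curve_on_if_Cn_on) (auto intro: Cn_on_add \<mu>C)
  have in0: "0 \<in> ?J" using b(1) by simp
  have "isCont \<mu> 0"
    using \<mu>C[of 0] in0 by (simp add: continuous_on_eq_continuous_at)
  then have "\<forall>\<^sub>F t in nhds 0. dist (\<mu> t) (\<mu> 0) < kap"
    using kap_pos unfolding continuous_at tendsto_at_iff_tendsto_nhds by (rule tendstoD)
  then obtain \<delta>1 where \<delta>1: "\<delta>1 > 0" "\<And>t. \<bar>t\<bar> < \<delta>1 \<Longrightarrow> \<bar>\<mu> t\<bar> < kap"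
    using b(3) by (auto simp: eventually_nhds_metric dist_real_def)
  \<comment> \<open>The restriction to \<open>\<delta>1\<close> keeps \<open>\<Lambda>\<close>
    positive on the whole interval.\<close>
  define \<delta> where "\<delta> = min \<delta>0 \<delta>1"
  have \<delta>: "\<delta> > 0" "\<delta> \<le> \<delta>0" using b(1) \<delta>1(1) by (auto simp: \<delta>_def)
  let ?I = "{-\<delta><..<\<delta>}"
  have I: "\<bar>t\<bar> < \<delta>0" "\<bar>t\<bar> < \<delta>1" "t \<in> ?J" if "t \<in> ?I" for t
    using that by (auto simp: \<delta>_def)
  have sub: "?I \<subseteq> ?J" using \<delta>(2) by auto
  have sm: "smooth_curve_on ?I \<Lambda>" "smooth_curve_on ?I \<Gamma>"
    by (rule smooth_curve_on_subset[OF smL sub], rule smooth_curve_on_subset[OF \<Gamma>(1) sub])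
  have \<Lambda>pos: "\<Lambda> t > 0" if "t \<in> ?I" for t
    using \<delta>1(2)[OF I(2)[OF that]] by (auto simp: \<Lambda>_def)
  define u where "u t = t *\<^sub>R (v_k k + \<Gamma> t)" for t
  have hu: "h2_fun (u t) = frame (t *\<^sub>R (V + w t))" if "t \<in> ?J" for t
    using \<Gamma>(2)[OF that]
    by (auto simp: u_def scaleR_h2.rep_eq plus_h2.rep_eq frame_linear frame_V)
  have \<Gamma>0: "\<Gamma> 0 = 0"
    using \<Gamma>(2)[OF in0] b(4) by (intro h2_fun_inject[THEN iffD1]) (auto simp: zero_h2.rep_eq frame_linear)
  have \<Gamma>Y: "\<Gamma> t \<in> Y_rev_k k" if t: "t \<in> ?I" for t
  proof -
    have "rev_state (w t)" "ell (w t) = 0" using b(6)[OF I(1)[OF t]] by auto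
    then show ?thesis
      using \<Gamma>(2)[OF I(3)[OF t]] by (auto simp: Y_rev_k_def frame_refl intro!: Y_revI)
  qed
  have ru: "rev_state (t *\<^sub>R (V + w t))" if "\<bar>t\<bar> < \<delta>0" for t
    using b(6)[OF that] by (intro rev_state_linear rev_V) auto
  have zc: "u t \<in> Y_rev \<and> G_zero R (\<Lambda> t) (u t) \<and>
         (\<forall>x. x = (\<lambda>\<eta>. x0 R \<eta> + h2_fun (u t) \<eta>) \<longrightarrow>
            (\<forall>\<eta>. cross3 (x \<eta>) (D2 x \<eta>) - \<Lambda> t *\<^sub>R cross3 e3 (x \<eta>) + \<Lambda> t *\<^sub>R D1 x \<eta> = 0) \<and>
            (\<forall>\<eta>. norm (x \<eta>) = R))" if t: "t \<in> ?I" for t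
  proof -
    have "nonlin_sol (\<mu> t) (t *\<^sub>R (V + w t))" using b(6)[OF I(1)[OF t]] by simp
    note n = nonlin_sol_zero[OF this ru[OF I(1)[OF t]] hu[OF I(3)[OF t]]]
    show ?thesis using n unfolding \<Lambda>_def by blast
  qed
  obtain \<Gamma>' where "(\<Gamma> has_vector_derivative \<Gamma>') (at 0)"
    by (rule smooth_curve_on_imp_differentiable[OF \<Gamma>(1) in0]) auto
  then have "((\<lambda>t. v_k k + \<Gamma> t) has_vector_derivative (0 + \<Gamma>')) (at 0)"
    by (intro has_vector_derivative_add has_vector_derivative_const)
  from has_vector_derivative_scaleR[OF DERIV_ident this]
  have du: "(u has_vector_derivative v_k k) (at 0)" by (simp add: u_def[abs_def] \<Gamma>0)
  obtain L where L: "\<And>z. norm (ell z) \<le> norm z * L" "L > 0"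
    using bounded_linear.pos_bounded[OF bounded_linear_ell] by auto
  define K' where "K' = 6 * (20 * R + 100 + 20 * kap + 10 * R + 10 * kap + 10)"
  have K': "K' > 0" using R kap_pos by (simp add: K'_def)
  \<comment> \<open>The first bounds provide the smallness in \<open>zero_nonlin_sol\<close> and
    positivity of the parameter, those by \<open>\<rho>0\<close> put parameter shift and state into
    the uniqueness region, and the last one forces the curve parameter into the reduced
    interval.\<close>
  have "\<forall>\<^sub>F \<rho> in at_right 0. 0 < \<rho> \<and> \<rho> < kap \<and> \<rho> < 1 \<and> 10 * \<rho> < R \<and> \<rho> < \<rho>0 \<and> K' * \<rho> < \<rho>0 \<and> K' * \<rho> * L / ell V < \<delta>"
  proof (intro eventually_conj)
    show "\<forall>\<^sub>F \<rho>::real in at_right 0. 0 < \<rho>" by (rule eventually_at_right_less)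
    have t: "(f \<longlongrightarrow> 0) (at_right 0) \<Longrightarrow> 0 < c \<Longrightarrow> \<forall>\<^sub>F \<rho> in at_right 0. f \<rho> < c" for f :: "real \<Rightarrow> real" and c
      by (rule order_tendstoD(2))
    show "\<forall>\<^sub>F \<rho> in at_right 0. \<rho> < kap" "\<forall>\<^sub>F \<rho>::real in at_right 0. \<rho> < 1" "\<forall>\<^sub>F \<rho> in at_right 0. \<rho> < \<rho>0"
      by (rule t; use kap_pos b(2) in simp)+
    show "\<forall>\<^sub>F \<rho> in at_right 0. 10 * \<rho> < R" "\<forall>\<^sub>F \<rho> in at_right 0. K' * \<rho> < \<rho>0"
      "\<forall>\<^sub>F \<rho> in at_right 0. K' * \<rho> * L / ell V < \<delta>"
      by (rule t; use R b(2) \<delta>(1) ell_V in \<open>auto intro!: tendsto_eq_intros\<close>)+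
  qed
  then obtain \<rho> where \<rho>: "0 < \<rho>" "\<rho> < kap" "\<rho> < 1" "10 * \<rho> < R" "\<rho> < \<rho>0" "K' * \<rho> < \<rho>0" "K' * \<rho> * L / ell V < \<delta>"
    using eventually_happens by (metis (mono_tags, lifting) trivial_limit_at_right_real)
  have uniq: "v = 0 \<or> (\<exists>t\<in>?I. lam = \<Lambda> t \<and> v = u t)"
    if v: "\<bar>lam - kap\<bar> < \<rho>" "norm v < \<rho>" "v \<in> Y_rev" "G_rev_zero R lam v" for lam v
  proof -
    define \<nu> where "\<nu> = lam - kap"
    have lam: "lam = kap + \<nu>" by (simp add: \<nu>_def)
    have "\<exists>z. rev_state z \<and> nonlin_sol \<nu> z \<and> frame z = h2_fun v \<and> norm z \<le> K' * norm v"
      unfolding K'_def by (rule zero_nonlin_sol) (use v \<rho> in \<open>auto simp: \<nu>_def\<close>)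
    then obtain z where z: "rev_state z" "nonlin_sol \<nu> z" "frame z = h2_fun v" "norm z \<le> K' * norm v" by blast
    have nz: "norm z \<le> K' * \<rho>"
      by (rule order_trans[OF z(4)], rule mult_left_mono) (use v(2) K' in auto)
    have "z = 0 \<or> (\<exists>t. \<bar>t\<bar> < \<delta>0 \<and> \<nu> = \<mu> t \<and> z = t *\<^sub>R (V + w t))"
      by (rule b(8)) (use v(1) \<rho> nz z in \<open>auto simp: \<nu>_def\<close>)
    then show ?thesis
    proof
      assume "z = 0"
      then have "h2_fun v = h2_fun 0"
        by (intro ext) (simp add: z(3)[symmetric] frame_linear zero_h2.rep_eq)
      then show ?thesis by (simp add: h2_fun_inject)
    next
      assume "\<exists>t. \<bar>t\<bar> < \<delta>0 \<and> \<nu> = \<mu> t \<and> z = t *\<^sub>R (V + w t)"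
      then obtain t where t: "\<bar>t\<bar> < \<delta>0" "\<nu> = \<mu> t" "z = t *\<^sub>R (V + w t)" by blast
      \<comment> \<open>Uniqueness alone gives only \<open>\<bar>t\<bar> < \<delta>0\<close>. Since
        \<open>ell (w t) = 0\<close>, the functional \<open>ell\<close> reads off \<open>t\<close>
        from \<open>z\<close>, and smallness of \<open>z\<close> improves this to
        \<open>\<bar>t\<bar> < \<delta>\<close>.\<close>
      have "ell z = t * ell V" using b(6)[OF t(1)] by (simp add: t(3))
      then have "\<bar>t\<bar> = norm (ell z) / ell V" using ell_V by (simp add: abs_mult)
      also have "\<dots> \<le> K' * \<rho> * L / ell V"
        using order_trans[OF L(1)[of z] mult_right_mono[OF nz, of L]] L(2) ell_V by (intro divide_right_mono) auto
      finally have "\<bar>t\<bar> < \<delta>" using \<rho>(7) by simp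
      then have tI: "t \<in> ?I" by auto
      have "h2_fun v = h2_fun (u t)" using z(3) hu[OF I(3)[OF tI]] t(3) by simp
      then have "v = u t" by (simp add: h2_fun_inject)
      then show ?thesis using tI t(2) lam by (auto simp: \<Lambda>_def)
    qed
  qed
  have "bifurcation_point_rev R (kap, 0)"
    unfolding bifurcation_point_rev_def
  proof
    show "(kap, 0) \<in> trivial_branch" using kap_pos by (simp add: trivial_branch_def)
    show "(kap, 0) \<in> closure {(lam, u). (lam, u) \<in> zeros_rev R \<and> u \<noteq> 0}"
      unfolding closure_approachable
    proof (intro allI impI)
      fix \<epsilon> :: real assume "\<epsilon> > 0"
      obtain \<Lambda>' where "(\<Lambda> has_vector_derivative \<Lambda>') (at 0)"
        by (rule smooth_curve_on_imp_differentiable[OF sm(1), of 0]) (use \<delta>(1) in auto)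
      then have "isCont \<Lambda> 0" by (rule has_vector_derivative_continuous)
      moreover have "isCont u 0" using du by (rule has_vector_derivative_continuous)
      ultimately have "((\<lambda>t. (\<Lambda> t, u t)) \<longlongrightarrow> (\<Lambda> 0, u 0)) (at 0)"
        unfolding isCont_def by (rule tendsto_Pair)
      then have "\<forall>\<^sub>F t in at 0. dist (\<Lambda> t, u t) (\<Lambda> 0, u 0) < \<epsilon>"
        using \<open>\<epsilon> > 0\<close> by (rule tendstoD)
      moreover have "\<forall>\<^sub>F t in at 0. t \<in> ?I" by (rule eventually_at_in_open') (use \<delta>(1) in auto)
      moreover have "\<forall>\<^sub>F t::real in at 0. t \<noteq> 0" by (rule eventually_neq_at_within)
      ultimately have "\<forall>\<^sub>F t in at 0. dist (\<Lambda> t, u t) (\<Lambda> 0, u 0) < \<epsilon> \<and> t \<in> ?I \<and> t \<noteq> 0"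
        by eventually_elim simp
      then obtain t where t: "dist (\<Lambda> t, u t) (\<Lambda> 0, u 0) < \<epsilon>" "t \<in> ?I" "t \<noteq> 0"
        using eventually_happens[of _ "at (0::real)"] by auto
      have "\<Lambda> 0 = kap" "u 0 = 0" by (simp_all add: \<Lambda>_def u_def b(3))
      moreover have "u t \<noteq> 0"
      proof
        assume "u t = 0"
        \<comment> \<open>Orthogonality of \<open>\<Gamma> t\<close> to \<open>v_k\<close> leaves
          \<open>t\<close> as the coefficient along \<open>v_k\<close>, so the zeros with
          \<open>t \<noteq> 0\<close> are nontrivial.\<close>
        have "u t \<bullet> v_k k = t * (v_k k \<bullet> v_k k)"
          using \<Gamma>Y[OF t(2)] by (simp add: u_def inner_add_left Y_rev_k_def)
        then show False using \<open>u t = 0\<close> inner_v_k_self t(3) by simp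
      qed
      moreover have "(\<Lambda> t, u t) \<in> zeros_rev R"
        using zc[OF t(2)] \<Lambda>pos[OF t(2)] G_zero_imp_G_rev_zero by (auto simp: zeros_rev_def)
      ultimately show "\<exists>y\<in>{(lam, u). (lam, u) \<in> zeros_rev R \<and> u \<noteq> 0}. dist y (kap, 0) < \<epsilon>"
        using t(1) by (intro bexI[of _ "(\<Lambda> t, u t)"]) auto
    qed
  qed
  then show ?thesis
  proof (rule conjI, intro exI conjI)
    show "\<Lambda> 0 = kap" by (simp add: \<Lambda>_def b(3))
    show "((\<lambda>t. t *\<^sub>R (v_k k + \<Gamma> t)) has_vector_derivative v_k k) (at 0)"
      using du unfolding u_def[abs_def] .
    show "\<forall>lam w. \<bar>lam - kap\<bar> < \<rho> \<longrightarrow> norm w < \<rho> \<longrightarrow> w \<in> Y_rev \<longrightarrow> G_rev_zero R lam w \<longrightarrow>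
          w = 0 \<or> (\<exists>t\<in>?I. lam = \<Lambda> t \<and> w = t *\<^sub>R (v_k k + \<Gamma> t))"
      using uniq unfolding u_def by blast
    show "\<forall>t\<in>?I. t *\<^sub>R (v_k k + \<Gamma> t) \<in> Y_rev \<and> G_zero R (\<Lambda> t) (t *\<^sub>R (v_k k + \<Gamma> t)) \<and>
         (\<forall>x. x = (\<lambda>\<eta>. x0 R \<eta> + h2_fun (t *\<^sub>R (v_k k + \<Gamma> t)) \<eta>) \<longrightarrow>
            (\<forall>\<eta>. cross3 (x \<eta>) (D2 x \<eta>) - \<Lambda> t *\<^sub>R cross3 e3 (x \<eta>) + \<Lambda> t *\<^sub>R D1 x \<eta> = 0) \<and>
            (\<forall>\<eta>. norm (x \<eta>) = R))"
      using zc unfolding u_def by blast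
  qed (use \<delta>(1) sm \<Lambda>pos \<Gamma>Y \<Gamma>0 \<rho>(1,2) in \<open>auto intro: less_imp_le\<close>)
qed

end

theorem theorem3p1:
  fixes R :: real and k :: nat
  assumes "R > 0" and "k \<ge> 2"
  shows
    "(\<forall>lam>0. \<forall>u\<in>Y_rev. G_rev R lam u \<in> Z_rev) \<and>
     bifurcation_point_rev R (lam_k R k, 0) \<and>
     (\<exists>\<delta>>0. \<exists>U. \<exists>\<Lambda> :: real \<Rightarrow> real. \<exists>\<Gamma> :: real \<Rightarrow> (real^3) h2. \<exists>\<rho>>0.
        let u = (\<lambda>t. t *\<^sub>R (v_k k + \<Gamma> t)) in
        (openin (top_of_set ({0<..} \<times> Y_rev)) U \<and> (lam_k R k, 0) \<in> U \<and>
         smooth_curve_on {-\<delta><..<\<delta>} \<Lambda> \<and> \<Lambda> ` {-\<delta><..<\<delta>} \<subseteq> {0<..} \<and> \<Lambda> 0 = lam_k R k \<and>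
         smooth_curve_on {-\<delta><..<\<delta>} \<Gamma> \<and> \<Gamma> ` {-\<delta><..<\<delta>} \<subseteq> Y_rev_k k \<and> \<Gamma> 0 = 0 \<and>
         (\<forall>t\<in>{-\<delta><..<\<delta>}. (\<Lambda> t, u t) \<in> U \<and> G_rev_zero R (\<Lambda> t) (u t)) \<and>
         (u has_vector_derivative v_k k) (at 0)) \<and>
        (ball (lam_k R k, 0) \<rho> \<inter> UNIV \<times> Y_rev \<subseteq> {0<..} \<times> Y_rev \<and>
         (\<forall>lam w. (lam, w) \<in> ball (lam_k R k, 0) \<rho> \<and> w \<in> Y_rev \<and> G_rev_zero R lam w \<longrightarrow>
            w = 0 \<or> (\<exists>t\<in>{-\<delta><..<\<delta>}. (lam, w) = (\<Lambda> t, u t)))) \<and>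
        (\<forall>t\<in>{-\<delta><..<\<delta>}.
           G_zero R (\<Lambda> t) (u t) \<and>
           (let x = (\<lambda>\<eta>. x0 R \<eta> + h2_fun (u t) \<eta>) in
              (AE \<eta> in lebesgue.
                 cross3 (x \<eta>) (D2 x \<eta>) - \<Lambda> t *\<^sub>R cross3 e3 (x \<eta>) + \<Lambda> t *\<^sub>R D1 x \<eta> = 0) \<and>
              (\<forall>\<eta>. norm (x \<eta>) = R))))"
proof -
  interpret mode R k by unfold_locales (use assms in auto)
  have kap: "lam_k R k = kap" by (simp add: lam_k_def kap_def)
  obtain \<delta> \<Lambda> \<Gamma> \<rho> where b: "\<delta> > 0" "\<rho> > 0"
      "smooth_curve_on {-\<delta><..<\<delta>} \<Lambda>" "\<forall>t\<in>{-\<delta><..<\<delta>}. \<Lambda> t > 0" "\<Lambda> 0 = kap"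
      "smooth_curve_on {-\<delta><..<\<delta>} \<Gamma>" "\<forall>t\<in>{-\<delta><..<\<delta>}. \<Gamma> t \<in> Y_rev_k k" "\<Gamma> 0 = 0"
      "((\<lambda>t. t *\<^sub>R (v_k k + \<Gamma> t)) has_vector_derivative v_k k) (at 0)"
      "\<rho> \<le> kap"
    and uniq: "\<forall>lam w. \<bar>lam - kap\<bar> < \<rho> \<longrightarrow> norm w < \<rho> \<longrightarrow> w \<in> Y_rev \<longrightarrow> G_rev_zero R lam w \<longrightarrow>
          w = 0 \<or> (\<exists>t\<in>{-\<delta><..<\<delta>}. lam = \<Lambda> t \<and> w = t *\<^sub>R (v_k k + \<Gamma> t))"
    and z: "\<forall>t\<in>{-\<delta><..<\<delta>}. t *\<^sub>R (v_k k + \<Gamma> t) \<in> Y_rev \<and> G_zero R (\<Lambda> t) (t *\<^sub>R (v_k k + \<Gamma> t)) \<and>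
         (\<forall>x. x = (\<lambda>\<eta>. x0 R \<eta> + h2_fun (t *\<^sub>R (v_k k + \<Gamma> t)) \<eta>) \<longrightarrow>
            (\<forall>\<eta>. cross3 (x \<eta>) (D2 x \<eta>) - \<Lambda> t *\<^sub>R cross3 e3 (x \<eta>) + \<Lambda> t *\<^sub>R D1 x \<eta> = 0) \<and>
            (\<forall>\<eta>. norm (x \<eta>) = R))"
    using bifurcation by (elim conjE exE) (rule that, assumption+)
  \<comment> \<open>The whole domain can serve as the neighbourhood, since the curve stays in it for
    all \<open>t\<close> in the chosen interval.\<close>
  let ?U = "{0<..} \<times> Y_rev :: (real \<times> (real^3) h2) set"
  have ball: "\<bar>lam - kap\<bar> < \<rho> \<and> norm w < \<rho>" if "(lam, w) \<in> ball (kap, 0) \<rho>" for lam :: real and w :: "(real^3) h2"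
    using that dist_fst_le[of "(kap, 0)" "(lam, w)"] dist_snd_le[of "(kap, 0)" "(lam, w)"]
    by (auto simp: dist_real_def dist_norm abs_minus_commute)
  have Y0: "0 \<in> Y_rev" by (simp add: Y_rev_def zero_h2.rep_eq S_refl_def vec_eq_iff forall_3)
  show ?thesis
    unfolding Let_def kap
  proof (intro conjI exI ballI allI impI)
    show "bifurcation_point_rev R (kap, 0)" using bifurcation by blast
    show "G_rev R lam u \<in> Z_rev" if "u \<in> Y_rev" for lam u by (rule G_rev_in_Z_rev[OF that])
    show "openin (top_of_set ?U) ?U" by simp
    show "(kap, 0) \<in> ?U" using kap_pos Y0 by simp
    show "\<Lambda> ` {-\<delta><..<\<delta>} \<subseteq> {0<..}" "\<Gamma> ` {-\<delta><..<\<delta>} \<subseteq> Y_rev_k k" using b by auto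
    show "ball (kap, 0) \<rho> \<inter> UNIV \<times> Y_rev \<subseteq> ?U"
      using ball b(10) by fastforce
    show "w = 0 \<or> (\<exists>t\<in>{-\<delta><..<\<delta>}. (lam, w) = (\<Lambda> t, t *\<^sub>R (v_k k + \<Gamma> t)))"
      if "(lam, w) \<in> ball (kap, 0) \<rho> \<and> w \<in> Y_rev \<and> G_rev_zero R lam w" for lam w
      using uniq[rule_format, of lam w] ball[of lam w] that by auto
    fix t assume t: "t \<in> {-\<delta><..<\<delta>}"
    show "(\<Lambda> t, t *\<^sub>R (v_k k + \<Gamma> t)) \<in> ?U" using z[rule_format, OF t] b(4) t by auto
    show "G_rev_zero R (\<Lambda> t) (t *\<^sub>R (v_k k + \<Gamma> t))" using z t by (blast intro: G_zero_imp_G_rev_zero)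
    show "G_zero R (\<Lambda> t) (t *\<^sub>R (v_k k + \<Gamma> t))" using z t by blast
    show "AE \<eta> in lebesgue. cross3 (x0 R \<eta> + h2_fun (t *\<^sub>R (v_k k + \<Gamma> t)) \<eta>)
        (D2 (\<lambda>\<eta>. x0 R \<eta> + h2_fun (t *\<^sub>R (v_k k + \<Gamma> t)) \<eta>) \<eta>)
        - \<Lambda> t *\<^sub>R cross3 e3 (x0 R \<eta> + h2_fun (t *\<^sub>R (v_k k + \<Gamma> t)) \<eta>)
        + \<Lambda> t *\<^sub>R D1 (\<lambda>\<eta>. x0 R \<eta> + h2_fun (t *\<^sub>R (v_k k + \<Gamma> t)) \<eta>) \<eta> = 0"
      using z t by (intro AE_I2) simp
    show "norm (x0 R \<eta> + h2_fun (t *\<^sub>R (v_k k + \<Gamma> t)) \<eta>) = R" for \<eta>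
      using z t by simp
  qed (use b in auto)
qed

end
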